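(* Let $2\le k\le t$ be fixed integers. There exists $m_0$ such that for all $m\ge m_0$: if $G$ is a $K_{k+1,t+1}^+$-free graph with $m$ edges, then $\lambda(G)\le\lambda(S_{k,m})$, with equality if and only if $G=S_{k,m}$.
   Context: All graphs are finite and simple; isolated vertices are ignored. $K_{k+1,t+1}^+$ is the graph obtained from the complete bipartite graph $K_{k+1,t+1}$ by adding one edge inside the part of size $k+1$. Split graph: for $1\le k<m$, write $m-\binom{k}{2}=kt'+r$ with integers $t'\ge 1$ and $0\le r\le k-1$; $S_{k,m}$ is the $m$-edge graph obtained from $K_k\vee t'K_1$ (a clique $K_k$ joined to $t'$ independent vertices) by adding one extra vertex adjacent to exactly $r$ vertices of the $K_k$. $\lambda(G)$ is the spectral radius of the adjacency matrix; $F$-free means no subgraph isomorphic to $F$. *)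

theory Defs
  imports Complex_Main
begin

(* A finite simple graph, with isolated vertices ignored, is represented by its
   edge set: a finite set of 2-element vertex sets. *)
definition simple_graph :: "'a set set \<Rightarrow> bool" where
  "simple_graph E \<longleftrightarrow> finite E \<and> (\<forall>e\<in>E. card e = 2)"

definition verts :: "'a set set \<Rightarrow> 'a set" where
  "verts E = \<Union>E"

definition contains_subgraph :: "'a set set \<Rightarrow> 'b set set \<Rightarrow> bool" where
  "contains_subgraph G F \<longleftrightarrow>
     (\<exists>f :: 'b \<Rightarrow> 'a. inj_on f (verts F) \<and> (\<forall>e\<in>F. f ` e \<in> G))"

definition graph_iso :: "'a set set \<Rightarrow> 'b set set \<Rightarrow> bool" where
  "graph_iso G H \<longleftrightarrow> (\<exists>f :: 'a \<Rightarrow> 'b. inj_on f (verts G) \<and> H = (\<lambda>e. f ` e) ` G)"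

definition adj_eigenvalue :: "'a set set \<Rightarrow> complex \<Rightarrow> bool" where
  "adj_eigenvalue E \<mu> \<longleftrightarrow>
     (\<exists>x :: 'a \<Rightarrow> complex. (\<exists>v\<in>verts E. x v \<noteq> 0) \<and>
        (\<forall>v\<in>verts E. (\<Sum>u\<in>{u\<in>verts E. {u, v} \<in> E}. x u) = \<mu> * x v))"

definition spec_rad :: "'a set set \<Rightarrow> real" where
  "spec_rad E = Max {cmod \<mu> | \<mu>. adj_eigenvalue E \<mu>}"

definition Kplus :: "nat \<Rightarrow> nat \<Rightarrow> nat set set" where
  "Kplus k t = {{a, b} | a b. a \<le> k \<and> k < b \<and> b \<le> k + t + 1} \<union> {{0, 1}}"

(* split graph S_{k,m}: clique on {0..<k}, independent vertices k..k+t'-1 joined to the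
   clique, and vertex k+t' adjacent to the r vertices 0..<r, where
   m - C(k,2) = k t' + r with 0 \<le> r < k. *)
definition Ssplit :: "nat \<Rightarrow> nat \<Rightarrow> nat set set" where
  "Ssplit k m =
     (let t' = (m - (k choose 2)) div k; r = (m - (k choose 2)) mod k in
      {{i, j} | i j. i < j \<and> j < k}
      \<union> {{i, k + s} | i s. i < k \<and> s < t'}
      \<union> {{i, k + t'} | i. i < r})"

end

theory Submission
  imports Defs "HOL-Analysis.Analysis"
begin

text \<open>
  Let \<open>\<lambda>\<close> be the spectral radius of \<open>G\<close> and \<open>x\<close> its Perron vector, scaled so that the maximal entry is
  \<open>x u = 1\<close>. Let \<open>N\<close> be the neighbourhood of \<open>u\<close> and \<open>W\<close> the set of the remaining vertices. A uniform test
  vector on the clique of \<open>S\<^sub>k\<^sub>,\<^sub>m\<close> shows that \<open>\<lambda> \<ge> \<lambda>(S\<^sub>k\<^sub>,\<^sub>m)\<close> forces \<open>\<lambda>\<^sup>2 - (k - 1) \<lambda> \<ge> m - O(1)\<close>, while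
  counting walks of length two from \<open>u\<close> expresses \<open>\<lambda>\<^sup>2 - m\<close> through the edges inside \<open>N\<close> and \<open>W\<close>.

  Either some vertex of \<open>N\<close> has a large entry but few neighbours (by weight) in \<open>N\<close>. Then \<open>G\<close> is
  close to a complete bipartite graph with both sides of order \<open>\<lambda>\<close>; an edge inside a side has an end
  that misses a positive proportion of the other side, which costs more than the edge gains, so
  \<open>\<lambda>\<^sup>2 \<le> m\<close>, a contradiction. Or there is a set \<open>A\<close> of exactly \<open>k\<close>
  vertices with entries \<open>1 - O(1/\<lambda>)\<close>, all other entries being \<open>O(1/\<lambda>)\<close>. Eliminating the small
  entries gives an inequality for the entries on \<open>A\<close>, in which every vertex outside \<open>A\<close> with
  \<open>0 < d < k\<close> neighbours in \<open>A\<close> costs \<open>d (k - d) / k\<close>. Since \<open>d (k - d)\<close> is concave, this leaves only the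
  graph in which \<open>A\<close> is a clique and at most one outside vertex has a degree different from \<open>k\<close>.
\<close>

text \<open>The bound and the case of equality follow from one implication: a free graph whose
  spectral radius is at least that of the split graph is isomorphic to it. This must be exact in the
  residue of the number of edges modulo \<open>k\<close>. The obstacle is accumulation of error: the
  large entries are known only up to \<open>O(1/lam)\<close>, and such a loss at each of the order
  of \<open>lam ^ 2\<close> outside vertices would add up to order \<open>lam\<close>.

  The dichotomy rests on the fact that a subset of \<open>N\<close> of bounded size has total weight
  at most \<open>(k - 1) * lam + O(1)\<close> in \<open>N\<close>. So only boundedly many vertices
  of \<open>N\<close> can have weight of order \<open>lam\<close> there, and the excess of
  \<open>lam ^ 2\<close> over \<open>m\<close> must come from them.\<close>

section \<open>Perron vectors and eigenvalues\<close>

text \<open>These two simp rules would turn the weighted sums over indicator functions into sums over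
  intersections.\<close>

declare sum_of_bool_mult_eq [simp del] sum_mult_of_bool_eq [simp del]

lemma perron_vector:
  fixes V :: "'a set" and E :: "'a \<Rightarrow> 'a \<Rightarrow> bool"
  assumes fin: "finite V" and ne: "V \<noteq> {}"
    and sym: "\<And>v w. E v w \<Longrightarrow> E w v" and irr: "\<And>v. \<not> E v v"
  obtains lam x where "\<And>v. 0 \<le> x v" "\<And>v. x v \<le> 1" "(\<Sum>v\<in>V. (x v)\<^sup>2) = (1::real)"
    "\<And>v. v \<in> V \<Longrightarrow> (\<Sum>w\<in>V. of_bool (E v w) * x w) = lam * x v"
    "\<And>z. (\<Sum>v\<in>V. \<Sum>w\<in>V. of_bool (E v w) * z v * z w) \<le> lam * (\<Sum>v\<in>V. (z v)\<^sup>2)"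
proof -
  \<comment> \<open>The functions vanish outside \<open>V\<close>, so the box is a product of
    compact sets and no identification of \<open>V\<close> with coordinates is needed.\<close>
  define B where "B = Pi\<^sub>E UNIV (\<lambda>v. if v \<in> V then {0..1::real} else {0})"
  define S where "S = B \<inter> {x. (\<Sum>v\<in>V. (x v)\<^sup>2) = 1}"
  define q where "q = (\<lambda>x::'a \<Rightarrow> real. \<Sum>v\<in>V. \<Sum>w\<in>V. of_bool (E v w) * x v * x w)"
  have cx: "continuous_on T (\<lambda>x::'a \<Rightarrow> real. x v)" for v T
    by (rule continuous_on_subset[OF continuous_on_product_coordinates]) auto
  have "compactin (product_topology (\<lambda>_. euclidean) UNIV) B"
    unfolding B_def by (subst compactin_PiE) auto
  then have "compact B"
    by (simp add: euclidean_product_topology)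
  moreover have "closed {x::'a \<Rightarrow> real. (\<Sum>v\<in>V. (x v)\<^sup>2) = 1}"
    by (intro closed_Collect_eq continuous_intros cx)
  ultimately have "compact S" unfolding S_def by (rule compact_Int_closed)
  moreover have "S \<noteq> {}"
  proof -
    obtain v0 where "v0 \<in> V" using ne by auto
    then have "(\<lambda>v. if v = v0 then 1 else 0) \<in> S"
      using fin by (auto simp: S_def B_def if_distrib[of "\<lambda>y. y\<^sup>2"] sum.delta cong: if_cong)
    then show ?thesis by auto
  qed
  moreover have "continuous_on S q" unfolding q_def by (intro continuous_intros cx)
  ultimately obtain x where xS: "x \<in> S" and mx: "\<And>y. y \<in> S \<Longrightarrow> q y \<le> q x"
    using continuous_attains_sup by metis
  define lam where "lam = q x"
  have x0: "0 \<le> x v" "x v \<le> 1" for v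
    using xS by (auto simp: S_def B_def PiE_iff split: if_splits dest!: spec[of _ v])
  have xn: "(\<Sum>v\<in>V. (x v)\<^sup>2) = 1" using xS by (auto simp: S_def)
  have ray: "q z \<le> lam * (\<Sum>v\<in>V. (z v)\<^sup>2)" for z
  proof (cases "(\<Sum>v\<in>V. (z v)\<^sup>2) = 0")
    case True
    then have "z v = 0" if "v \<in> V" for v
      using that fin by (simp add: sum_nonneg_eq_0_iff)
    then show ?thesis using True by (simp add: q_def)
  next
    case False
    define n where "n = (\<Sum>v\<in>V. (z v)\<^sup>2)"
    have n: "n > 0" using False by (metis n_def order_le_less sum_nonneg zero_le_power2)
    define y where "y = (\<lambda>v. if v \<in> V then \<bar>z v\<bar> / sqrt n else 0)"
    have ysq: "(\<Sum>v\<in>V. (y v)\<^sup>2) = 1"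
    proof -
      have "(\<Sum>v\<in>V. (y v)\<^sup>2) = (\<Sum>v\<in>V. (z v)\<^sup>2 / n)"
        by (rule sum.cong) (use n in \<open>auto simp: y_def power_divide\<close>)
      also have "\<dots> = 1" using n by (simp add: n_def flip: sum_divide_distrib)
      finally show ?thesis .
    qed
    have y1: "y v \<le> 1" if "v \<in> V" for v
    proof -
      have "(y v)\<^sup>2 \<le> (\<Sum>v\<in>V. (y v)\<^sup>2)" using that fin by (intro member_le_sum) auto
      then show ?thesis using ysq by (metis abs_le_square_iff abs_of_nonneg abs_one le_cases one_power2 order_trans abs_ge_self)
    qed
    have "y \<in> S" using ysq y1 by (auto simp: S_def B_def y_def n less_imp_le)
    then have "q y \<le> lam" using mx by (simp add: lam_def)
    \<comment> \<open>Adjacency entries are nonnegative, so passing to absolute values does not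
      decrease the form. This is why the maximum may be sought among nonnegative vectors.\<close>
    have "q z \<le> n * q y"
    proof -
      have "q z \<le> (\<Sum>v\<in>V. \<Sum>w\<in>V. of_bool (E v w) * \<bar>z v\<bar> * \<bar>z w\<bar>)"
        unfolding q_def
        by (intro sum_mono) (auto simp: of_bool_def simp flip: abs_mult)
      also have "\<dots> = n * q y"
        unfolding q_def sum_distrib_left
        by (intro sum.cong refl) (use n in \<open>auto simp: y_def\<close>)
      finally show ?thesis .
    qed
    also have "\<dots> \<le> n * lam" using \<open>q y \<le> lam\<close> n by simp
    finally show ?thesis by (simp add: n_def mult.commute)
  qed
  have eig: "(\<Sum>w\<in>V. of_bool (E v w) * x w) = lam * x v" if v: "v \<in> V" for v
  proof -
    define b where "b = (\<Sum>w\<in>V. of_bool (E v w) * x w) - lam * x v"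
    \<comment> \<open>First variation: \<open>b\<close> is the defect of the eigenvalue equation at
      \<open>v\<close>, and moving the single coordinate \<open>v\<close> by \<open>s\<close> adds
      no term in \<open>s\<^sup>2\<close> to \<open>q\<close>, because there are no loops. A linear
      term bounded by a quadratic one for every \<open>s\<close> vanishes.\<close>
    have exq: "2 * s * b \<le> lam * s\<^sup>2" for s
    proof -
      define d where "d = (\<lambda>w. if w = v then s else 0)"
      have "q (\<lambda>w. x w + d w) = q x + (\<Sum>p\<in>V. \<Sum>w\<in>V. of_bool (E p w) * x p * d w)
          + (\<Sum>p\<in>V. \<Sum>w\<in>V. of_bool (E p w) * d p * x w) + (\<Sum>p\<in>V. \<Sum>w\<in>V. of_bool (E p w) * d p * d w)"
        unfolding q_def by (simp add: algebra_simps sum.distrib)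
      also have "(\<Sum>p\<in>V. \<Sum>w\<in>V. of_bool (E p w) * d p * d w) = 0"
        by (intro sum.neutral ballI) (auto simp: d_def irr)
      also have "(\<Sum>p\<in>V. \<Sum>w\<in>V. of_bool (E p w) * d p * x w) = (\<Sum>p\<in>V. if p = v then (\<Sum>w\<in>V. of_bool (E v w) * s * x w) else 0)"
        by (intro sum.cong) (auto simp: d_def)
      also have "\<dots> = s * (\<Sum>w\<in>V. of_bool (E v w) * x w)"
        using v fin by (simp add: sum_distrib_left mult_ac)
      also have "(\<Sum>p\<in>V. \<Sum>w\<in>V. of_bool (E p w) * x p * d w) = (\<Sum>p\<in>V. \<Sum>w\<in>V. (if w = v then of_bool (E v p) * x p * s else 0))"
        by (intro sum.cong) (auto simp: d_def dest: sym)
      also have "\<dots> = s * (\<Sum>w\<in>V. of_bool (E v w) * x w)"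
        using v fin by (simp add: sum_distrib_left mult_ac)
      finally have 1: "q (\<lambda>w. x w + d w) = lam + 2 * s * (\<Sum>w\<in>V. of_bool (E v w) * x w)"
        by (simp add: lam_def)
      have "(\<Sum>w\<in>V. (x w + d w)\<^sup>2) = (\<Sum>w\<in>V. (x w)\<^sup>2 + (if w = v then 2 * s * x v + s\<^sup>2 else 0))"
        by (intro sum.cong) (auto simp: d_def power2_sum)
      also have "\<dots> = 1 + 2 * s * x v + s\<^sup>2"
        using v fin xn by (simp add: sum.distrib)
      finally have 2: "(\<Sum>w\<in>V. (x w + d w)\<^sup>2) = 1 + 2 * s * x v + s\<^sup>2" .
      from ray[of "\<lambda>w. x w + d w"] show ?thesis
        unfolding 1 2 by (simp add: b_def algebra_simps)
    qed
    have "lam \<ge> 0" unfolding lam_def q_def using x0 by (intro sum_nonneg) auto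
    have "b = 0"
    proof (rule ccontr)
      assume "b \<noteq> 0"
      have "2 * (b / (lam + 1)) * b * (lam + 1)\<^sup>2 \<le> lam * (b / (lam + 1))\<^sup>2 * (lam + 1)\<^sup>2"
        using exq[of "b / (lam + 1)"] by (intro mult_right_mono) auto
      moreover have "2 * (b / (lam + 1)) * b * (lam + 1)\<^sup>2 = 2 * b\<^sup>2 * (lam + 1)"
        "lam * (b / (lam + 1))\<^sup>2 * (lam + 1)\<^sup>2 = lam * b\<^sup>2"
        using \<open>lam \<ge> 0\<close> by (auto simp: power2_eq_square)
      ultimately have "2 * b\<^sup>2 * (lam + 1) \<le> lam * b\<^sup>2" by simp
      then have "b\<^sup>2 * (lam + 2) \<le> 0" by (simp add: algebra_simps)
      then show False using \<open>b \<noteq> 0\<close> \<open>lam \<ge> 0\<close>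
        by (smt (verit) mult_pos_pos zero_less_power2)
    qed
    then show ?thesis by (simp add: b_def)
  qed
  show ?thesis
    by (rule that[of x lam]) (use x0 xn eig ray in \<open>auto simp: q_def\<close>)
qed

text \<open>The matrix is real and symmetric, so the eigenvalue equals its conjugate. The real and
  imaginary parts of the eigenvector then satisfy the same real equation, and one of them is
  nonzero.\<close>

lemma adj_eigenvalue_real:
  assumes sg: "simple_graph G" and ev: "adj_eigenvalue G \<mu>"
  shows "\<exists>f. (\<Sum>v\<in>verts G. (f v)\<^sup>2) = 1 \<and>
    (\<forall>v\<in>verts G. (\<Sum>w\<in>verts G. of_bool ({v, w} \<in> G) * f w) = Re \<mu> * f v) \<and> \<mu> = of_real (Re \<mu>)"
proof -
  let ?V = "verts G"
  have fin: "finite ?V"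
    using sg unfolding simple_graph_def verts_def
    by (auto intro: finite_Union simp: card_ge_0_finite)
  from ev obtain x where nz: "\<exists>v\<in>?V. x v \<noteq> 0"
    and eq: "\<And>v. v \<in> ?V \<Longrightarrow> (\<Sum>u\<in>{u\<in>?V. {u, v} \<in> G}. x u) = \<mu> * x v"
    unfolding adj_eigenvalue_def by auto
  have eq': "(\<Sum>w\<in>?V. of_bool ({v, w} \<in> G) * x w) = \<mu> * x v" if "v \<in> ?V" for v
  proof -
    have "(\<Sum>u\<in>{u\<in>?V. {u, v} \<in> G}. x u) = (\<Sum>w\<in>?V. of_bool ({v, w} \<in> G) * x w)"
      using fin by (intro sum.mono_neutral_cong_left) (auto simp: insert_commute)
    then show ?thesis using eq[OF that] by simp
  qed
  define n where "n = (\<Sum>v\<in>?V. (cmod (x v))\<^sup>2)"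
  have n: "n > 0"
    using nz fin unfolding n_def by (auto intro!: sum_pos2)
  define P where "P = (\<Sum>v\<in>?V. \<Sum>w\<in>?V. of_bool ({v, w} \<in> G) * (cnj (x v) * x w))"
  have "P = (\<Sum>v\<in>?V. cnj (x v) * (\<Sum>w\<in>?V. of_bool ({v, w} \<in> G) * x w))"
    by (simp add: P_def sum_distrib_left mult_ac)
  also have "\<dots> = (\<Sum>v\<in>?V. \<mu> * (x v * cnj (x v)))"
    by (intro sum.cong refl, subst eq') (auto simp: mult_ac)
  also have "\<dots> = \<mu> * of_real n"
    by (simp add: n_def sum_distrib_left flip: complex_norm_square)
  finally have P: "P = \<mu> * of_real n" .
  have "cnj P = (\<Sum>v\<in>?V. \<Sum>w\<in>?V. of_bool ({v, w} \<in> G) * (cnj (x w) * x v))"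
    unfolding P_def cnj_sum by (intro sum.cong) (auto simp: of_bool_def mult.commute)
  also have "\<dots> = P" unfolding P_def by (subst sum.swap) (simp add: insert_commute)
  finally have "cnj \<mu> * of_real n = \<mu> * of_real n" using P by simp
  then have "cnj \<mu> = \<mu>" using n by simp
  then have re: "\<mu> = of_real (Re \<mu>)" by (simp add: complex_eq_iff)
  have key: "\<exists>f. (\<Sum>v\<in>?V. (f v)\<^sup>2) = 1 \<and> (\<forall>v\<in>?V. (\<Sum>w\<in>?V. of_bool ({v, w} \<in> G) * f w) = Re \<mu> * f v)"
    if g: "\<And>v. v \<in> ?V \<Longrightarrow> (\<Sum>w\<in>?V. of_bool ({v, w} \<in> G) * g w) = Re \<mu> * g v" and gz: "\<exists>v\<in>?V. g v \<noteq> (0::real)" for g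
  proof -
    define n where "n = (\<Sum>v\<in>?V. (g v)\<^sup>2)"
    have n: "n > 0" using gz fin unfolding n_def by (auto intro!: sum_pos2)
    have a: "(\<Sum>v\<in>?V. (g v / sqrt n)\<^sup>2) = 1"
      using n by (simp add: power_divide n_def flip: sum_divide_distrib)
    have "(\<Sum>w\<in>?V. of_bool ({v, w} \<in> G) * (g w / sqrt n)) = Re \<mu> * (g v / sqrt n)" if "v \<in> ?V" for v
      using g[OF that] by (simp flip: sum_divide_distrib)
    with a show ?thesis by (intro exI[of _ "\<lambda>v. g v / sqrt n"]) auto
  qed
  have Im0: "Im \<mu> = 0" using re by (metis Im_complex_of_real)
  have R: "(\<Sum>w\<in>?V. of_bool ({v, w} \<in> G) * Re (x w)) = Re \<mu> * Re (x v)" if "v \<in> ?V" for v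
  proof -
    have "(\<Sum>w\<in>?V. of_bool ({v, w} \<in> G) * Re (x w)) = Re (\<Sum>w\<in>?V. of_bool ({v, w} \<in> G) * x w)"
      unfolding Re_sum by (intro sum.cong) (auto simp: of_bool_def)
    then show ?thesis using eq'[OF that] Im0 by simp
  qed
  have I: "(\<Sum>w\<in>?V. of_bool ({v, w} \<in> G) * Im (x w)) = Re \<mu> * Im (x v)" if "v \<in> ?V" for v
  proof -
    have "(\<Sum>w\<in>?V. of_bool ({v, w} \<in> G) * Im (x w)) = Im (\<Sum>w\<in>?V. of_bool ({v, w} \<in> G) * x w)"
      unfolding Im_sum by (intro sum.cong) (auto simp: of_bool_def)
    then show ?thesis using eq'[OF that] Im0 by simp
  qed
  have "(\<exists>v\<in>?V. Re (x v) \<noteq> 0) \<or> (\<exists>v\<in>?V. Im (x v) \<noteq> 0)" using nz by (auto simp: complex_eq_iff)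
  then show ?thesis using key[OF R] key[OF I] re by blast
qed

text \<open>Makes the \<open>Max\<close> in \<open>spec_rad\<close> meaningful. Unit eigenvectors of
  distinct eigenvalues are orthonormal; Bessel's inequality at each vertex, summed over the
  vertices, bounds the number of eigenvalues by the number of vertices.\<close>

lemma finite_adj_eigenvalues:
  assumes sg: "simple_graph G"
  shows "finite {\<mu>. adj_eigenvalue G \<mu>}"
proof (rule conjunct1[OF finite_if_finite_subsets_card_bdd])
  fix F assume F: "F \<subseteq> {\<mu>. adj_eigenvalue G \<mu>}" and finF: "finite F"
  let ?V = "verts G"
  let ?a = "\<lambda>v w. of_bool ({v, w} \<in> G) :: real"
  have fin: "finite ?V"
    using sg unfolding simple_graph_def verts_def
    by (auto intro: finite_Union simp: card_ge_0_finite)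
  define f where "f = (\<lambda>\<mu>. SOME f. (\<Sum>v\<in>?V. (f v)\<^sup>2) = 1 \<and>
    (\<forall>v\<in>?V. (\<Sum>w\<in>?V. ?a v w * f w) = Re \<mu> * f v) \<and> \<mu> = of_real (Re \<mu>))"
  have f: "(\<Sum>v\<in>?V. (f \<mu> v)\<^sup>2) = 1 \<and>
    (\<forall>v\<in>?V. (\<Sum>w\<in>?V. ?a v w * f \<mu> w) = Re \<mu> * f \<mu> v) \<and> \<mu> = of_real (Re \<mu>)" if "\<mu> \<in> F" for \<mu>
    unfolding f_def by (rule someI_ex[OF adj_eigenvalue_real[OF sg]]) (use that F in auto)
  have f1: "(\<Sum>v\<in>?V. (f \<mu> v)\<^sup>2) = 1" if "\<mu> \<in> F" for \<mu> using f[OF that] by blast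
  have f2: "(\<Sum>w\<in>?V. ?a v w * f \<mu> w) = Re \<mu> * f \<mu> v" if "\<mu> \<in> F" "v \<in> ?V" for \<mu> v
    using f that by blast
  have f3: "\<mu> = of_real (Re \<mu>)" if "\<mu> \<in> F" for \<mu> using f[OF that] by blast
  have orth: "(\<Sum>v\<in>?V. f \<mu> v * f \<nu> v) = 0" if "\<mu> \<in> F" "\<nu> \<in> F" "\<mu> \<noteq> \<nu>" for \<mu> \<nu>
  proof -
    have *: "Re \<alpha> * (\<Sum>v\<in>?V. f \<alpha> v * f \<beta> v) = (\<Sum>v\<in>?V. \<Sum>w\<in>?V. ?a v w * f \<alpha> w * f \<beta> v)" if "\<alpha> \<in> F" for \<alpha> \<beta>
    proof -
      have "Re \<alpha> * (\<Sum>v\<in>?V. f \<alpha> v * f \<beta> v) = (\<Sum>v\<in>?V. (Re \<alpha> * f \<alpha> v) * f \<beta> v)"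
        by (simp add: sum_distrib_left mult.assoc)
      also have "\<dots> = (\<Sum>v\<in>?V. (\<Sum>w\<in>?V. ?a v w * f \<alpha> w) * f \<beta> v)"
        by (intro sum.cong refl) (simp only: f2[OF that])
      finally show ?thesis by (simp add: sum_distrib_right)
    qed
    have "(\<Sum>v\<in>?V. \<Sum>w\<in>?V. ?a v w * f \<mu> w * f \<nu> v) = (\<Sum>v\<in>?V. \<Sum>w\<in>?V. ?a v w * f \<nu> w * f \<mu> v)"
      by (subst sum.swap) (simp add: insert_commute mult_ac)
    then have "Re \<mu> * (\<Sum>v\<in>?V. f \<mu> v * f \<nu> v) = Re \<nu> * (\<Sum>v\<in>?V. f \<mu> v * f \<nu> v)"
      using *[of \<mu> \<nu>] *[of \<nu> \<mu>] that by (simp add: mult.commute)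
    moreover have "Re \<mu> \<noteq> Re \<nu>"
      using that f3[of \<mu>] f3[of \<nu>] by auto
    ultimately show ?thesis by simp
  qed
  have bessel: "(\<Sum>\<mu>\<in>F. (f \<mu> p)\<^sup>2) \<le> 1" if p: "p \<in> ?V" for p
  proof -
    \<comment> \<open>The projection of the unit vector at \<open>p\<close> to the span of the
      eigenvectors; its squared norm equals its value at \<open>p\<close>.\<close>
    define g where "g = (\<lambda>v. \<Sum>\<mu>\<in>F. f \<mu> p * f \<mu> v)"
    have gp: "g p = (\<Sum>\<mu>\<in>F. (f \<mu> p)\<^sup>2)" by (simp add: g_def power2_eq_square)
    have "(\<Sum>v\<in>?V. (g v)\<^sup>2) = (\<Sum>v\<in>?V. \<Sum>\<mu>\<in>F. \<Sum>\<nu>\<in>F. (f \<mu> p * f \<nu> p) * (f \<mu> v * f \<nu> v))"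
      by (simp add: g_def power2_eq_square sum_product mult_ac)
    also have "\<dots> = (\<Sum>\<mu>\<in>F. \<Sum>v\<in>?V. \<Sum>\<nu>\<in>F. (f \<mu> p * f \<nu> p) * (f \<mu> v * f \<nu> v))"
      by (rule sum.swap)
    also have "\<dots> = (\<Sum>\<mu>\<in>F. \<Sum>\<nu>\<in>F. \<Sum>v\<in>?V. (f \<mu> p * f \<nu> p) * (f \<mu> v * f \<nu> v))"
      by (intro sum.cong refl sum.swap)
    also have "\<dots> = (\<Sum>\<mu>\<in>F. \<Sum>\<nu>\<in>F. (if \<mu> = \<nu> then f \<mu> p * f \<nu> p else 0))"
    proof (intro sum.cong refl)
      fix \<mu> \<nu> assume "\<mu> \<in> F" "\<nu> \<in> F"
      then show "(\<Sum>v\<in>?V. (f \<mu> p * f \<nu> p) * (f \<mu> v * f \<nu> v)) = (if \<mu> = \<nu> then f \<mu> p * f \<nu> p else 0)"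
        using orth[of \<mu> \<nu>] f1[of \<mu>] by (auto simp: power2_eq_square simp flip: sum_distrib_left)
    qed
    also have "\<dots> = g p" using finF by (simp add: gp power2_eq_square)
    finally have "(\<Sum>v\<in>?V. (g v)\<^sup>2) = g p" .
    moreover have "(g p)\<^sup>2 \<le> (\<Sum>v\<in>?V. (g v)\<^sup>2)" using p fin by (intro member_le_sum) auto
    ultimately have gg: "(g p)\<^sup>2 \<le> g p" by simp
    have "g p \<le> 1"
    proof (rule ccontr)
      assume "\<not> g p \<le> 1"
      then have "1 * g p < g p * g p" by (intro mult_strict_right_mono) auto
      with gg show False by (simp add: power2_eq_square)
    qed
    then show ?thesis by (simp add: gp)
  qed
  have "real (card F) = (\<Sum>\<mu>\<in>F. \<Sum>v\<in>?V. (f \<mu> v)\<^sup>2)" using f1 by simp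
  also have "\<dots> = (\<Sum>v\<in>?V. \<Sum>\<mu>\<in>F. (f \<mu> v)\<^sup>2)" by (rule sum.swap)
  also have "\<dots> \<le> (\<Sum>v\<in>?V. 1)" by (intro sum_mono bessel)
  finally show "card F \<le> card ?V" using finF by simp
qed

section \<open>Graphs without the forbidden subgraph\<close>

text \<open>The assumption \<open>free\<close> is what \<open>K\<^sup>+\<close>-freeness yields: \<open>S\<close> is the part of size \<open>k + 1\<close> with its extra
  edge \<open>p q\<close>.\<close>

locale kfree_eigen =
  fixes V :: "'a set" and E :: "'a \<Rightarrow> 'a \<Rightarrow> bool" and k t :: nat
    and x :: "'a \<Rightarrow> real" and lam :: real and u :: 'a and m c :: real
  assumes finV: "finite V"
    and sym: "E v w \<Longrightarrow> E w v"
    and irr: "\<not> E v v"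
    and EV: "E v w \<Longrightarrow> v \<in> V"
    and k2: "2 \<le> k"
    and free: "S \<subseteq> V \<Longrightarrow> card S = k + 1 \<Longrightarrow> p \<in> S \<Longrightarrow> q \<in> S \<Longrightarrow> E p q \<Longrightarrow>
      card {w \<in> V. \<forall>s\<in>S. E s w} \<le> t"
    and x_nonneg: "0 \<le> x v"
    and x_le1: "x v \<le> 1"
    and uV: "u \<in> V" and xu: "x u = 1"
    and eigen: "v \<in> V \<Longrightarrow> (\<Sum>w\<in>V. of_bool (E v w) * x w) = lam * x v"
    and edges: "(\<Sum>v\<in>V. \<Sum>w\<in>V. of_bool (E v w)) = 2 * m"
    and c0: "0 \<le> c" and lam1: "1 \<le> lam"
    and large: "m - c \<le> lam\<^sup>2 - (real k - 1) * lam"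
begin

definition a :: "'a \<Rightarrow> 'a \<Rightarrow> real" where "a v w = of_bool (E v w)"

definition wt :: "'a set \<Rightarrow> 'a \<Rightarrow> real" where "wt Y p = (\<Sum>w\<in>Y. a p w * x w)"

definition dg :: "'a set \<Rightarrow> 'a \<Rightarrow> real" where "dg Y p = (\<Sum>w\<in>Y. a p w)"

definition N :: "'a set" where "N = {w \<in> V. E u w}"

definition W :: "'a set" where "W = V - N - {u}"

text \<open>All pair sums below range over ordered pairs, so \<open>eW\<close> and \<open>Q\<close> count every edge twice.\<close>

definition D :: real where "D = (\<Sum>w\<in>W. dg N w * (1 - x w))"

definition eW :: real where "eW = (\<Sum>w\<in>W. dg W w)"

text \<open>An edge \<open>v w\<close> inside \<open>N\<close> contributes \<open>x v + x w\<close>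
  to the walks of length two from \<open>u\<close> and one edge to \<open>m\<close>; the summand is
  the difference.\<close>

definition Q :: real where "Q = (\<Sum>v\<in>N. \<Sum>w\<in>N. a v w * (x v + x w - 1))"

lemma a_sym: "a v w = a w v"
  using sym by (auto simp: a_def)

lemma a_nonneg [simp]: "0 \<le> a v w" and a_le1: "a v w \<le> 1"
  by (auto simp: a_def)

lemma fin_N [simp]: "finite N" and fin_W [simp]: "finite W" and N_V: "N \<subseteq> V" and W_V: "W \<subseteq> V"
  and u_N: "u \<notin> N" and u_W: "u \<notin> W" and N_W: "N \<inter> W = {}"
  using finV irr by (auto simp: N_def W_def)

lemma fin_sub: "Y \<subseteq> V \<Longrightarrow> finite Y"
  using finV finite_subset by auto

lemma V_eq: "V = insert u (N \<union> W)"
  using uV by (auto simp: N_def W_def)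

lemma sum_V: "(\<Sum>v\<in>V. f v) = f u + (\<Sum>v\<in>N. f v) + (\<Sum>v\<in>W. (f v :: real))"
  using u_N u_W N_W by (subst V_eq) (simp add: sum.union_disjoint)

lemma a_uN: "v \<in> N \<Longrightarrow> a v u = 1" and a_uW: "v \<in> W \<Longrightarrow> a v u = 0"
  by (auto simp: N_def W_def a_def dest: sym)

lemma wt_nonneg: "0 \<le> wt Y p"
  unfolding wt_def by (intro sum_nonneg mult_nonneg_nonneg x_nonneg) auto

lemma dg_nonneg: "0 \<le> dg Y p"
  unfolding dg_def by (intro sum_nonneg) auto

lemma wt_le_dg: "wt Y p \<le> dg Y p"
  unfolding wt_def dg_def by (intro sum_mono mult_left_le x_le1) auto

lemma wt_le_sum: "wt Y p \<le> (\<Sum>w\<in>Y. x w)"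
  unfolding wt_def by (intro sum_mono) (auto simp: x_nonneg a_le1 intro: mult_left_le_one_le)

lemma wt_mono: "Y \<subseteq> Z \<Longrightarrow> Z \<subseteq> V \<Longrightarrow> wt Y p \<le> wt Z p"
  unfolding wt_def by (rule sum_mono2) (auto simp: x_nonneg intro: fin_sub)

lemma dg_mono: "Y \<subseteq> Z \<Longrightarrow> Z \<subseteq> V \<Longrightarrow> dg Y p \<le> dg Z p"
  unfolding dg_def by (rule sum_mono2) (auto intro: fin_sub)

lemma wt_Un: "Y \<inter> Z = {} \<Longrightarrow> Y \<subseteq> V \<Longrightarrow> Z \<subseteq> V \<Longrightarrow> wt (Y \<union> Z) p = wt Y p + wt Z p"
  unfolding wt_def by (rule sum.union_disjoint) (auto intro: fin_sub)

lemma dg_Un: "Y \<inter> Z = {} \<Longrightarrow> Y \<subseteq> V \<Longrightarrow> Z \<subseteq> V \<Longrightarrow> dg (Y \<union> Z) p = dg Y p + dg Z p"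
  unfolding dg_def by (rule sum.union_disjoint) (auto intro: fin_sub)

lemma wt_V: "v \<in> V \<Longrightarrow> wt V v = lam * x v"
  using eigen by (simp add: wt_def a_def)

lemma wt_N: "v \<in> N \<Longrightarrow> lam * x v = 1 + wt N v + wt W v"
  using wt_V[of v] N_V by (auto simp: wt_def sum_V a_uN xu)

lemma wt_W: "v \<in> W \<Longrightarrow> lam * x v = wt N v + wt W v"
  using wt_V[of v] W_V by (auto simp: wt_def sum_V a_uW)

lemma sum_N: "(\<Sum>v\<in>N. x v) = lam"
proof -
  have "wt V u = (\<Sum>v\<in>N. x v)"
    unfolding wt_def using finV by (intro sum.mono_neutral_cong_right) (auto simp: N_def a_def)
  then show ?thesis using wt_V[OF uV] xu by simp
qed

lemma wt_N_le: "wt N v \<le> lam"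
  using wt_le_sum[of N v] sum_N by simp

lemma swap_a: "(\<Sum>v\<in>Y. \<Sum>w\<in>Z. a v w * f v w) = (\<Sum>w\<in>Z. \<Sum>v\<in>Y. a w v * f v w)"
  unfolding sum.swap[of _ Z Y] by (intro sum.cong refl) (metis a_sym)

lemma D_nonneg: "0 \<le> D"
  unfolding D_def by (intro sum_nonneg mult_nonneg_nonneg dg_nonneg) (simp add: x_le1)

lemma eW_nonneg: "0 \<le> eW"
  unfolding eW_def by (intro sum_nonneg dg_nonneg)

text \<open>Both sides are obtained by counting: \<open>\<lambda>\<^sup>2 x u\<close> is a sum over the walks of length two that start at
  \<open>u\<close>, and \<open>m\<close> splits along \<open>V = {u} \<union> N \<union> W\<close>.\<close>

lemma excess_identity: "2 * lam\<^sup>2 - 2 * m = Q - 2 * D - eW"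
proof -
  have dgN: "dg V v = 1 + dg N v + dg W v" if "v \<in> N" for v
    using that by (simp add: dg_def sum_V a_uN)
  have dgW: "dg V v = dg N v + dg W v" if "v \<in> W" for v
    using that by (simp add: dg_def sum_V a_uW)
  have dgu: "dg V u = real (card N)"
  proof -
    have "dg V u = (\<Sum>v\<in>N. 1)"
      unfolding dg_def using finV by (intro sum.mono_neutral_cong_right) (auto simp: N_def a_def)
    then show ?thesis by simp
  qed
  have NW: "(\<Sum>v\<in>N. dg W v) = (\<Sum>w\<in>W. dg N w)"
    unfolding dg_def using swap_a[of "\<lambda>_ _. 1" W N] by simp
  have "2 * m = (\<Sum>v\<in>V. dg V v)" using edges by (simp add: dg_def a_def)
  also have "\<dots> = 2 * real (card N) + (\<Sum>v\<in>N. dg N v) + 2 * (\<Sum>w\<in>W. dg N w) + eW"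
    unfolding sum_V using NW by (simp add: dgu dgN dgW sum.distrib eW_def)
  finally have 1: "2 * m = \<dots>" .
  have "lam\<^sup>2 = (\<Sum>v\<in>N. lam * x v)" using sum_N by (simp add: power2_eq_square flip: sum_distrib_left)
  also have "\<dots> = real (card N) + (\<Sum>v\<in>N. wt N v) + (\<Sum>v\<in>N. wt W v)"
    by (simp add: wt_N sum.distrib)
  also have "(\<Sum>v\<in>N. wt W v) = (\<Sum>w\<in>W. dg N w * x w)"
    unfolding wt_def dg_def using swap_a[of "\<lambda>_ w. x w" W N] by (simp add: sum_distrib_right)
  finally have 2: "lam\<^sup>2 = real (card N) + (\<Sum>v\<in>N. wt N v) + (\<Sum>w\<in>W. dg N w * x w)" .
  have "Q = (\<Sum>v\<in>N. \<Sum>w\<in>N. a v w * x v) + (\<Sum>v\<in>N. \<Sum>w\<in>N. a v w * x w) - (\<Sum>v\<in>N. \<Sum>w\<in>N. a v w)"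
    unfolding Q_def by (simp add: algebra_simps sum.distrib sum_subtractf)
  also have "(\<Sum>v\<in>N. \<Sum>w\<in>N. a v w * x v) = (\<Sum>v\<in>N. \<Sum>w\<in>N. a v w * x w)"
    by (rule swap_a)
  finally have 3: "Q = 2 * (\<Sum>v\<in>N. wt N v) - (\<Sum>v\<in>N. dg N v)"
    by (simp add: wt_def dg_def)
  have 4: "D = (\<Sum>w\<in>W. dg N w) - (\<Sum>w\<in>W. dg N w * x w)"
    by (simp add: D_def algebra_simps sum_subtractf)
  show ?thesis using 1 2 3 4 by simp
qed

lemma excess_ge: "2 * (real k - 1) * lam - 2 * c + 2 * D + eW \<le> Q"
  using excess_identity large by (simp add: algebra_simps)

section \<open>Vertices of large weight inside the neighbourhood \<open>N\<close>\<close>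

text \<open>A vertex of \<open>N\<close> with fewer than \<open>k\<close> neighbours in
  \<open>H\<close> contributes at most \<open>k - 1\<close> times its entry, and the entries on
  \<open>N\<close> sum to \<open>lam\<close>. Any other vertex of \<open>N\<close> is a common
  neighbour of \<open>u\<close> and some \<open>k\<close>-subset of \<open>H\<close>. These
  \<open>k + 1\<close> vertices span an edge at \<open>u\<close>, so \<open>free\<close> allows at
  most \<open>t\<close> such vertices for each of at most \<open>2 ^ card H\<close> subsets.\<close>

lemma sum_wt_le:
  assumes H: "H \<subseteq> N"
  shows "(\<Sum>h\<in>H. wt N h) \<le> (real k - 1) * lam + 2 ^ card H * real t * real (card H)"
proof -
  define B where "B = {v \<in> N. k \<le> card {h \<in> H. E h v}}"
  have finH: "finite H" using H fin_N finite_subset by blast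
  have "B \<subseteq> (\<Union>K\<in>{K. K \<subseteq> H \<and> card K = k}. {w \<in> V. \<forall>s\<in>insert u K. E s w})"
  proof
    fix v assume v: "v \<in> B"
    then obtain K where K: "K \<subseteq> {h \<in> H. E h v}" "card K = k"
      by (auto simp: B_def elim: obtain_subset_with_card_n)
    then show "v \<in> (\<Union>K\<in>{K. K \<subseteq> H \<and> card K = k}. {w \<in> V. \<forall>s\<in>insert u K. E s w})"
      using v by (auto simp: B_def N_def)
  qed
  then have "card B \<le> card (\<Union>K\<in>{K. K \<subseteq> H \<and> card K = k}. {w \<in> V. \<forall>s\<in>insert u K. E s w})"
    using finV finH by (intro card_mono) auto
  also have "\<dots> \<le> (\<Sum>K\<in>{K. K \<subseteq> H \<and> card K = k}. card {w \<in> V. \<forall>s\<in>insert u K. E s w})"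
    using finH by (intro card_UN_le) auto
  also have "\<dots> \<le> (\<Sum>K\<in>{K. K \<subseteq> H \<and> card K = k}. t)"
  proof (rule sum_mono)
    fix K assume "K \<in> {K. K \<subseteq> H \<and> card K = k}"
    then have K: "K \<subseteq> H" "card K = k" by auto
    then obtain q where q: "q \<in> K" using k2 by (metis card.empty ex_in_conv not_numeral_le_zero)
    have "u \<notin> K" using K H u_N by auto
    then have cK: "card (insert u K) = k + 1" using K finH finite_subset by fastforce
    have iV: "insert u K \<subseteq> V" using K H N_V uV by blast
    have "E u q" using K H q by (auto simp: N_def)
    then show "card {w \<in> V. \<forall>s\<in>insert u K. E s w} \<le> t"
      using q by (intro free[OF iV cK, of u q]) auto
  qed
  also have "\<dots> \<le> 2 ^ card H * t"
  proof -
    have "card {K. K \<subseteq> H \<and> card K = k} \<le> card (Pow H)" using finH by (intro card_mono) auto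
    then show ?thesis using finH by (simp add: card_Pow)
  qed
  finally have cB: "real (card B) \<le> 2 ^ card H * real t"
    by (metis of_nat_le_iff of_nat_mult of_nat_numeral of_nat_power)
  have "(\<Sum>h\<in>H. wt N h) = (\<Sum>v\<in>N. x v * (\<Sum>h\<in>H. a h v))"
    unfolding wt_def by (subst sum.swap) (simp add: sum_distrib_left mult.commute)
  also have "\<dots> \<le> (\<Sum>v\<in>N. (real k - 1) * x v + (if v \<in> B then real (card H) else 0))"
  proof (rule sum_mono)
    fix v assume "v \<in> N"
    have s: "(\<Sum>h\<in>H. a h v) = real (card {h \<in> H. E h v})"
      unfolding a_def using finH by (simp add: sum_of_bool_eq Int_def)
    show "x v * (\<Sum>h\<in>H. a h v) \<le> (real k - 1) * x v + (if v \<in> B then real (card H) else 0)"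
    proof (cases "v \<in> B")
      case True
      have "card {h \<in> H. E h v} \<le> card H" using finH by (intro card_mono) auto
      then have "x v * (\<Sum>h\<in>H. a h v) \<le> 1 * real (card H)"
        unfolding s by (intro mult_mono x_le1) auto
      moreover have "0 \<le> (real k - 1) * x v" using k2 x_nonneg by simp
      ultimately show ?thesis using True by simp
    next
      case False
      then have "real (card {h \<in> H. E h v}) \<le> real k - 1" using \<open>v \<in> N\<close> by (auto simp: B_def)
      then have "x v * (\<Sum>h\<in>H. a h v) \<le> x v * (real k - 1)"
        unfolding s using x_nonneg by (intro mult_left_mono) auto
      then show ?thesis using False by (simp add: mult.commute)
    qed
  qed
  also have "\<dots> = (real k - 1) * lam + real (card B) * real (card H)"
  proof -
    have "B = {v \<in> N. v \<in> B}" by (auto simp: B_def)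
    then have "(\<Sum>v\<in>N. if v \<in> B then real (card H) else 0) = (\<Sum>v\<in>B. real (card H))"
      using sum.inter_filter[OF fin_N, of "\<lambda>_. real (card H)" "\<lambda>v. v \<in> B"] by simp
    then show ?thesis by (simp add: sum.distrib sum_N flip: sum_distrib_left)
  qed
  also have "\<dots> \<le> (real k - 1) * lam + 2 ^ card H * real t * real (card H)"
    using cB by (intro add_left_mono mult_right_mono) auto
  finally show ?thesis .
qed

text \<open>Otherwise \<open>h\<close> such vertices would have total weight at least
  \<open>k * lam\<close>, which exceeds the bound of \<open>sum_wt_le\<close> by a full
  \<open>lam\<close> up to a bounded term.\<close>

lemma card_heavy_less:
  assumes h: "real k \<le> g * real h" and l: "2 ^ h * real t * real h < lam"
  shows "card {w \<in> N. g * lam \<le> wt N w} < h"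
proof (rule ccontr)
  assume "\<not> ?thesis"
  then obtain H where H: "H \<subseteq> {w \<in> N. g * lam \<le> wt N w}" "card H = h"
    by (meson not_less obtain_subset_with_card_n)
  have "real k * lam \<le> (g * real h) * lam" using h lam1 by (intro mult_right_mono) auto
  also have "\<dots> = (\<Sum>v\<in>H. g * lam)" using H by (simp add: mult_ac)
  also have "\<dots> \<le> (\<Sum>v\<in>H. wt N v)" using H by (intro sum_mono) auto
  also have "\<dots> \<le> (real k - 1) * lam + 2 ^ h * real t * real h"
    using sum_wt_le[of H] H by auto
  finally show False using l by (simp add: algebra_simps)
qed

section \<open>Weighted forms of the common neighbour bound\<close>

text \<open>Union bound. A vertex of \<open>Y0\<close> either is a common neighbour of
  \<open>S\<close>, which happens at most \<open>t\<close> times with entries at most one, or is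
  missed by some \<open>s\<close>. Such an \<open>s\<close> lies in \<open>S'\<close>, and the entry
  is part of the weight of \<open>Y\<close> that \<open>s\<close> misses.\<close>

lemma kplus_weight:
  assumes S: "S \<subseteq> V" "card S = k + 1" "p \<in> S" "q \<in> S" "E p q"
    and Y: "Y0 \<subseteq> Y" "Y \<subseteq> V" and S': "S' \<subseteq> S"
    and adj: "\<And>w s. w \<in> Y0 \<Longrightarrow> s \<in> S - S' \<Longrightarrow> E s w"
  shows "(\<Sum>w\<in>Y0. x w) \<le> real t + (\<Sum>s\<in>S'. (\<Sum>w\<in>Y. x w) - wt Y s)"
proof -
  define C where "C = {w \<in> V. \<forall>s\<in>S. E s w}"
  have fin: "finite S'" "finite Y0" "finite Y"
    using finite_subset[OF S' fin_sub[OF S(1)]] fin_sub[OF Y(2)] finite_subset[OF Y(1)] by auto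
  have finC: "finite C" using finV by (simp add: C_def)
  have "(\<Sum>w\<in>Y0. x w) \<le> (\<Sum>w\<in>Y0. of_bool (w \<in> C) + (\<Sum>s\<in>S'. (1 - a s w) * x w))"
  proof (rule sum_mono)
    fix w assume w: "w \<in> Y0"
    have nn: "0 \<le> (1 - a s w) * x w" for s using a_le1 x_nonneg by simp
    show "x w \<le> of_bool (w \<in> C) + (\<Sum>s\<in>S'. (1 - a s w) * x w)"
    proof (cases "w \<in> C")
      case True then show ?thesis using x_le1[of w] nn by (simp add: sum_nonneg add_increasing2)
    next
      case False
      then obtain s where s: "s \<in> S" "\<not> E s w" using w Y by (auto simp: C_def)
      then have "s \<in> S'" using adj w by blast
      then have "(1 - a s w) * x w \<le> (\<Sum>s\<in>S'. (1 - a s w) * x w)"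
        using fin nn by (intro member_le_sum) auto
      then show ?thesis using s by (simp add: a_def)
    qed
  qed
  also have "\<dots> = (\<Sum>w\<in>Y0. of_bool (w \<in> C)) + (\<Sum>w\<in>Y0. \<Sum>s\<in>S'. (1 - a s w) * x w)"
    by (rule sum.distrib)
  also have "(\<Sum>w\<in>Y0. of_bool (w \<in> C)) \<le> real t"
  proof -
    have "card (Y0 \<inter> C) \<le> card C" using finC by (intro card_mono) auto
    also have "\<dots> \<le> t" unfolding C_def by (rule free[OF S])
    finally show ?thesis using fin by (simp add: sum_of_bool_eq)
  qed
  also have "(\<Sum>w\<in>Y0. \<Sum>s\<in>S'. (1 - a s w) * x w) \<le> (\<Sum>w\<in>Y. \<Sum>s\<in>S'. (1 - a s w) * x w)"
    using fin Y by (intro sum_mono2) (auto intro!: sum_nonneg mult_nonneg_nonneg simp: a_le1 x_nonneg)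
  also have "\<dots> = (\<Sum>s\<in>S'. (\<Sum>w\<in>Y. x w) - wt Y s)"
    by (subst sum.swap) (simp add: wt_def algebra_simps sum_subtractf)
  finally show ?thesis by simp
qed

lemma card_ge_weight:
  assumes "(\<Sum>w\<in>Y. x w) \<ge> real n" shows "n \<le> card Y"
proof -
  have "(\<Sum>w\<in>Y. x w) \<le> (\<Sum>w\<in>Y. 1)" by (intro sum_mono x_le1)
  then show ?thesis using assms by simp
qed

text \<open>By inclusion-exclusion the left side is at most the weight that \<open>p\<close> and
  \<open>q\<close> have in common. If \<open>T\<close> sees almost all of \<open>Y\<close>, then
  nearly all of that weight is common to the \<open>k + 1\<close> vertices of \<open>T\<close> and
  the edge \<open>p q\<close>.\<close>

lemma common_weight_set:
  assumes pq: "E p q" and Y: "Y \<subseteq> V" and T: "T \<subseteq> V" "p \<notin> T" "q \<notin> T" "card T = k - 1"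
    and b: "\<And>s. s \<in> T \<Longrightarrow> (\<Sum>w\<in>Y. x w) - wt Y s \<le> b"
  shows "wt Y p + wt Y q - (\<Sum>w\<in>Y. x w) \<le> real t + (real k - 1) * b"
proof -
  have pV: "p \<in> V" "q \<in> V" "p \<noteq> q" using pq EV sym irr by blast+
  have finT: "finite T" using T fin_sub by auto
  have cS: "card ({p, q} \<union> T) = k + 1"
    using T pV k2 finT by (subst card_Un_disjoint) auto
  have "wt Y p + wt Y q - (\<Sum>w\<in>Y. x w) = (\<Sum>w\<in>Y. (a p w + a q w - 1) * x w)"
    by (simp add: wt_def algebra_simps sum.distrib sum_subtractf)
  also have "\<dots> \<le> (\<Sum>w\<in>Y. if E p w \<and> E q w then x w else 0)"
    by (intro sum_mono) (auto simp: a_def x_nonneg)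
  also have "\<dots> = (\<Sum>w\<in>{w \<in> Y. E p w \<and> E q w}. x w)"
    using fin_sub[OF Y] by (rule sum.inter_filter[symmetric])
  also have "\<dots> \<le> real t + (\<Sum>s\<in>T. (\<Sum>w\<in>Y. x w) - wt Y s)"
    by (rule kplus_weight[OF _ cS _ _ pq _ Y]) (use T pV in auto)
  also have "\<dots> \<le> real t + (\<Sum>s\<in>T. b)"
    by (intro add_left_mono sum_mono b)
  also have "\<dots> = real t + (real k - 1) * b" using T k2 by (simp add: of_nat_diff)
  finally show ?thesis .
qed

text \<open>Two more than \<open>k - 1\<close> vertices are required because \<open>p\<close> and
  \<open>q\<close> may themselves lie in \<open>R\<close>.\<close>

lemma common_weight_le:
  assumes pq: "E p q" and Y: "Y \<subseteq> V" and R: "R \<subseteq> V" "k + 1 \<le> card R"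
    and b: "\<And>s. s \<in> R \<Longrightarrow> (\<Sum>w\<in>Y. x w) - wt Y s \<le> b"
  shows "wt Y p + wt Y q - (\<Sum>w\<in>Y. x w) \<le> real t + (real k - 1) * b"
proof -
  have "card R - card {p, q} \<le> card (R - {p, q})" by (rule diff_card_le_card_Diff) simp
  moreover have "card {p, q} \<le> 2" by (simp add: card_insert_if)
  ultimately have "k - 1 \<le> card (R - {p, q})" using R by simp
  then obtain T where "T \<subseteq> R - {p, q}" "card T = k - 1"
    by (meson obtain_subset_with_card_n)
  then show ?thesis using R b by (intro common_weight_set[OF pq Y]) auto
qed

section \<open>Graphs close to complete bipartite ones\<close>

lemma markov_weight:
  assumes "finite Y" "\<And>v. v \<in> Y \<Longrightarrow> 0 \<le> f v" "(\<Sum>v\<in>Y. x v * f v) \<le> B" "0 < b"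
  shows "(\<Sum>v\<in>{v \<in> Y. b < f v}. x v) \<le> B / b"
proof -
  have "b * (\<Sum>v\<in>{v \<in> Y. b < f v}. x v) = (\<Sum>v\<in>{v \<in> Y. b < f v}. x v * b)"
    by (simp add: sum_distrib_left mult.commute)
  also have "\<dots> \<le> (\<Sum>v\<in>{v \<in> Y. b < f v}. x v * f v)"
    by (intro sum_mono mult_left_mono x_nonneg) auto
  also have "\<dots> \<le> (\<Sum>v\<in>Y. x v * f v)"
    using assms by (intro sum_mono2) (auto simp: x_nonneg)
  finally show ?thesis using assms by (simp add: field_simps)
qed

text \<open>The threshold \<open>1 / 16\<close> is a lower bound for \<open>X / (4 \<lambda>)\<close> with \<open>X\<close> the squared norm of \<open>x\<close>: an edge inside a
  side with \<open>x p x q\<close> below it contributes less to the Rayleigh quotient than it takes away from the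
  number of edges across. An edge above it is paid for by the pairs missing at its bad end.\<close>

lemma side_excess_le:
  assumes YZ: "Y \<subseteq> V" "Z \<subseteq> V"
    and inw: "\<And>p. p \<in> Y \<Longrightarrow> wt Y p \<le> lam / 1024"
    and bad: "\<And>p q. p \<in> Y \<Longrightarrow> q \<in> Y \<Longrightarrow> E p q \<Longrightarrow>
      lam / 16 \<le> (\<Sum>w\<in>Z. (1 - a p w) * (x w)\<^sup>2) \<or> lam / 16 \<le> (\<Sum>w\<in>Z. (1 - a q w) * (x w)\<^sup>2)"
  shows "(\<Sum>p\<in>Y. \<Sum>q\<in>Y. a p q * (x p * x q - 1 / 16))
    \<le> (\<Sum>p\<in>Y. \<Sum>q\<in>Z. (1 - a p q) * (x p)\<^sup>2 * (x q)\<^sup>2) / 2"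
proof -
  define b where "b = (\<lambda>p. of_bool (lam / 16 \<le> (\<Sum>w\<in>Z. (1 - a p w) * (x w)\<^sup>2)) :: real)"
  \<comment> \<open>Below \<open>1 / 16\<close> the left side is nonpositive, above it
    \<open>16 * x p\<close> is at least one. The additional factor \<open>x p\<close> produces the
    square that the missing pairs at \<open>p\<close> carry.\<close>
  have half: "x p * x q - 1 / 16 \<le> 16 * (x p)\<^sup>2 * x q" for p q
  proof (cases "x p \<le> 1 / 16")
    case True
    have "x p * x q \<le> 1 / 16 * 1" using True x_le1 x_nonneg by (intro mult_mono) auto
    moreover have "0 \<le> 16 * (x p)\<^sup>2 * x q" using x_nonneg by simp
    ultimately show ?thesis by linarith
  next
    case False
    have "1 * (x p * x q) \<le> (16 * x p) * (x p * x q)"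
      using False x_nonneg by (intro mult_right_mono) auto
    then show ?thesis by (simp add: power2_eq_square mult_ac)
  qed
  have "(\<Sum>p\<in>Y. \<Sum>q\<in>Y. a p q * (x p * x q - 1 / 16))
    \<le> (\<Sum>p\<in>Y. \<Sum>q\<in>Y. a p q * (16 * b p * (x p)\<^sup>2 * x q) + a p q * (16 * b q * (x q)\<^sup>2 * x p))"
  proof (intro sum_mono)
    fix p q assume pq: "p \<in> Y" "q \<in> Y"
    have nn: "0 \<le> 16 * b r * (x r)\<^sup>2 * x s" for r s using x_nonneg by (simp add: b_def)
    show "a p q * (x p * x q - 1 / 16) \<le> a p q * (16 * b p * (x p)\<^sup>2 * x q) + a p q * (16 * b q * (x q)\<^sup>2 * x p)"
    proof (cases "E p q")
      case True
      then have "b p = 1 \<or> b q = 1" using bad[OF pq True] by (auto simp: b_def)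
      then have "x p * x q - 1 / 16 \<le> 16 * b p * (x p)\<^sup>2 * x q + 16 * b q * (x q)\<^sup>2 * x p"
      proof
        assume "b p = 1"
        then have "16 * b p * (x p)\<^sup>2 * x q = 16 * (x p)\<^sup>2 * x q" by simp
        then show ?thesis using half[of p q] nn[of q p] by linarith
      next
        assume "b q = 1"
        then have "16 * b q * (x q)\<^sup>2 * x p = 16 * (x q)\<^sup>2 * x p" by simp
        then show ?thesis using half[of q p] nn[of p q] mult.commute[of "x p" "x q"] by linarith
      qed
      then show ?thesis using True by (simp add: a_def)
    qed (simp add: a_def)
  qed
  also have "\<dots> = 2 * (\<Sum>p\<in>Y. \<Sum>q\<in>Y. a p q * (16 * b p * (x p)\<^sup>2 * x q))"
    using swap_a[of "\<lambda>p q. 16 * b p * (x p)\<^sup>2 * x q" Y Y] by (simp add: sum.distrib)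
  also have "(\<Sum>p\<in>Y. \<Sum>q\<in>Y. a p q * (16 * b p * (x p)\<^sup>2 * x q)) = (\<Sum>p\<in>Y. 16 * b p * (x p)\<^sup>2 * wt Y p)"
    by (simp add: wt_def sum_distrib_left mult_ac)
  \<comment> \<open>The constant \<open>1024\<close> is fixed here: \<open>16 * (lam / 1024)\<close>
    is a quarter of the deficiency \<open>lam / 16\<close> at a bad end, and the two orders of an
    edge double this to one half.\<close>
  also have "\<dots> \<le> (\<Sum>p\<in>Y. 16 * b p * (x p)\<^sup>2 * (lam / 1024))"
    by (intro sum_mono mult_left_mono inw) (auto simp: b_def)
  also have "\<dots> = (\<Sum>p\<in>Y. (x p)\<^sup>2 * (b p * (lam / 16))) / 4"
    by (simp add: sum_divide_distrib mult_ac)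
  also have "\<dots> \<le> (\<Sum>p\<in>Y. (x p)\<^sup>2 * (\<Sum>w\<in>Z. (1 - a p w) * (x w)\<^sup>2)) / 4"
  proof (intro divide_right_mono sum_mono mult_left_mono)
    fix p
    have "0 \<le> (\<Sum>w\<in>Z. (1 - a p w) * (x w)\<^sup>2)"
      by (intro sum_nonneg mult_nonneg_nonneg) (auto simp: a_le1)
    then show "b p * (lam / 16) \<le> (\<Sum>w\<in>Z. (1 - a p w) * (x w)\<^sup>2)"
      by (auto simp: b_def)
  qed auto
  also have "(\<Sum>p\<in>Y. (x p)\<^sup>2 * (\<Sum>w\<in>Z. (1 - a p w) * (x w)\<^sup>2))
      = (\<Sum>p\<in>Y. \<Sum>q\<in>Z. (1 - a p q) * (x p)\<^sup>2 * (x q)\<^sup>2)"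
    by (simp add: sum_distrib_left mult_ac)
  finally show ?thesis by simp
qed

text \<open>The cross terms of \<open>lam * X\<close> are bounded by AM-GM with parameter
  \<open>s = X / (2 * lam)\<close>, the value of \<open>x p * x q\<close> in a balanced complete
  bipartite graph with constant entries. Since the squared norms of the sides have product at most
  \<open>X\<^sup>2 / 4\<close>, this gives \<open>lam * X / 2\<close> plus \<open>s\<close> per
  cross edge, minus the missing pairs \<open>F\<close>. Each side spends half of \<open>F\<close> on
  its inner edges, which then also cost at most \<open>s\<close> each; this needs
  \<open>1 / 16 \<le> s / 2\<close>, hence \<open>lam / 4 \<le> X\<close>.\<close>

lemma bipartition_bound:
  assumes UZ: "U \<union> Z = V" "U \<inter> Z = {}"
    and X: "X = (\<Sum>v\<in>V. (x v)\<^sup>2)" "lam / 4 \<le> X" "X \<le> 2 * lam"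
    and U: "(\<Sum>p\<in>U. \<Sum>q\<in>U. a p q * (x p * x q - 1 / 16))
      \<le> (\<Sum>p\<in>U. \<Sum>q\<in>Z. (1 - a p q) * (x p)\<^sup>2 * (x q)\<^sup>2) / 2"
    and Z: "(\<Sum>p\<in>Z. \<Sum>q\<in>Z. a p q * (x p * x q - 1 / 16))
      \<le> (\<Sum>p\<in>Z. \<Sum>q\<in>U. (1 - a p q) * (x p)\<^sup>2 * (x q)\<^sup>2) / 2"
  shows "lam\<^sup>2 \<le> m"
proof -
  define F where "F = (\<Sum>p\<in>U. \<Sum>q\<in>Z. (1 - a p q) * (x p)\<^sup>2 * (x q)\<^sup>2)"
  define s where "s = X / (2 * lam)"
  have s: "s > 0" "1 / 16 \<le> s / 2" using X lam1 by (auto simp: s_def field_simps)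
  have UV: "U \<subseteq> V" "Z \<subseteq> V" using UZ by auto
  have fin: "finite U" "finite Z" using UV fin_sub by auto
  have split: "(\<Sum>p\<in>V. \<Sum>q\<in>V. a p q * f p q) =
      (\<Sum>p\<in>U. \<Sum>q\<in>U. a p q * f p q) + (\<Sum>p\<in>Z. \<Sum>q\<in>Z. a p q * f p q) + 2 * (\<Sum>p\<in>U. \<Sum>q\<in>Z. a p q * f p q)"
    if fs: "\<And>p q. f p q = f q p" for f :: "'a \<Rightarrow> 'a \<Rightarrow> real"
  proof -
    have s: "(\<Sum>q\<in>V. g q) = (\<Sum>q\<in>U. g q) + (\<Sum>q\<in>Z. g q)" for g :: "'a \<Rightarrow> real"
      using fin UZ(2) sum.union_disjoint[of U Z g] UZ(1) by simp
    have "(\<Sum>p\<in>Z. \<Sum>q\<in>U. a p q * f p q) = (\<Sum>p\<in>U. \<Sum>q\<in>Z. a p q * f p q)"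
      unfolding swap_a[of f U Z] by (intro sum.cong refl arg_cong2[where f = "(*)"] fs)
    then show ?thesis by (simp add: s sum.distrib)
  qed
  have FZ: "(\<Sum>p\<in>Z. \<Sum>q\<in>U. (1 - a p q) * (x p)\<^sup>2 * (x q)\<^sup>2) = F"
    unfolding F_def by (subst sum.swap) (intro sum.cong refl, simp add: a_sym mult_ac)
  have XUZ: "X = (\<Sum>v\<in>U. (x v)\<^sup>2) + (\<Sum>v\<in>Z. (x v)\<^sup>2)"
    using fin UZ(2) sum.union_disjoint[of U Z "\<lambda>v. (x v)\<^sup>2"] UZ(1) X by simp
  have "lam * X = (\<Sum>p\<in>V. x p * wt V p)"
    unfolding X sum_distrib_left by (intro sum.cong refl) (simp add: wt_V power2_eq_square)
  also have "\<dots> = (\<Sum>p\<in>V. \<Sum>q\<in>V. a p q * (x p * x q))"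
    by (simp add: wt_def sum_distrib_left mult_ac)
  also have "\<dots> = (\<Sum>p\<in>U. \<Sum>q\<in>U. a p q * (x p * x q)) + (\<Sum>p\<in>Z. \<Sum>q\<in>Z. a p q * (x p * x q))
      + 2 * (\<Sum>p\<in>U. \<Sum>q\<in>Z. a p q * (x p * x q))"
    by (rule split) (rule mult.commute)
  finally have 1: "lam * X = \<dots>" .
  have 2: "2 * m = (\<Sum>p\<in>U. \<Sum>q\<in>U. a p q) + (\<Sum>p\<in>Z. \<Sum>q\<in>Z. a p q) + 2 * (\<Sum>p\<in>U. \<Sum>q\<in>Z. a p q)"
    using edges split[of "\<lambda>_ _. 1"] by (simp add: a_def)
  have "(\<Sum>p\<in>U. \<Sum>q\<in>Z. a p q * (x p * x q)) \<le>
      (\<Sum>p\<in>U. \<Sum>q\<in>Z. (s * a p q + ((x p)\<^sup>2 * (x q)\<^sup>2 - (1 - a p q) * (x p)\<^sup>2 * (x q)\<^sup>2) / s) / 2)"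
  proof (intro sum_mono)
    fix p q
    show "a p q * (x p * x q) \<le> (s * a p q + ((x p)\<^sup>2 * (x q)\<^sup>2 - (1 - a p q) * (x p)\<^sup>2 * (x q)\<^sup>2) / s) / 2"
    proof (cases "E p q")
      case True
      have "0 \<le> (s - x p * x q)\<^sup>2 / s" using s by simp
      also have "\<dots> = s - 2 * (x p * x q) + (x p)\<^sup>2 * (x q)\<^sup>2 / s"
        using s by (simp add: power2_eq_square field_simps)
      finally show ?thesis using True by (simp add: a_def)
    qed (simp add: a_def)
  qed
  also have "\<dots> = (s * (\<Sum>p\<in>U. \<Sum>q\<in>Z. a p q) + ((\<Sum>p\<in>U. (x p)\<^sup>2) * (\<Sum>q\<in>Z. (x q)\<^sup>2) - F) / s) / 2"
    unfolding F_def sum_product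
    by (simp add: sum_distrib_left sum.distrib sum_subtractf flip: sum_divide_distrib)
  finally have 3: "2 * (\<Sum>p\<in>U. \<Sum>q\<in>Z. a p q * (x p * x q)) \<le>
      s * (\<Sum>p\<in>U. \<Sum>q\<in>Z. a p q) + ((\<Sum>p\<in>U. (x p)\<^sup>2) * (\<Sum>q\<in>Z. (x q)\<^sup>2) - F) / s" by simp
  have "(\<Sum>p\<in>U. (x p)\<^sup>2) * (\<Sum>q\<in>Z. (x q)\<^sup>2) \<le> X\<^sup>2 / 4"
    using sum_squares_ge_zero[of "(\<Sum>p\<in>U. (x p)\<^sup>2) - (\<Sum>q\<in>Z. (x q)\<^sup>2)" 0]
    unfolding XUZ by (simp add: power2_eq_square algebra_simps)
  then have "((\<Sum>p\<in>U. (x p)\<^sup>2) * (\<Sum>q\<in>Z. (x q)\<^sup>2) - F) / s \<le> (X\<^sup>2 / 4 - F) / s"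
    using s by (intro divide_right_mono) auto
  also have "\<dots> = lam * X / 2 - F / s"
    using X lam1 by (simp add: s_def field_simps power2_eq_square)
  also have "\<dots> \<le> lam * X / 2 - F"
  proof -
    have F0: "0 \<le> F" unfolding F_def by (intro sum_nonneg mult_nonneg_nonneg) (auto simp: a_le1)
    have "s \<le> 1" using X lam1 by (simp add: s_def field_simps)
    then have "F * s \<le> F" using F0 s by (simp add: mult_left_le)
    then have "F \<le> F / s" using s by (simp add: field_simps)
    then show ?thesis by simp
  qed
  finally have 4: "((\<Sum>p\<in>U. (x p)\<^sup>2) * (\<Sum>q\<in>Z. (x q)\<^sup>2) - F) / s \<le> lam * X / 2 - F" .
  have in_le: "(\<Sum>p\<in>Y. \<Sum>q\<in>Y. a p q * (x p * x q)) \<le>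
      (\<Sum>p\<in>Y. \<Sum>q\<in>Y. a p q * (x p * x q - 1 / 16)) + s / 2 * (\<Sum>p\<in>Y. \<Sum>q\<in>Y. a p q)" for Y
  proof -
    have "(\<Sum>p\<in>Y. \<Sum>q\<in>Y. a p q * (x p * x q)) \<le> (\<Sum>p\<in>Y. \<Sum>q\<in>Y. a p q * (x p * x q - 1 / 16) + s / 2 * a p q)"
    proof (intro sum_mono)
      fix p q
      have "a p q * (1 / 16) \<le> a p q * (s / 2)" using s by (intro mult_left_mono) auto
      then show "a p q * (x p * x q) \<le> a p q * (x p * x q - 1 / 16) + s / 2 * a p q"
        by (simp add: algebra_simps)
    qed
    then show ?thesis by (simp add: sum.distrib sum_distrib_left)
  qed
  have "lam * X \<le> lam * X / 2 + s * m"
  proof -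
    have "2 * (s * m) = s * (\<Sum>p\<in>U. \<Sum>q\<in>U. a p q) + s * (\<Sum>p\<in>Z. \<Sum>q\<in>Z. a p q)
        + 2 * (s * (\<Sum>p\<in>U. \<Sum>q\<in>Z. a p q))"
      using arg_cong[OF 2, of "\<lambda>y. s * y"] by (simp add: distrib_left)
    then show ?thesis
      using 1 3 4 in_le[of U] in_le[of Z] U Z unfolding FZ F_def[symmetric] by linarith
  qed
  then have "lam * X / 2 \<le> X * m / (2 * lam)" by (simp add: s_def)
  then have "X * lam\<^sup>2 \<le> X * m" using lam1 by (simp add: field_simps power2_eq_square)
  moreover have "X > 0" using X lam1 by simp
  ultimately show ?thesis by simp
qed

text \<open>A heavy row gives at most \<open>lam\<close>. In a light row the summand is at most
  \<open>d\<close> unless both entries exceed \<open>d\<close>, and then it is at most one and so at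
  most \<open>(x v / d) * (x w / d)\<close>. The two divisions by \<open>d\<close> turn
  \<open>d ^ 3 * lam\<close> into \<open>d * lam\<close>, which is why the threshold is a cube. The
  terms \<open>d\<close> are counted by the edges.\<close>

lemma excess_le:
  assumes g: "card {w \<in> N. d ^ 3 * lam \<le> wt N w} \<le> h" and d: "0 < d" "d \<le> 1"
    and mle: "m \<le> lam\<^sup>2"
  shows "Q \<le> real h * lam + 3 * d * lam\<^sup>2"
proof -
  define P where "P = {w \<in> N. d ^ 3 * lam \<le> wt N w}"
  have term_le: "a v w * (x v + x w - 1) \<le> a v w * d + (x v / d) * (a v w * x w / d)" for v w
  proof -
    have "x v + x w - 1 \<le> d + (x v / d) * (x w / d)"
    proof (cases "x v \<le> d \<or> x w \<le> d")
      case True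
      have "0 \<le> (x v / d) * (x w / d)" using d x_nonneg by simp
      then show ?thesis using True x_le1[of v] x_le1[of w] by auto
    next
      case False
      then have "1 * 1 \<le> (x v / d) * (x w / d)" using d by (intro mult_mono) auto
      then show ?thesis using x_le1[of v] x_le1[of w] d by linarith
    qed
    then show ?thesis by (cases "E v w") (auto simp: a_def)
  qed
  have row: "(\<Sum>w\<in>N. a v w * (x v + x w - 1)) \<le> dg N v * d + (if v \<in> P then lam else 0) + x v * (d * lam)"
    if v: "v \<in> N" for v
  proof (cases "v \<in> P")
    case True
    have "(\<Sum>w\<in>N. a v w * (x v + x w - 1)) \<le> wt N v"
      unfolding wt_def by (intro sum_mono mult_left_mono) (auto simp: x_le1)
    also have "\<dots> \<le> lam" by (rule wt_N_le)
    moreover have "0 \<le> dg N v * d" "0 \<le> x v * (d * lam)" using d lam1 x_nonneg dg_nonneg by auto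
    ultimately show ?thesis using True by simp
  next
    case False
    then have w3: "wt N v \<le> d ^ 3 * lam" using v by (simp add: P_def)
    have "(\<Sum>w\<in>N. a v w * (x v + x w - 1)) \<le> (\<Sum>w\<in>N. a v w * d + (x v / d) * (a v w * x w / d))"
      by (intro sum_mono term_le)
    also have "\<dots> = dg N v * d + x v / d * (wt N v / d)"
      by (simp add: dg_def wt_def sum.distrib sum_distrib_right sum_distrib_left sum_divide_distrib)
    also have "x v / d * (wt N v / d) \<le> x v / d * (d ^ 3 * lam / d)"
      using d x_nonneg w3 by (intro mult_left_mono divide_right_mono) auto
    also have "\<dots> = x v * (d * lam)" using d by (simp add: power3_eq_cube)
    finally show ?thesis using False by simp
  qed
  have "Q \<le> (\<Sum>v\<in>N. dg N v * d + (if v \<in> P then lam else 0) + x v * (d * lam))"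
    unfolding Q_def by (intro sum_mono row)
  also have "\<dots> = (\<Sum>v\<in>N. dg N v) * d + (\<Sum>v\<in>N. if v \<in> P then lam else 0) + lam * (d * lam)"
    by (simp add: sum.distrib sum_distrib_right sum_N flip: sum_distrib_right)
  also have "(\<Sum>v\<in>N. if v \<in> P then lam else 0) = real (card P) * lam"
  proof -
    have "P = {v \<in> N. v \<in> P}" by (auto simp: P_def)
    then show ?thesis using sum.inter_filter[OF fin_N, of "\<lambda>_. lam" "\<lambda>v. v \<in> P"] by simp
  qed
  also have "real (card P) * lam \<le> real h * lam"
    using g lam1 by (intro mult_right_mono) (auto simp: P_def)
  also have "(\<Sum>v\<in>N. dg N v) * d \<le> 2 * lam\<^sup>2 * d"
  proof (intro mult_right_mono)
    have "(\<Sum>v\<in>N. dg N v) \<le> (\<Sum>v\<in>N. dg V v)" by (intro sum_mono dg_mono N_V) simp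
    also have "\<dots> \<le> (\<Sum>v\<in>V. dg V v)"
      using finV N_V by (intro sum_mono2) (auto simp: dg_nonneg)
    also have "\<dots> = 2 * m" using edges by (simp add: dg_def a_def)
    finally show "(\<Sum>v\<in>N. dg N v) \<le> 2 * lam\<^sup>2" using mle by simp
  qed (use d in simp)
  finally show ?thesis by (simp add: power2_eq_square algebra_simps)
qed

text \<open>With \<open>D\<close> and \<open>eW\<close> small and \<open>W\<close> heavy, almost all
  pairs between \<open>N\<close> and \<open>W\<close> are edges and entries on \<open>W\<close> are
  close to one on average. After a few vertices change sides, \<open>bipartition_bound\<close>
  contradicts \<open>m < lam\<^sup>2\<close>.\<close>

lemma dense_case:
  assumes z: "z = 1 / (4096 * real k)" and d: "d = z / 20480"
    and mlt: "m < lam\<^sup>2"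
    and D: "D \<le> 2 * d * lam\<^sup>2" and eW: "eW \<le> 4 * d * lam\<^sup>2"
    and om: "lam / 3 \<le> (\<Sum>v\<in>W. x v)"
    and big: "real t \<le> z * lam" "12 * (real k + 1) \<le> lam"
  shows False
proof -
  define om where "om = (\<Sum>v\<in>W. x v)"
  have z0: "0 < z" and kz: "real k * z = 1 / 4096" using z k2 by auto
  have "2 * z \<le> real k * z" using z0 k2 by (intro mult_right_mono) auto
  then have zle: "z \<le> 1 / 8192" using kz by simp
  have dle: "d \<le> 1 / 160000000" using d z0 zle by auto
  have lam0: "0 < lam" using lam1 by simp
  have dl: "d * lam \<le> lam / 160000000" using dle lam0 by simp
  have zl': "z * lam \<le> lam / 8192" using zle lam0 by simp
  have kzl: "real k * (z * lam) = lam / 4096" using kz using arg_cong[OF kz, of "\<lambda>y. y * lam"] by simp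
  \<comment> \<open>A defect \<open>1 - x v\<close> on \<open>W\<close> is charged to
    \<open>D\<close> along edges to \<open>N\<close> and to \<open>eW\<close> along edges inside
    \<open>W\<close>.\<close>
  have X1: "(\<Sum>v\<in>W. x v * (1 - x v)) \<le> 6 * d * lam"
  proof -
    have "lam * (\<Sum>v\<in>W. x v * (1 - x v)) = (\<Sum>v\<in>W. (lam * x v) * (1 - x v))"
      by (simp add: sum_distrib_left mult_ac)
    also have "\<dots> \<le> (\<Sum>v\<in>W. dg N v * (1 - x v) + dg W v)"
    proof (rule sum_mono)
      fix v assume "v \<in> W"
      have "(lam * x v) * (1 - x v) = wt N v * (1 - x v) + wt W v * (1 - x v)"
        unfolding wt_W[OF \<open>v \<in> W\<close>] by (simp add: algebra_simps)
      also have "\<dots> \<le> dg N v * (1 - x v) + dg W v * 1"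
        using x_le1[of v] x_nonneg[of v] wt_le_dg dg_nonneg by (intro add_mono mult_mono) auto
      finally show "(lam * x v) * (1 - x v) \<le> dg N v * (1 - x v) + dg W v" by simp
    qed
    also have "\<dots> = D + eW" by (simp add: D_def eW_def sum.distrib)
    also have "\<dots> \<le> 6 * d * lam\<^sup>2" using D eW by linarith
    also have "\<dots> = lam * (6 * d * lam)" by (simp add: power2_eq_square)
    finally show ?thesis using lam0 by simp
  qed
  have X1': "(\<Sum>v\<in>W. x v * (1 - x v)) \<le> lam / 1000000" using X1 dl lam0 by linarith
  have miss: "(\<Sum>v\<in>W. x v * (lam - wt N v)) \<le> 10 * d * lam\<^sup>2"
  proof -
    have "(\<Sum>v\<in>W. x v * (lam - wt N v)) \<le> (\<Sum>v\<in>W. lam * (x v * (1 - x v)) + dg W v)"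
    proof (rule sum_mono)
      fix v assume "v \<in> W"
      then have wWv: "wt W v = lam * x v - wt N v" using wt_W by simp
      have "x v * (lam - wt N v) = lam * (x v * (1 - x v)) + x v * wt W v"
        unfolding wWv by (simp add: algebra_simps)
      also have "x v * wt W v \<le> 1 * dg W v"
        using x_le1 x_nonneg wt_le_dg wt_nonneg by (intro mult_mono) auto
      finally show "x v * (lam - wt N v) \<le> lam * (x v * (1 - x v)) + dg W v" by simp
    qed
    also have "\<dots> = lam * (\<Sum>v\<in>W. x v * (1 - x v)) + eW"
      by (simp add: eW_def sum.distrib sum_distrib_left)
    also have "\<dots> \<le> lam * (6 * d * lam) + 4 * d * lam\<^sup>2" using X1 eW lam0 by (intro add_mono mult_left_mono) auto
    finally show ?thesis by (simp add: power2_eq_square)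
  qed
  \<comment> \<open>The same missing pairs between \<open>N\<close> and \<open>W\<close>, counted
    from the side of \<open>N\<close>.\<close>
  have miss': "(\<Sum>v\<in>N. x v * (om - wt W v)) \<le> 10 * d * lam\<^sup>2"
  proof -
    have "(\<Sum>v\<in>N. x v * (om - wt W v)) = (\<Sum>v\<in>N. \<Sum>w\<in>W. x v * ((1 - a v w) * x w))"
      by (simp add: om_def wt_def algebra_simps sum_subtractf sum_distrib_left)
    also have "\<dots> = (\<Sum>w\<in>W. \<Sum>v\<in>N. x w * ((1 - a w v) * x v))"
      by (subst sum.swap) (simp add: a_sym[of _ "_"] mult_ac)
    also have "\<dots> = (\<Sum>w\<in>W. x w * (lam - wt N w))"
      unfolding sum_N[symmetric] by (simp add: wt_def algebra_simps sum_subtractf sum_distrib_left)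
    finally show ?thesis using miss by simp
  qed
  \<comment> \<open>The choice \<open>d = z / 20480\<close> is made for this: with threshold
    \<open>z * lam\<close>, Markov's inequality leaves exceptional weight at most
    \<open>lam / 2048\<close> on either side.\<close>
  have ratio: "10 * d * lam\<^sup>2 / (z * lam) = lam / 2048"
    using z0 lam0 by (simp add: d power2_eq_square field_simps)
  define Wr where "Wr = {v \<in> W. lam - wt N v \<le> z * lam}"
  define Nr where "Nr = {v \<in> N. om - wt W v \<le> z * lam}"
  have Wbad: "(\<Sum>v\<in>W - Wr. x v) \<le> lam / 2048"
  proof -
    have "W - Wr = {v \<in> W. z * lam < lam - wt N v}" by (auto simp: Wr_def)
    then show ?thesis
      using markov_weight[OF fin_W _ miss, of "z * lam"] z0 lam0 wt_N_le ratio by simp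
  qed
  have Nbad: "(\<Sum>v\<in>N - Nr. x v) \<le> lam / 2048"
  proof -
    have "N - Nr = {v \<in> N. z * lam < om - wt W v}" by (auto simp: Nr_def)
    then show ?thesis
      using markov_weight[OF fin_N _ miss', of "z * lam"] z0 lam0 wt_le_sum ratio by (simp add: om_def)
  qed
  have sub: "Wr \<subseteq> W" "Nr \<subseteq> N" by (auto simp: Wr_def Nr_def)
  have WrV: "Wr \<subseteq> V" and NrV: "Nr \<subseteq> V" using sub W_V N_V by auto
  have "(\<Sum>v\<in>W. x v) = (\<Sum>v\<in>W - Wr. x v) + (\<Sum>v\<in>Wr. x v)"
    by (rule sum.subset_diff) (auto simp: sub)
  then have cWr: "k + 1 \<le> card Wr" using Wbad om big by (intro card_ge_weight) simp
  have "(\<Sum>v\<in>N. x v) = (\<Sum>v\<in>N - Nr. x v) + (\<Sum>v\<in>Nr. x v)"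
    by (rule sum.subset_diff) (auto simp: sub)
  then have cNr: "k + 1 \<le> card Nr" using Nbad sum_N big by (intro card_ge_weight) simp
  \<comment> \<open>The choice of \<open>z\<close> is made for this: \<open>k - 1\<close> misses of
    \<open>z * lam\<close> each and \<open>t \<le> z * lam\<close> make at most
    \<open>lam / 4096\<close> together.\<close>
  have bnd: "real t + (real k - 1) * (z * lam) \<le> lam / 4096"
    using big kzl by (simp add: algebra_simps)
  have comN: "wt N p + wt N q \<le> lam + lam / 4096" if "E p q" for p q
    using common_weight_le[OF that N_V WrV cWr, of "z * lam"] bnd sum_N by (auto simp: Wr_def)
  have comW: "wt W p + wt W q \<le> om + lam / 4096" if "E p q" for p q
    using common_weight_le[OF that W_V NrV cNr, of "z * lam"] bnd by (auto simp: Nr_def om_def)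
  have sN: "wt N w \<le> lam / 2048" if w: "w \<in> N" for w
  proof -
    have "E u w" using w by (simp add: N_def)
    moreover have "wt N u = lam" using sum_N finV
      by (auto simp: wt_def a_def N_def intro!: sum.cong)
    ultimately show ?thesis using comN[of u w] lam0 by simp
  qed
  \<comment> \<open>A vertex of \<open>Wr\<close> sees nearly all of \<open>N\<close>, so by
    \<open>comN\<close> it has no neighbour with noticeable weight in \<open>N\<close>. The
    neighbours of \<open>v\<close> in \<open>W\<close> are thus exceptional.\<close>
  have sW: "wt W v \<le> lam / 2048" if v: "v \<in> W" "lam / 2048 < wt N v" for v
  proof -
    have "\<not> E v w" if "w \<in> Wr" for w
    proof
      assume "E v w"
      have "lam - z * lam \<le> wt N w" using \<open>w \<in> Wr\<close> by (simp add: Wr_def)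
      then show False using comN[OF \<open>E v w\<close>] v zl' lam0 by linarith
    qed
    then have "wt W v = wt (W - Wr) v"
      unfolding wt_def by (intro sum.mono_neutral_right) (auto simp: a_def)
    also have "\<dots> \<le> (\<Sum>w\<in>W - Wr. x w)" by (rule wt_le_sum)
    finally show ?thesis using Wbad by simp
  qed
  \<comment> \<open>Vertices of \<open>W\<close> that see almost nothing of \<open>N\<close> fit on
    the side of \<open>N\<close> and are moved there; being exceptional, they have little
    weight.\<close>
  define Mv where "Mv = {v \<in> W. wt N v \<le> lam / 2048}"
  have "Mv \<subseteq> W - Wr"
  proof
    fix v assume "v \<in> Mv"
    then have v: "v \<in> W" "wt N v \<le> lam / 2048" by (auto simp: Mv_def)
    then have "\<not> lam - wt N v \<le> z * lam" using zl' lam0 by linarith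
    then show "v \<in> W - Wr" using v by (simp add: Wr_def)
  qed
  then have "(\<Sum>v\<in>Mv. x v) \<le> (\<Sum>v\<in>W - Wr. x v)"
    using fin_W by (intro sum_mono2) (auto simp: x_nonneg)
  then have Mv: "(\<Sum>v\<in>Mv. x v) \<le> lam / 2048" using Wbad by simp
  have MvW: "Mv \<subseteq> W" by (auto simp: Mv_def)
  define U where "U = insert u (W - Mv)"
  define Z where "Z = N \<union> Mv"
  have UZ: "U \<union> Z = V" "U \<inter> Z = {}"
    using V_eq MvW u_N u_W N_W by (auto simp: U_def Z_def)
  have UV: "U \<subseteq> V" "Z \<subseteq> V" using UZ by auto
  have uno: "\<not> E u w" if "w \<in> W" for w using that EV sym by (auto simp: W_def N_def)
  have inU: "wt U p \<le> lam / 1024" if p: "p \<in> U" for p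
  proof (cases "p = u")
    case True
    have "wt U p = 0" unfolding wt_def using True uno irr by (intro sum.neutral) (auto simp: U_def a_def)
    then show ?thesis using lam0 by simp
  next
    case False
    then have pW: "p \<in> W" "lam / 2048 < wt N p" using p by (auto simp: U_def Mv_def)
    have "wt U p = wt (W - Mv) p" unfolding wt_def U_def
      using u_W a_uW[OF pW(1)] by simp
    also have "\<dots> \<le> wt W p" by (rule wt_mono) (auto simp: W_V)
    also have "\<dots> \<le> lam / 2048" by (rule sW[OF pW])
    finally show ?thesis using lam0 by simp
  qed
  have inZ: "wt Z p \<le> lam / 1024" if p: "p \<in> Z" for p
  proof -
    have "wt Z p = wt N p + wt Mv p"
      unfolding Z_def using N_W MvW N_V W_V by (intro wt_Un) auto
    moreover have "wt N p \<le> lam / 2048" using p sN by (auto simp: Z_def Mv_def)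
    moreover have "wt Mv p \<le> lam / 2048" using wt_le_sum[of Mv p] Mv by simp
    ultimately show ?thesis by simp
  qed
  \<comment> \<open>Vertices of \<open>Nr\<close> see almost all of \<open>W\<close>, so their
    entries are at least \<open>1 / 4\<close>. This converts missing weight into missing squares at
    a loss of a factor four.\<close>
  have missN: "lam / 16 \<le> (\<Sum>w\<in>Z. (1 - a p w) * (x w)\<^sup>2)" if p: "wt N p \<le> 2 / 3 * lam" for p
  proof -
    have "lam - wt N p = (\<Sum>w\<in>N. (1 - a p w) * x w)"
      unfolding sum_N[symmetric] by (simp add: wt_def algebra_simps sum_subtractf)
    also have "\<dots> = (\<Sum>w\<in>N - Nr. (1 - a p w) * x w) + (\<Sum>w\<in>Nr. (1 - a p w) * x w)"
      by (rule sum.subset_diff) (auto simp: sub)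
    also have "(\<Sum>w\<in>N - Nr. (1 - a p w) * x w) \<le> (\<Sum>w\<in>N - Nr. x w)"
      by (intro sum_mono) (auto simp: x_nonneg a_le1 intro!: mult_left_le_one_le)
    also have "(\<Sum>w\<in>Nr. (1 - a p w) * x w) \<le> (\<Sum>w\<in>Nr. 4 * ((1 - a p w) * (x w)\<^sup>2))"
    proof (rule sum_mono)
      fix w assume w: "w \<in> Nr"
      then have "w \<in> N" "om - wt W w \<le> z * lam" by (auto simp: Nr_def)
      then have "lam / 4 \<le> lam * x w"
        using wt_N[of w] wt_nonneg[of N w] om[folded om_def] zl' lam0 by linarith
      then have "1 / 4 \<le> x w" using lam0 by simp
      then have "1 * ((1 - a p w) * x w) \<le> (4 * x w) * ((1 - a p w) * x w)"
        using x_nonneg a_le1 by (intro mult_right_mono) auto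
      then show "(1 - a p w) * x w \<le> 4 * ((1 - a p w) * (x w)\<^sup>2)" by (simp add: power2_eq_square mult_ac)
    qed
    also have "(\<Sum>w\<in>Nr. 4 * ((1 - a p w) * (x w)\<^sup>2)) \<le> 4 * (\<Sum>w\<in>Z. (1 - a p w) * (x w)\<^sup>2)"
      unfolding sum_distrib_left[symmetric] using sub UV fin_sub
      by (intro mult_left_mono sum_mono2) (auto simp: Z_def a_le1)
    finally show ?thesis using Nbad p lam0 by simp
  qed
  \<comment> \<open>Here the conversion to squares costs only the total of
    \<open>x w * (1 - x w)\<close> over \<open>W\<close>, bounded by \<open>X1'\<close>. The value
    \<open>lam / 7\<close> is less than half of \<open>lam / 3\<close>, so \<open>comW\<close> makes
    one end of every edge miss that much.\<close>
  have missW: "lam / 16 \<le> (\<Sum>w\<in>U. (1 - a p w) * (x w)\<^sup>2)" if p: "wt W p \<le> om - lam / 7" for p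
  proof -
    have "om - wt W p = (\<Sum>w\<in>W. (1 - a p w) * x w)"
      by (simp add: om_def wt_def algebra_simps sum_subtractf)
    also have "\<dots> = (\<Sum>w\<in>W - Mv. (1 - a p w) * x w) + (\<Sum>w\<in>Mv. (1 - a p w) * x w)"
      by (rule sum.subset_diff) (auto simp: MvW)
    also have "(\<Sum>w\<in>Mv. (1 - a p w) * x w) \<le> (\<Sum>w\<in>Mv. x w)"
      by (intro sum_mono) (auto simp: x_nonneg a_le1 intro!: mult_left_le_one_le)
    also have "(\<Sum>w\<in>W - Mv. (1 - a p w) * x w) \<le> (\<Sum>w\<in>W - Mv. (1 - a p w) * (x w)\<^sup>2 + x w * (1 - x w))"
    proof (rule sum_mono)
      fix w
      have "(1 - a p w) * (x w * (1 - x w)) \<le> x w * (1 - x w)"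
        using x_nonneg x_le1 a_le1 by (intro mult_left_le_one_le) auto
      then show "(1 - a p w) * x w \<le> (1 - a p w) * (x w)\<^sup>2 + x w * (1 - x w)"
        by (simp add: algebra_simps power2_eq_square)
    qed
    also have "\<dots> = (\<Sum>w\<in>W - Mv. (1 - a p w) * (x w)\<^sup>2) + (\<Sum>w\<in>W - Mv. x w * (1 - x w))"
      by (rule sum.distrib)
    also have "(\<Sum>w\<in>W - Mv. x w * (1 - x w)) \<le> (\<Sum>w\<in>W. x w * (1 - x w))"
      by (intro sum_mono2) (auto simp: x_nonneg x_le1)
    also have "(\<Sum>w\<in>W - Mv. (1 - a p w) * (x w)\<^sup>2) \<le> (\<Sum>w\<in>U. (1 - a p w) * (x w)\<^sup>2)"
      using UV fin_sub by (intro sum_mono2) (auto simp: U_def a_le1)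
    finally show ?thesis using Mv X1' p lam0 by linarith
  qed
  have eU: "(\<Sum>p\<in>U. \<Sum>q\<in>U. a p q * (x p * x q - 1 / 16))
      \<le> (\<Sum>p\<in>U. \<Sum>q\<in>Z. (1 - a p q) * (x p)\<^sup>2 * (x q)\<^sup>2) / 2"
  proof (rule side_excess_le[OF UV inU])
    fix p q assume "E p q"
    then have "wt N p \<le> 2 / 3 * lam \<or> wt N q \<le> 2 / 3 * lam" using comN[of p q] lam0 by linarith
    then show "lam / 16 \<le> (\<Sum>w\<in>Z. (1 - a p w) * (x w)\<^sup>2) \<or> lam / 16 \<le> (\<Sum>w\<in>Z. (1 - a q w) * (x w)\<^sup>2)"
      using missN by blast
  qed
  have eZ: "(\<Sum>p\<in>Z. \<Sum>q\<in>Z. a p q * (x p * x q - 1 / 16))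
      \<le> (\<Sum>p\<in>Z. \<Sum>q\<in>U. (1 - a p q) * (x p)\<^sup>2 * (x q)\<^sup>2) / 2"
  proof (rule side_excess_le[OF UV(2,1) inZ])
    fix p q assume "E p q"
    then have "wt W p \<le> om - lam / 7 \<or> wt W q \<le> om - lam / 7"
      using comW[of p q] om lam0 unfolding om_def[symmetric] by linarith
    then show "lam / 16 \<le> (\<Sum>w\<in>U. (1 - a p w) * (x w)\<^sup>2) \<or> lam / 16 \<le> (\<Sum>w\<in>U. (1 - a q w) * (x w)\<^sup>2)"
      using missW by blast
  qed
  have Xge: "lam / 4 \<le> (\<Sum>v\<in>V. (x v)\<^sup>2)"
  proof -
    have "om - (\<Sum>v\<in>W. x v * (1 - x v)) = (\<Sum>v\<in>W. (x v)\<^sup>2)"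
      by (simp add: om_def algebra_simps sum_subtractf power2_eq_square)
    also have "\<dots> \<le> (\<Sum>v\<in>V. (x v)\<^sup>2)" using W_V finV by (intro sum_mono2) auto
    finally show ?thesis using X1' om[folded om_def] lam0 by linarith
  qed
  have Xle: "(\<Sum>v\<in>V. (x v)\<^sup>2) \<le> 2 * lam"
  proof -
    have "lam * (\<Sum>v\<in>V. (x v)\<^sup>2) = (\<Sum>v\<in>V. x v * wt V v)"
      unfolding sum_distrib_left by (intro sum.cong refl) (simp add: wt_V power2_eq_square)
    also have "\<dots> \<le> (\<Sum>v\<in>V. 1 * dg V v)"
      using x_le1 x_nonneg wt_le_dg wt_nonneg by (intro sum_mono mult_mono) auto
    also have "\<dots> = 2 * m" using edges by (simp add: dg_def a_def)
    also have "\<dots> \<le> lam * (2 * lam)" using mlt by (simp add: power2_eq_square)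
    finally show ?thesis using lam0 by simp
  qed
  have "lam\<^sup>2 \<le> m" by (rule bipartition_bound[OF UZ refl Xge Xle eU eZ])
  then show False using mlt by simp
qed

end

section \<open>Few dominating vertices\<close>

text \<open>Merging two deficient degrees modulo \<open>k\<close> lowers the sum of \<open>d (k - d)\<close> by at least two.\<close>

lemma concave_residue_step:
  fixes k r d :: nat
  assumes "0 < k" "r < k" "d \<le> k"
  shows "(r + d) mod k * (k - (r + d) mod k) + of_bool (0 < d \<and> d < k) + of_bool (r \<noteq> 0)
    \<le> r * (k - r) + d * (k - d) + of_bool ((r + d) mod k \<noteq> 0)"
proof -
  consider "d = 0" | "d = k" | "r = 0" "0 < d" "d < k" | "0 < r" "0 < d" "r + d < k" | "0 < r" "0 < d" "r + d = k"
    | "0 < r" "d < k" "k < r + d" using assms by linarith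
  then show ?thesis
  proof cases
    case 4
    then obtain e where k: "k = r + d + e" and "0 < e" using less_imp_add_positive by metis
    then show ?thesis using 4 by (simp add: k algebra_simps Suc_le_eq)
  next
    case 5
    then have "0 < r * d" by simp
    then have "Suc (Suc 0) \<le> r * d + d * r" using mult.commute[of r d] by linarith
    then show ?thesis using 5(1,2) unfolding 5(3)[symmetric] by simp
  next
    case 6
    then obtain j where j: "r + d = k + j" "0 < j" using less_imp_add_positive by metis
    obtain b where b: "k = d + b" "0 < b" using 6 less_imp_add_positive by metis
    obtain c where c: "k = r + c" "0 < c" using assms less_imp_add_positive by metis
    have k: "k = j + b + c" "r = j + b" "d = j + c" using j b c by auto
    have "j < k" using k(1) b by linarith
    then have m: "(r + d) mod k = j" by (simp add: j(1))
    have "0 < b * c" using b c by simp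
    then show ?thesis unfolding m using k j(2) by (simp add: algebra_simps Suc_le_eq)
  qed (use assms in auto)
qed

text \<open>The steps telescope. The boolean term allows for the one deficient summand that a
  nonzero residue forces; every further one raises the sum by at least one.\<close>

lemma concave_residue_sum:
  fixes k :: nat
  assumes "finite R" "0 < k" "\<And>v. v \<in> R \<Longrightarrow> d v \<le> k"
  shows "(\<Sum>v\<in>R. d v) mod k * (k - (\<Sum>v\<in>R. d v) mod k) + card {v \<in> R. 0 < d v \<and> d v < k}
    \<le> (\<Sum>v\<in>R. d v * (k - d v)) + of_bool ((\<Sum>v\<in>R. d v) mod k \<noteq> 0)"
  using assms(1,3)
proof (induction R rule: finite_induct)
  case empty
  then show ?case by simp
next
  case (insert w R)
  define n where "n = (\<Sum>v\<in>R. d v)"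
  have s: "(\<Sum>v\<in>insert w R. d v) mod k = (n mod k + d w) mod k"
    using insert(1,2) by (simp add: n_def add.commute[of "d w"] mod_add_left_eq)
  have "{v \<in> insert w R. 0 < d v \<and> d v < k} =
    (if 0 < d w \<and> d w < k then insert w {v \<in> R. 0 < d v \<and> d v < k} else {v \<in> R. 0 < d v \<and> d v < k})"
    by auto
  then have c: "card {v \<in> insert w R. 0 < d v \<and> d v < k} = card {v \<in> R. 0 < d v \<and> d v < k} + of_bool (0 < d w \<and> d w < k)"
    using insert by simp
  have IH: "n mod k * (k - n mod k) + card {v \<in> R. 0 < d v \<and> d v < k}
    \<le> (\<Sum>v\<in>R. d v * (k - d v)) + of_bool (n mod k \<noteq> 0)"
    using insert unfolding n_def by blast
  have "n mod k < k" "d w \<le> k" using assms insert by auto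
  from concave_residue_step[OF assms(2) this] IH
  show ?case unfolding s c using insert(1,2) by (simp add: algebra_simps)
qed

text \<open>Raising \<open>r\<close> by one changes \<open>r * (k - r)\<close> by
  \<open>k - 2 * r - 1\<close>, and wrapping around lowers it. This prices an edge outside
  \<open>A\<close>, which takes one unit from the degree sum into \<open>A\<close>: the loss is at
  most \<open>(k - 1) / k\<close>, while the edge itself counts for a full unit.\<close>

lemma residue_add_le:
  fixes k :: nat
  assumes "0 < k"
  shows "(n + e) mod k * (k - (n + e) mod k) \<le> n mod k * (k - n mod k) + e * (k - 1)"
proof (induction e)
  case 0
  then show ?case by simp
next
  case (Suc e)
  define r where "r = (n + e) mod k"
  have r: "r < k" using assms by (simp add: r_def)
  have s: "Suc (n + e) mod k = (if Suc r = k then 0 else Suc r)"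
    by (simp add: r_def mod_Suc)
  have "Suc (n + e) mod k * (k - Suc (n + e) mod k) \<le> r * (k - r) + (k - 1)"
  proof (cases "Suc r = k")
    case False
    then obtain j where "k = Suc r + j" "0 < j" using r less_imp_add_positive[of "Suc r" k] by fastforce
    then show ?thesis unfolding s by simp
  qed (simp add: s)
  then show ?case using Suc by (simp add: r_def)
qed

section \<open>Finding the \<open>k\<close> dominating vertices and the structure around
  them\<close>

context kfree_eigen begin

lemma wt_N_u: "wt N u = lam"
  using sum_N by (auto simp: wt_def a_def N_def intro!: sum.cong)

text \<open>Half of \<open>Q\<close> is at most the weight of \<open>H\<close> in \<open>N\<close>,
  thus at most \<open>(k - 1) * lam + O(1)\<close>, while \<open>excess_ge\<close> requires
  \<open>(k - 1) * lam - O(1)\<close> plus all losses. So each loss is bounded by a constant, and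
  the vertices with entries above \<open>1 / 2\<close> see almost all of \<open>N\<close>.\<close>

lemma sparse_case:
  assumes g: "0 < g" "\<And>w. w \<in> N \<Longrightarrow> 1 / 2 < x w \<Longrightarrow> g * lam \<le> wt N w"
    and h: "card {w \<in> N. g * lam \<le> wt N w} \<le> h"
    and C2: "C2 = 2 ^ h * real t * real h + c"
    and B: "B = C2 / g + 1 + real k + 6 * C2"
    and big: "8 * C2 \<le> lam" "real t + (real k - 1) * (6 * C2) < g * lam" "real t + real k * B < lam" "c < lam"
  obtains A where "A \<subseteq> V" "card A = k"
    "\<And>v. v \<in> A \<Longrightarrow> lam * (1 - x v) \<le> 1 + real t + real k * B + 2 * C2"
    "\<And>v. v \<in> V - A \<Longrightarrow> lam * x v \<le> 1 + real t + real k * B + 2 * C2"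
proof -
  define H where "H = {w \<in> N. 1 / 2 < x w}"
  define W' where "W' = {w \<in> W. 1 / 2 < x w}"
  have HN: "H \<subseteq> N" and finH: "finite H" by (auto simp: H_def)
  have C20: "0 \<le> C2" using c0 by (simp add: C2)
  have B0: "0 \<le> B" "C2 / g \<le> B" "6 * C2 \<le> B" using C20 g by (auto simp: B)
  have lam0: "0 < lam" using lam1 by simp
  have cH: "card H \<le> h"
  proof -
    have "card H \<le> card {w \<in> N. g * lam \<le> wt N w}" using g by (intro card_mono) (auto simp: H_def)
    then show ?thesis using h by simp
  qed
  have up: "(\<Sum>h\<in>H. wt N h) \<le> (real k - 1) * lam + (C2 - c)"
  proof -
    have "2 ^ card H * real t * real (card H) \<le> 2 ^ h * real t * real h"
      using cH by (intro mult_mono power_increasing) auto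
    then show ?thesis using sum_wt_le[OF HN] by (simp add: C2)
  qed
  \<comment> \<open>A summand is positive only if one of its ends is in \<open>H\<close>. If both
    are, it is nonnegative, so counting it twice is harmless.\<close>
  have "Q \<le> (\<Sum>v\<in>N. \<Sum>w\<in>N. a v w * (of_bool (v \<in> H) * (x v + x w - 1)) + a v w * (of_bool (w \<in> H) * (x v + x w - 1)))"
    unfolding Q_def
  proof (intro sum_mono)
    fix v w assume "v \<in> N" "w \<in> N"
    then show "a v w * (x v + x w - 1) \<le> a v w * (of_bool (v \<in> H) * (x v + x w - 1)) + a v w * (of_bool (w \<in> H) * (x v + x w - 1))"
      by (cases "E v w") (auto simp: a_def H_def)
  qed
  also have "\<dots> = 2 * (\<Sum>v\<in>N. \<Sum>w\<in>N. a v w * (of_bool (v \<in> H) * (x v + x w - 1)))"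
  proof -
    have "(\<Sum>v\<in>N. \<Sum>w\<in>N. a v w * (of_bool (w \<in> H) * (x v + x w - 1)))
      = (\<Sum>v\<in>N. \<Sum>w\<in>N. a v w * (of_bool (v \<in> H) * (x v + x w - 1)))"
      by (subst swap_a) (simp add: add.commute)
    then show ?thesis by (simp add: sum.distrib)
  qed
  also have "(\<Sum>v\<in>N. \<Sum>w\<in>N. a v w * (of_bool (v \<in> H) * (x v + x w - 1)))
      = (\<Sum>v\<in>H. \<Sum>w\<in>N. a v w * (x v + x w - 1))"
    by (rule sum.mono_neutral_cong_right) (use HN in auto)
  also have "\<dots> = (\<Sum>v\<in>H. wt N v - dg N v * (1 - x v))"
    by (simp add: wt_def dg_def algebra_simps sum.distrib sum_subtractf sum_distrib_left sum_distrib_right)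
  also have "\<dots> = (\<Sum>v\<in>H. wt N v) - (\<Sum>v\<in>H. dg N v * (1 - x v))" by (rule sum_subtractf)
  finally have main: "(real k - 1) * lam - c + D + eW / 2 + (\<Sum>v\<in>H. dg N v * (1 - x v)) \<le> (\<Sum>v\<in>H. wt N v)"
    using excess_ge by (simp add: algebra_simps)
  have nnH: "0 \<le> (\<Sum>v\<in>H. dg N v * (1 - x v))"
    by (intro sum_nonneg mult_nonneg_nonneg dg_nonneg) (simp add: x_le1)
  have D: "D \<le> C2" and eW: "eW \<le> 2 * C2" and dH: "(\<Sum>v\<in>H. dg N v * (1 - x v)) \<le> C2"
    and low: "(real k - 1) * lam - c \<le> (\<Sum>v\<in>H. wt N v)"
    using main up nnH D_nonneg eW_nonneg by linarith+
  have H1: "lam * (1 - x v) \<le> C2 / g" if v: "v \<in> H" for v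
  proof -
    have "g * lam \<le> wt N v" using v g by (auto simp: H_def)
    then have "g * lam \<le> dg N v" using wt_le_dg order_trans by blast
    then have "g * lam * (1 - x v) \<le> dg N v * (1 - x v)" by (intro mult_right_mono) (simp_all add: x_le1)
    also have "\<dots> \<le> (\<Sum>v\<in>H. dg N v * (1 - x v))"
      using finH v by (intro member_le_sum) (auto simp: x_le1 dg_nonneg)
    finally show ?thesis using dH g by (simp add: field_simps)
  qed
  have wW: "wt W v \<le> 2 * C2" if v: "v \<in> W" for v
  proof -
    have "dg W v \<le> eW" unfolding eW_def using v by (intro member_le_sum) (auto simp: dg_nonneg)
    then show ?thesis using wt_le_dg[of W v] eW by linarith
  qed
  \<comment> \<open>An entry above \<open>1 / 2\<close> forces degree at least
    \<open>lam / 4\<close> into \<open>N\<close>, so \<open>D\<close> limits the defect of the entry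
    to \<open>4 * C2\<close>; neighbours inside \<open>W\<close> account for the other
    \<open>2 * C2\<close>.\<close>
  have W'1: "lam - wt N v \<le> 6 * C2" if v: "v \<in> W'" for v
  proof -
    have vW: "v \<in> W" "1 / 2 < x v" using v by (auto simp: W'_def)
    have "lam * (1 / 2) \<le> lam * x v" using vW lam0 by (intro mult_left_mono) auto
    then have "lam / 4 \<le> dg N v" using wt_W[OF vW(1)] wW[OF vW(1)] wt_le_dg[of N v] big by linarith
    then have "lam / 4 * (1 - x v) \<le> dg N v * (1 - x v)" by (intro mult_right_mono) (simp_all add: x_le1)
    also have "\<dots> \<le> D" unfolding D_def using vW by (intro member_le_sum) (auto simp: dg_nonneg x_le1)
    finally have "lam - lam * x v \<le> 4 * C2" using D by (simp add: algebra_simps)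
    then show ?thesis using wt_W[OF vW(1)] wW[OF vW(1)] by linarith
  qed
  have "H \<noteq> {}"
  proof
    assume "H = {}"
    then have "(real k - 1) * lam \<le> c" using low by simp
    moreover have "1 * lam \<le> (real k - 1) * lam" using k2 lam0 by (intro mult_right_mono) auto
    ultimately show False using big by simp
  qed
  then obtain b where b: "b \<in> H" by auto
  have bN: "b \<in> N" "E u b" "b \<noteq> u" using b HN u_N by (auto simp: N_def)
  have HV: "H \<subseteq> V" "W' \<subseteq> V" using HN N_V W_V by (auto simp: W'_def)
  have dis: "u \<notin> H" "u \<notin> W'" "H \<inter> W' = {}" using HN u_N u_W N_W by (auto simp: W'_def)
  have finW': "finite W'" by (simp add: W'_def)
  have clique_bound: "wt N b \<le> real t + (real k - 1) * r"
    if "T \<subseteq> V" "u \<notin> T" "b \<notin> T" "card T = k - 1" "\<And>s. s \<in> T \<Longrightarrow> lam - wt N s \<le> r" for T r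
    using common_weight_set[OF bN(2) N_V that(1-4), of r] that(5) by (simp add: sum_N wt_N_u)
  \<comment> \<open>Otherwise \<open>k - 1\<close> such vertices and the edge \<open>u b\<close>
    would leave \<open>b\<close> only bounded weight in \<open>N\<close>.\<close>
  have cW': "card W' < k - 1"
  proof (rule ccontr)
    assume "\<not> ?thesis"
    then obtain T where T: "T \<subseteq> W'" "card T = k - 1" by (meson not_less obtain_subset_with_card_n)
    have "wt N b \<le> real t + (real k - 1) * (6 * C2)"
      using T HV dis b W'1 by (intro clique_bound[of T]) auto
    moreover have "g * lam \<le> wt N b" using b g by (auto simp: H_def)
    ultimately show False using big by simp
  qed
  have aN: "a v w \<le> dg N w" if "v \<in> N" for v w
    unfolding dg_def a_sym[of v w] using that by (intro member_le_sum) auto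
  \<comment> \<open>Every neighbour in \<open>W\<close> with entry at most \<open>1 / 2\<close>
    contributes at least \<open>1 / 2\<close> to \<open>D\<close>.\<close>
  have low_deg: "(\<Sum>w\<in>W - W'. a v w) \<le> 2 * C2" if v: "v \<in> N" for v
  proof -
    have "(\<Sum>w\<in>W - W'. a v w) \<le> (\<Sum>w\<in>W - W'. 2 * (dg N w * (1 - x w)))"
    proof (rule sum_mono)
      fix w assume "w \<in> W - W'"
      then have "x w \<le> 1 / 2" by (auto simp: W'_def)
      then have "dg N w * 1 \<le> dg N w * (2 * (1 - x w))" by (intro mult_left_mono dg_nonneg) simp
      then show "a v w \<le> 2 * (dg N w * (1 - x w))" using aN[OF v, of w] by (simp add: algebra_simps)
    qed
    also have "\<dots> \<le> (\<Sum>w\<in>W. 2 * (dg N w * (1 - x w)))"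
      by (intro sum_mono2) (auto simp: dg_nonneg x_le1)
    also have "\<dots> = 2 * D" by (simp add: D_def sum_distrib_left)
    finally show ?thesis using D by simp
  qed
  have wNW: "wt (W - W') v \<le> 2 * C2" if v: "v \<in> N" for v
    using wt_le_dg[of "W - W'" v] low_deg[OF v] by (simp add: dg_def)
  have H2: "lam - wt N v \<le> B" if v: "v \<in> H" for v
  proof -
    have "wt W v = wt W' v + wt (W - W') v"
      using wt_Un[of W' "W - W'" v] W_V by (auto simp: W'_def Un_absorb1 Diff_partition)
    moreover have "wt W' v \<le> real k"
    proof -
      have "wt W' v \<le> (\<Sum>w\<in>W'. 1)" using wt_le_sum[of W' v] sum_mono[of W' x "\<lambda>_. 1"] x_le1 by fastforce
      then show ?thesis using cW' by simp
    qed
    ultimately show ?thesis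
      using wt_N[of v] v HN wNW[of v] H1[OF v] C20 by (auto simp: B algebra_simps)
  qed
  \<comment> \<open>All members miss at most \<open>B\<close> of the weight of \<open>N\<close>.
    More than \<open>k\<close> of them would contradict the common neighbour bound for the edge
    \<open>u b\<close>, and fewer than \<open>k - 1\<close> in \<open>H\<close> cannot carry the
    weight demanded by \<open>low\<close>. Hence \<open>W'\<close> is empty and \<open>A0\<close>
    has exactly \<open>k\<close> elements.\<close>
  define A0 where "A0 = insert u (H \<union> W')"
  have A0V: "A0 \<subseteq> V" using HV uV by (auto simp: A0_def)
  have finA0: "finite A0" using A0V fin_sub by auto
  have A0m: "lam - wt N v \<le> B" if v: "v \<in> A0" for v
  proof -
    consider "v = u" | "v \<in> H" | "v \<in> W'" using v by (auto simp: A0_def)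
    then show ?thesis using B0 wt_N_u H2[of v] W'1[of v] by cases auto
  qed
  have cA0: "card A0 = 1 + card H + card W'"
    using dis finH finW' by (simp add: A0_def card_Un_disjoint)
  have "card A0 \<le> k"
  proof (rule ccontr)
    assume "\<not> ?thesis"
    moreover have "card A0 - card {u, b} \<le> card (A0 - {u, b})" by (rule diff_card_le_card_Diff) simp
    ultimately have "k - 1 \<le> card (A0 - {u, b})" using bN by simp
    then obtain T where T: "T \<subseteq> A0 - {u, b}" "card T = k - 1" by (meson obtain_subset_with_card_n)
    have "wt N b \<le> real t + (real k - 1) * B"
      using T A0V A0m by (intro clique_bound[of T]) auto
    then show False using big H2[OF b] by (simp add: algebra_simps)
  qed
  moreover have "k - 1 \<le> card H"
  proof (rule ccontr)
    assume "\<not> ?thesis"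
    then have ck: "real (card H) \<le> real k - 2" using k2 by linarith
    have "(\<Sum>v\<in>H. wt N v) \<le> (\<Sum>v\<in>H. lam)" by (intro sum_mono wt_N_le)
    also have "\<dots> \<le> (real k - 2) * lam" using ck lam0 by simp
    finally show False using low big by (simp add: algebra_simps)
  qed
  ultimately have cHk: "card H = k - 1" and "card W' = 0" using cA0 by auto
  then have W'e: "W' = {}" using finW' by simp
  have cA: "card A0 = k" using cA0 cHk W'e k2 by simp
  have wtNv: "wt N v \<le> real t + real k * B" if v: "v \<in> V - A0" for v
  proof -
    have "wt N v = (\<Sum>w\<in>{w \<in> N. E v w}. x w)"
      unfolding wt_def sum.inter_filter[OF fin_N] by (intro sum.cong) (auto simp: a_def)
    also have "\<dots> \<le> real t + (\<Sum>s\<in>A0. (\<Sum>w\<in>N. x w) - wt N s)"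
      by (rule kplus_weight[of "insert v A0" u b]) (use v A0V finA0 cA N_V bN b in \<open>auto simp: A0_def\<close>)
    also have "\<dots> \<le> real t + (\<Sum>s\<in>A0. B)"
      by (intro add_left_mono sum_mono) (use A0m sum_N in auto)
    finally show ?thesis using cA by simp
  qed
  show ?thesis
  proof (rule that[OF A0V cA])
    fix v assume "v \<in> A0"
    then consider "v = u" | "v \<in> H" using W'e by (auto simp: A0_def)
    moreover have "B \<le> real k * B" using B0 k2 by (simp add: mult_le_cancel_right1)
    ultimately show "lam * (1 - x v) \<le> 1 + real t + real k * B + 2 * C2"
      using B0 C20 xu H1[of v] by cases auto
  next
    fix v assume v: "v \<in> V - A0"
    then consider "v \<in> W" | "v \<in> N" using V_eq by (auto simp: A0_def)
    then show "lam * x v \<le> 1 + real t + real k * B + 2 * C2"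
    proof cases
      case 1 then show ?thesis using wt_W wW wtNv[OF v] by fastforce
    next
      case 2 then show ?thesis using wt_N[OF 2] wNW[OF 2] wtNv[OF v] W'e by simp
    qed
  qed
qed

lemma split_structure:
  fixes M :: nat
  assumes A: "A \<subseteq> V" "card A = k"
    and hi: "\<And>v. v \<in> A \<Longrightarrow> lam * (1 - x v) \<le> C"
    and lo: "\<And>v. v \<in> V - A \<Longrightarrow> lam * x v \<le> C"
    and mM: "m = real M + real k * (real k - 1) / 2"
    and sharp: "real M - real (M mod k * (k - M mod k)) / real k \<le> lam\<^sup>2 - (real k - 1) * lam"
    and big: "2 * C \<le> lam" "32 * (2 * C * (real k)\<^sup>2 + C\<^sup>2) < lam" "4 * (real k)\<^sup>2 + 2 * real k < lam" "0 \<le> C"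
  shows "(\<forall>p\<in>A. \<forall>q\<in>A. p \<noteq> q \<longrightarrow> E p q) \<and> (\<forall>p\<in>V - A. \<forall>q\<in>V - A. \<not> E p q)
    \<and> card {v \<in> V - A. 0 < card {p \<in> A. E p v} \<and> card {p \<in> A. E p v} < k} \<le> 1"
proof -
  define R where "R = V - A"
  define dn where "dn = (\<lambda>v. card {p \<in> A. E p v})"
  define S where "S = (\<Sum>p\<in>A. (x p)\<^sup>2)"
  define E2 where "E2 = (\<Sum>v\<in>R. dg R v)"
  define mu where "mu = real k * (real k - 1) - (\<Sum>p\<in>A. dg A p)"
  define F where "F = (\<Sum>v\<in>R. dn v * (k - dn v))"
  define q where "q = card {v \<in> R. 0 < dn v \<and> dn v < k}"
  define K where "K = 2 * C * (real k)\<^sup>2 + C\<^sup>2"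
  have lam0: "0 < lam" using lam1 by simp
  have k0: "0 < real k" "2 \<le> real k" using k2 by auto
  have finA: "finite A" and finR: "finite R" and RV: "R \<subseteq> V" using A finV fin_sub by (auto simp: R_def)
  have V: "A \<union> R = V" "A \<inter> R = {}" using A by (auto simp: R_def)
  have wtV: "lam * x v = wt A v + wt R v" if "v \<in> V" for v
    using wt_V[OF that] wt_Un[of A R v] V A RV by simp
  have dnle: "dn v \<le> k" for v
    using card_mono[OF finA, of "{p \<in> A. E p v}"] A by (auto simp: dn_def)
  have dgA: "dg A v = real (dn v)" for v
    unfolding dg_def dn_def a_def using finA sym by (auto simp: sum_of_bool_eq intro!: arg_cong[where f = card])
  have eps: "1 - C / lam \<le> x v" "1 / 2 \<le> x v" if "v \<in> A" for v
  proof -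
    show "1 - C / lam \<le> x v" using hi[OF that] lam0 by (simp add: field_simps)
    moreover have "C / lam \<le> 1 / 2" using big lam0 by (simp add: field_simps)
    ultimately show "1 / 2 \<le> x v" by simp
  qed
  have Sle: "S \<le> real k"
  proof -
    have "S \<le> (\<Sum>p\<in>A. 1)" unfolding S_def
      using x_le1 x_nonneg by (intro sum_mono) (simp add: power_le_one)
    then show ?thesis using A by simp
  qed
  have Sge: "real k * (1 - 2 * (C / lam)) \<le> S"
  proof -
    have "(\<Sum>p\<in>A. 1 - 2 * (C / lam)) \<le> S" unfolding S_def
    proof (rule sum_mono)
      fix p assume "p \<in> A"
      have "0 \<le> (1 - x p)\<^sup>2" by simp
      then have "2 * x p - 1 \<le> (x p)\<^sup>2" by (simp add: power2_eq_square algebra_simps)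
      then show "1 - 2 * (C / lam) \<le> (x p)\<^sup>2" using eps(1)[OF \<open>p \<in> A\<close>] by linarith
    qed
    then show ?thesis using A by simp
  qed
  have Sge4: "real k / 4 \<le> S"
  proof -
    have "(\<Sum>p\<in>A. (1 / 2)\<^sup>2) \<le> S" unfolding S_def
      by (intro sum_mono power_mono eps) auto
    then show ?thesis using A by (simp add: power2_eq_square)
  qed
  have S0: "0 < S" using Sge4 k0 by simp
  have E20: "0 \<le> E2" unfolding E2_def by (intro sum_nonneg dg_nonneg)
  \<comment> \<open>Entries outside \<open>A\<close> are eliminated by their own eigenvalue
    equations. What remains are the edges inside \<open>R\<close>, where both entries are at most
    \<open>C / lam\<close>.\<close>
  have step1: "lam\<^sup>2 * S \<le> lam * (\<Sum>p\<in>A. x p * wt A p) + (\<Sum>v\<in>R. (wt A v)\<^sup>2) + C\<^sup>2 * E2 / lam"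
  proof -
    have "lam\<^sup>2 * S = lam * (\<Sum>p\<in>A. x p * (lam * x p))"
      by (simp add: S_def sum_distrib_left power2_eq_square mult_ac)
    also have "\<dots> = lam * (\<Sum>p\<in>A. x p * wt A p) + lam * (\<Sum>p\<in>A. x p * wt R p)"
    proof -
      have "(\<Sum>p\<in>A. x p * (lam * x p)) = (\<Sum>p\<in>A. x p * wt A p + x p * wt R p)"
        by (intro sum.cong refl) (use A in \<open>auto simp: wtV distrib_left\<close>)
      then show ?thesis by (simp add: sum.distrib distrib_left)
    qed
    also have "(\<Sum>p\<in>A. x p * wt R p) = (\<Sum>v\<in>R. x v * wt A v)"
    proof -
      have "(\<Sum>p\<in>A. x p * wt R p) = (\<Sum>p\<in>A. \<Sum>v\<in>R. a p v * (x p * x v))"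
        by (simp add: wt_def sum_distrib_left mult_ac)
      also have "\<dots> = (\<Sum>v\<in>R. x v * wt A v)"
        by (subst swap_a) (simp add: wt_def sum_distrib_left mult_ac)
      finally show ?thesis .
    qed
    also have "lam * (\<Sum>v\<in>R. x v * wt A v) \<le> (\<Sum>v\<in>R. (wt A v)\<^sup>2 + lam * (x v * wt R v))"
      unfolding sum_distrib_left
    proof (rule sum_mono)
      fix v assume v: "v \<in> R"
      then have e: "lam * x v = wt A v + wt R v" using RV wtV by auto
      have "lam * (x v * wt A v) = (lam * x v) * wt A v" by simp
      also have "\<dots> = (wt A v)\<^sup>2 + wt R v * wt A v" unfolding e by (simp add: power2_eq_square algebra_simps)
      also have "wt R v * wt A v \<le> wt R v * (lam * x v)"
        unfolding e using wt_nonneg by (intro mult_left_mono) auto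
      finally show "lam * (x v * wt A v) \<le> (wt A v)\<^sup>2 + lam * (x v * wt R v)" by (simp add: mult_ac)
    qed
    also have "\<dots> = (\<Sum>v\<in>R. (wt A v)\<^sup>2) + lam * (\<Sum>v\<in>R. x v * wt R v)"
      by (simp add: sum.distrib sum_distrib_left)
    also have "lam * (\<Sum>v\<in>R. x v * wt R v) \<le> lam * ((C / lam) * ((C / lam) * E2))"
    proof (intro mult_left_mono)
      have xl: "x v \<le> C / lam" if "v \<in> R" for v using lo[of v] that lam0 by (simp add: R_def field_simps)
      have "wt R v \<le> C / lam * dg R v" for v
        unfolding wt_def dg_def sum_distrib_left
        by (subst mult.commute[of "C / lam"]) (intro sum_mono mult_left_mono xl, auto)
      then have "(\<Sum>v\<in>R. x v * wt R v) \<le> (\<Sum>v\<in>R. (C / lam) * (C / lam * dg R v))"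
        using xl x_nonneg wt_nonneg big lam0 by (intro sum_mono mult_mono) auto
      then show "(\<Sum>v\<in>R. x v * wt R v) \<le> (C / lam) * ((C / lam) * E2)"
        by (simp add: E2_def sum_distrib_left)
    qed (use lam0 in simp)
    also have "lam * ((C / lam) * ((C / lam) * E2)) = C\<^sup>2 * E2 / lam"
      using lam0 by (simp add: power2_eq_square)
    finally show ?thesis by simp
  qed
  have nsum: "(\<Sum>q\<in>A. (of_bool (p \<noteq> q) :: real)) = real k - 1" if "p \<in> A" for p
  proof -
    have "(\<Sum>q\<in>A. (of_bool (p \<noteq> q) :: real)) = real (card (A \<inter> {q. p \<noteq> q}))" by (simp add: sum_of_bool_eq finA)
    also have "A \<inter> {q. p \<noteq> q} = A - {p}" by auto
    finally show ?thesis using that finA A k2 by (simp add: of_nat_diff)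
  qed
  \<comment> \<open>AM-GM on the pairs of \<open>A\<close>; a missing ordered pair forfeits
    \<open>x p * x q\<close>, which is at least \<open>1 / 4\<close>.\<close>
  have step2: "(\<Sum>p\<in>A. x p * wt A p) \<le> (real k - 1) * S - mu / 4"
  proof -
    let ?n = "\<lambda>p q. of_bool (p \<noteq> q) :: real"
    have "(\<Sum>p\<in>A. x p * wt A p) = (\<Sum>p\<in>A. \<Sum>q\<in>A. a p q * (x p * x q))"
      by (simp add: wt_def sum_distrib_left mult_ac)
    also have "\<dots> \<le> (\<Sum>p\<in>A. \<Sum>q\<in>A. ?n p q * (x p)\<^sup>2 / 2 + ?n p q * (x q)\<^sup>2 / 2 - (?n p q - a p q) / 4)"
    proof (intro sum_mono)
      fix p q assume pq: "p \<in> A" "q \<in> A"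
      have "0 \<le> (x p - x q)\<^sup>2" by simp
      then have am: "x p * x q \<le> (x p)\<^sup>2 / 2 + (x q)\<^sup>2 / 2" by (simp add: power2_eq_square algebra_simps)
      have "1 / 2 * (1 / 2) \<le> x p * x q" using pq eps x_nonneg by (intro mult_mono) auto
      then show "a p q * (x p * x q) \<le> ?n p q * (x p)\<^sup>2 / 2 + ?n p q * (x q)\<^sup>2 / 2 - (?n p q - a p q) / 4"
        using am irr by (cases "p = q"; cases "E p q") (auto simp: a_def)
    qed
    also have "\<dots> = (\<Sum>p\<in>A. \<Sum>q\<in>A. ?n p q * (x p)\<^sup>2) / 2 + (\<Sum>p\<in>A. \<Sum>q\<in>A. ?n p q * (x q)\<^sup>2) / 2
        - ((\<Sum>p\<in>A. \<Sum>q\<in>A. ?n p q) - (\<Sum>p\<in>A. dg A p)) / 4"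
      by (simp add: sum.distrib sum_subtractf dg_def flip: sum_divide_distrib)
    also have "(\<Sum>p\<in>A. \<Sum>q\<in>A. ?n p q * (x q)\<^sup>2) = (\<Sum>p\<in>A. \<Sum>q\<in>A. ?n p q * (x p)\<^sup>2)"
      by (subst sum.swap) (intro sum.cong refl, auto)
    also have "(\<Sum>p\<in>A. \<Sum>q\<in>A. ?n p q * (x p)\<^sup>2) = (\<Sum>p\<in>A. (\<Sum>q\<in>A. ?n p q) * (x p)\<^sup>2)"
      by (simp add: sum_distrib_right)
    also have "\<dots> = (real k - 1) * S"
      by (simp add: S_def sum_distrib_left nsum)
    also have "(\<Sum>p\<in>A. \<Sum>q\<in>A. ?n p q) = real k * (real k - 1)" using nsum A by simp
    finally show ?thesis by (simp add: mu_def mult.commute[of S])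
  qed
  \<comment> \<open>For \<open>dn v = k\<close> Cauchy-Schwarz gives exactly \<open>S * k\<close>,
    without error. Only deficient vertices, whose number is \<open>q\<close>, pay for replacing
    \<open>k\<close> by \<open>S\<close>.\<close>
  have step3: "(wt A v)\<^sup>2 \<le> S * ((real (dn v))\<^sup>2 / real k) + (if 0 < dn v \<and> dn v < k then 2 * (C / lam) * (real k)\<^sup>2 else 0)" for v
  proof (cases "dn v = k")
    case True
    have "(wt A v)\<^sup>2 \<le> (\<Sum>p\<in>A. (a v p)\<^sup>2) * (\<Sum>p\<in>A. (x p)\<^sup>2)"
      unfolding wt_def by (rule Cauchy_Schwarz_ineq_sum)
    also have "(\<Sum>p\<in>A. (a v p)\<^sup>2) = dg A v" unfolding dg_def by (intro sum.cong) (auto simp: a_def)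
    finally show ?thesis using True k0 by (simp add: dgA S_def power2_eq_square mult.commute)
  next
    case False
    have w: "wt A v \<le> real (dn v)" using wt_le_dg[of A v] dgA by simp
    then have w2: "(wt A v)\<^sup>2 \<le> (real (dn v))\<^sup>2" using wt_nonneg by (intro power_mono) auto
    show ?thesis
    proof (cases "dn v = 0")
      case True then show ?thesis using w2 by simp
    next
      case nz: False
      have "1 \<le> S / real k + 2 * (C / lam)" using Sge k0 by (simp add: field_simps)
      then have "(real (dn v))\<^sup>2 * 1 \<le> (real (dn v))\<^sup>2 * (S / real k + 2 * (C / lam))"
        by (intro mult_left_mono) auto
      also have "\<dots> = S * ((real (dn v))\<^sup>2 / real k) + 2 * (C / lam) * (real (dn v))\<^sup>2"
        by (simp add: algebra_simps)
      also have "2 * (C / lam) * (real (dn v))\<^sup>2 \<le> 2 * (C / lam) * (real k)\<^sup>2"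
        using big lam0 dnle by (intro mult_left_mono power_mono) auto
      finally show ?thesis using w2 nz False dnle[of v] by simp
    qed
  qed
  have dsq: "(real (dn v))\<^sup>2 / real k = real (dn v) - real (dn v * (k - dn v)) / real k" for v
    using dnle[of v] k0 by (simp add: of_nat_diff power2_eq_square field_simps)
  have step4: "(\<Sum>v\<in>R. (wt A v)\<^sup>2) \<le> S * ((\<Sum>v\<in>R. real (dn v)) - real F / real k) + 2 * (C / lam) * (real k)\<^sup>2 * real q"
  proof -
    have "(\<Sum>v\<in>R. (wt A v)\<^sup>2) \<le> (\<Sum>v\<in>R. S * ((real (dn v))\<^sup>2 / real k) + (if 0 < dn v \<and> dn v < k then 2 * (C / lam) * (real k)\<^sup>2 else 0))"
      by (intro sum_mono step3)
    also have "\<dots> = S * (\<Sum>v\<in>R. (real (dn v))\<^sup>2 / real k) + (\<Sum>v\<in>R. if 0 < dn v \<and> dn v < k then 2 * (C / lam) * (real k)\<^sup>2 else 0)"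
      by (simp only: sum.distrib sum_distrib_left)
    also have "(\<Sum>v\<in>R. if 0 < dn v \<and> dn v < k then 2 * (C / lam) * (real k)\<^sup>2 else 0) = 2 * (C / lam) * (real k)\<^sup>2 * real q"
      unfolding q_def using sum.inter_filter[OF finR, of "\<lambda>_. 2 * (C / lam) * (real k)\<^sup>2" "\<lambda>v. 0 < dn v \<and> dn v < k"]
      by (simp add: mult.commute)
    also have "(\<Sum>v\<in>R. (real (dn v))\<^sup>2 / real k) = (\<Sum>v\<in>R. real (dn v)) - real F / real k"
      unfolding dsq by (simp add: F_def sum_subtractf sum_divide_distrib)
    finally show ?thesis .
  qed
  \<comment> \<open>The edges between \<open>A\<close> and \<open>R\<close> are as many as in a
    split graph, plus the edges missing in \<open>A\<close>, minus those inside \<open>R\<close>;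
    \<open>mu\<close> and \<open>E2\<close> count the latter two twice.\<close>
  have tot: "(\<Sum>v\<in>R. real (dn v)) = real M + mu / 2 - E2 / 2"
  proof -
    have sV: "(\<Sum>v\<in>V. f v) = (\<Sum>v\<in>A. f v) + (\<Sum>v\<in>R. f v)" for f :: "'a \<Rightarrow> real"
      using sum.union_disjoint[OF finA finR V(2), of f] V(1) by simp
    have "2 * m = (\<Sum>v\<in>V. dg V v)" using edges by (simp add: dg_def a_def)
    also have "\<dots> = (\<Sum>v\<in>V. dg A v + dg R v)" using dg_Un[of A R] V A RV by simp
    also have "\<dots> = (\<Sum>v\<in>A. dg A v) + (\<Sum>v\<in>A. dg R v) + (\<Sum>v\<in>R. dg A v) + E2"
      by (simp add: sV sum.distrib E2_def)
    also have "(\<Sum>v\<in>A. dg R v) = (\<Sum>v\<in>R. dg A v)"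
      unfolding dg_def using swap_a[of "\<lambda>_ _. 1" R A] by simp
    finally show ?thesis using mM by (simp add: dgA mu_def field_simps)
  qed
  define gM where "gM = M mod k * (k - M mod k)"
  define fM where "fM = real gM / real k"
  have "gM \<le> k * k"
    unfolding gM_def using k2 by (intro mult_le_mono) (auto intro: less_imp_le)
  then have "real gM \<le> real (k * k)" by (simp only: of_nat_le_iff)
  then have fM: "fM \<le> real k" using k0 by (simp add: fM_def field_simps)
  \<comment> \<open>\<open>sharp\<close> multiplied by \<open>S\<close>, compared with the upper
    bounds above; the terms \<open>lam\<^sup>2 * S\<close> and \<open>S * real M\<close>
    cancel.\<close>
  have master: "lam * mu / 4 + S * (E2 / 2 + real F / real k) \<le> S * (fM + mu / 2) + K * (real q + E2) / lam"
  proof -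
    have "S * (real M - fM) \<le> S * (lam\<^sup>2 - (real k - 1) * lam)"
      using sharp S0 by (intro mult_left_mono) (auto simp: fM_def gM_def)
    also have "\<dots> = lam\<^sup>2 * S - lam * ((real k - 1) * S)" by (simp add: algebra_simps)
    also have "\<dots> \<le> lam * (\<Sum>p\<in>A. x p * wt A p) - lam * ((real k - 1) * S) + (\<Sum>v\<in>R. (wt A v)\<^sup>2) + C\<^sup>2 * E2 / lam"
      using step1 by simp
    also have "lam * (\<Sum>p\<in>A. x p * wt A p) \<le> lam * ((real k - 1) * S - mu / 4)"
      using step2 lam0 by (intro mult_left_mono) auto
    also have "(\<Sum>v\<in>R. (wt A v)\<^sup>2) \<le> S * (real M + mu / 2 - E2 / 2 - real F / real k) + 2 * (C / lam) * (real k)\<^sup>2 * real q"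
      using step4 unfolding tot .
    finally have 1: "S * (real M - fM) \<le> lam * ((real k - 1) * S - mu / 4) - lam * ((real k - 1) * S)
      + (S * (real M + mu / 2 - E2 / 2 - real F / real k) + 2 * (C / lam) * (real k)\<^sup>2 * real q) + C\<^sup>2 * E2 / lam" by simp
    have 2: "2 * (C / lam) * (real k)\<^sup>2 * real q + C\<^sup>2 * E2 / lam \<le> K * (real q + E2) / lam"
    proof -
      have "2 * C * (real k)\<^sup>2 * real q + C\<^sup>2 * E2 \<le> K * real q + K * E2"
        unfolding K_def using E20 big by (intro add_mono mult_right_mono) auto
      then have "(2 * C * (real k)\<^sup>2 * real q + C\<^sup>2 * E2) / lam \<le> (K * (real q + E2)) / lam"
        using lam0 by (intro divide_right_mono) (auto simp: distrib_left)
      then show ?thesis by (simp add: add_divide_distrib)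
    qed
    show ?thesis using 1 2 by (simp add: algebra_simps)
  qed
  have qF: "real q \<le> real F"
  proof -
    have "q = (\<Sum>v\<in>{v \<in> R. 0 < dn v \<and> dn v < k}. 1)" by (simp add: q_def)
    also have "\<dots> = (\<Sum>v\<in>R. if 0 < dn v \<and> dn v < k then 1 else 0)" by (rule sum.inter_filter[OF finR])
    also have "\<dots> \<le> F" unfolding F_def by (intro sum_mono) auto
    finally show ?thesis by simp
  qed
  have mu_nat: "\<exists>j::nat. mu = real j"
  proof -
    have "(\<Sum>p\<in>A. dn p) \<le> (\<Sum>p\<in>A. k - 1)"
    proof (rule sum_mono)
      fix p assume p: "p \<in> A"
      have "{v \<in> A. E v p} \<subseteq> A - {p}" using irr by auto
      then have "dn p \<le> card (A - {p})" unfolding dn_def using finA by (intro card_mono) auto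
      then show "dn p \<le> k - 1" using p finA A by simp
    qed
    then have le: "(\<Sum>p\<in>A. dn p) \<le> k * (k - 1)" using A by simp
    have "mu = real (k * (k - 1)) - real (\<Sum>p\<in>A. dn p)"
      using k2 by (simp add: mu_def dgA of_nat_diff)
    also have "\<dots> = real (k * (k - 1) - (\<Sum>p\<in>A. dn p))" using le by (simp add: of_nat_diff)
    finally show ?thesis by blast
  qed
  have err: "K * (real q + E2) / lam \<le> (real q + E2) / 32"
  proof -
    have "K / lam \<le> 1 / 32" using big(2) lam0 by (simp add: K_def field_simps)
    then have "K / lam * (real q + E2) \<le> 1 / 32 * (real q + E2)" using E20 by (intro mult_right_mono) auto
    then show ?thesis by simp
  qed
  \<comment> \<open>An edge missing in \<open>A\<close> costs order \<open>lam\<close>, but it can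
    gain only a bounded amount.\<close>
  have mu0: "mu = 0"
  proof (rule ccontr)
    assume "mu \<noteq> 0"
    then have mu1: "1 \<le> mu" using mu_nat by auto
    have "real k / 4 * (E2 / 2 + real q / real k) \<le> S * (E2 / 2 + real F / real k)"
      using Sge4 qF E20 k0 S0 by (intro mult_mono add_mono divide_right_mono) auto
    moreover have "real k / 4 * (E2 / 2 + real q / real k) = real k * E2 / 8 + real q / 4"
      using k0 by (simp add: field_simps)
    moreover have "2 * E2 \<le> real k * E2" using k0 E20 by (intro mult_right_mono) auto
    moreover have "0 \<le> real q" by simp
    ultimately have "(real q + E2) / 32 \<le> S * (E2 / 2 + real F / real k)" using E20 by argo
    then have "lam * mu / 4 \<le> S * (fM + mu / 2)" using master err by argo
    also have "\<dots> \<le> real k * (real k + mu / 2)"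
      using Sle fM mu1 S0 by (intro mult_mono) (auto simp: fM_def)
    also have "\<dots> \<le> ((real k)\<^sup>2 + real k / 2) * mu"
    proof -
      have "(real k)\<^sup>2 * 1 \<le> (real k)\<^sup>2 * mu" using mu1 by (intro mult_left_mono) auto
      then show ?thesis by (simp add: algebra_simps power2_eq_square)
    qed
    finally have "lam / 4 * mu \<le> ((real k)\<^sup>2 + real k / 2) * mu" by simp
    then have "lam / 4 \<le> (real k)\<^sup>2 + real k / 2" using mu1 by simp
    then show False using big(3) by simp
  qed
  define n where "n = (\<Sum>v\<in>R. dn v)"
  have nM: "real n = real M - E2 / 2" using tot mu0 by (simp add: n_def)
  then have "n \<le> M" using E20 by simp
  \<comment> \<open>The number of edges outside \<open>A\<close>.\<close>
  define e where "e = M - n"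
  have E2e: "E2 = 2 * real e" and Me: "M = n + e" using nM \<open>n \<le> M\<close> by (auto simp: e_def of_nat_diff)
  have c1: "n mod k * (k - n mod k) + q \<le> F + of_bool (n mod k \<noteq> 0)"
    unfolding n_def q_def F_def using finR k2 dnle by (intro concave_residue_sum) auto
  have c2: "gM \<le> n mod k * (k - n mod k) + e * (k - 1)"
    unfolding gM_def Me using k2 by (intro residue_add_le) auto
  define i where "i = (of_bool (n mod k \<noteq> 0) :: nat)"
  have "gM + q + e \<le> F + i + e * k"
  proof -
    have "e * (k - 1) + e = e * k" using k2 by (cases k) auto
    then show ?thesis using c1 c2 unfolding i_def[symmetric] by linarith
  qed
  then have "real (gM + q + e) \<le> real (F + i + e * k)" by (simp only: of_nat_le_iff)
  then have "real gM + real q + real e \<le> real F + real i + real e * real k" by simp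
  then have "fM + (real q + real e - real i) / real k \<le> real F / real k + real e"
  proof -
    assume "real gM + real q + real e \<le> real F + real i + real e * real k"
    then have "(real gM + (real q + real e - real i)) / real k \<le> (real F + real e * real k) / real k"
      by (intro divide_right_mono) auto
    then show ?thesis using k0 by (simp add: fM_def add_divide_distrib)
  qed
  then have "(real q + real e - real i) / real k \<le> E2 / 2 + real F / real k - fM" by (simp add: E2e)
  then have "S * ((real q + real e - real i) / real k) \<le> S * (E2 / 2 + real F / real k - fM)"
    using S0 by (intro mult_left_mono) auto
  also have "\<dots> \<le> (real q + E2) / 32"
  proof -
    have "S * (E2 / 2 + real F / real k) \<le> S * fM + K * (real q + E2) / lam"
      using master mu0 by simp
    then show ?thesis using err right_diff_distrib[of S "E2 / 2 + real F / real k" fM] by linarith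
  qed
  also have "\<dots> \<le> (real q + real e) / 16" by (simp add: E2e)
  finally have fin: "S * ((real q + real e - real i) / real k) \<le> (real q + real e) / 16" .
  have i1: "i \<le> 1" by (simp add: i_def)
  \<comment> \<open>The factor \<open>32\<close> in \<open>big\<close> is made for this: with
    \<open>k / 4 \<le> S\<close> the error is at most a quarter of \<open>q + e\<close>, so
    \<open>i \<le> 1\<close> gives \<open>q + e < 2\<close>.\<close>
  have fin': "real q + real e - real i \<le> (real q + real e) / 4" if "i \<le> q + e"
  proof -
    have "real k / 4 * ((real q + real e - real i) / real k) \<le> S * ((real q + real e - real i) / real k)"
      using that Sge4 k0 by (intro mult_right_mono divide_nonneg_nonneg) (auto simp flip: of_nat_add)
    moreover have "real k / 4 * ((real q + real e - real i) / real k) = (real q + real e - real i) / 4"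
      using k0 by simp
    ultimately show ?thesis using fin by argo
  qed
  have "e = 0 \<and> q \<le> 1"
  \<comment> \<open>The remaining case \<open>q = 0\<close>, \<open>e = 1\<close> is excluded
    because without deficient vertices \<open>n\<close> is a multiple of \<open>k\<close>, and then
    \<open>i = 0\<close>.\<close>
  proof (cases "q = 0")
    case True
    have "n mod k = 0"
    proof -
      have "dn v = 0 \<or> dn v = k" if "v \<in> R" for v
        using True that finR dnle[of v] by (auto simp: q_def)
      then have "k dvd dn v" if "v \<in> R" for v using that by (metis dvd_0_right dvd_refl)
      then have "k dvd n" unfolding n_def by (rule dvd_sum)
      then show ?thesis by simp
    qed
    then have "i = 0" by (simp add: i_def)
    then show ?thesis using fin' True by simp
  next
    case False
    then have "i \<le> q + e" using i1 by simp
    from fin'[OF this] i1 have "real q + real e < 2" by simp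
    then have "q + e < 2" by (metis of_nat_add of_nat_less_iff of_nat_numeral)
    then show ?thesis using False by auto
  qed
  then have "E2 = 0" and q1: "q \<le> 1" using E2e by auto
  then have "\<forall>v\<in>R. dg R v = 0"
    using finR by (simp add: E2_def sum_nonneg_eq_0_iff dg_nonneg)
  then have indep: "\<not> E p w" if "p \<in> R" "w \<in> R" for p w
    using that finR by (fastforce simp: dg_def sum_nonneg_eq_0_iff a_def)
  have "(\<Sum>p\<in>A. \<Sum>q\<in>A. of_bool (p \<noteq> q) - a p q) = mu"
    using nsum A by (simp add: mu_def sum_subtractf dg_def)
  moreover have nn: "0 \<le> of_bool (p \<noteq> q) - a p q" for p q
    using irr by (auto simp: a_def)
  ultimately have "\<forall>p\<in>A. \<forall>q\<in>A. of_bool (p \<noteq> q) - a p q = 0"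
    using finA mu0 by (simp add: sum_nonneg_eq_0_iff sum_nonneg)
  then have "E p w" if "p \<in> A" "w \<in> A" "p \<noteq> w" for p w
    using that by (fastforce simp: a_def)
  then show ?thesis using indep q1 by (auto simp: R_def q_def dn_def)
qed

lemma split_structure_exists:
  fixes M h :: nat
  assumes z: "z = 1 / (4096 * real k)" and d: "d = z / 20480"
    and h: "real k \<le> d ^ 3 * real h"
    and C2: "C2 = 2 ^ h * real t * real h + c"
    and B: "B = C2 / d ^ 3 + 1 + real k + 6 * C2"
    and C: "C = 1 + real t + real k * B + 2 * C2"
    and mM: "m = real M + real k * (real k - 1) / 2"
    and sharp: "real M - real (M mod k * (k - M mod k)) / real k \<le> lam\<^sup>2 - (real k - 1) * lam"
    and big: "2 ^ h * real t * real h < lam" "real h / d < lam" "real t / z < lam" "12 * (real k + 1) < lam"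
      "8 * C2 < lam" "(real t + (real k - 1) * (6 * C2)) / d ^ 3 < lam" "real t + real k * B < lam" "c < lam"
      "2 * C < lam" "32 * (2 * C * (real k)\<^sup>2 + C\<^sup>2) < lam" "4 * (real k)\<^sup>2 + 2 * real k < lam"
  shows "\<exists>A\<subseteq>V. card A = k \<and> (\<forall>p\<in>A. \<forall>q\<in>A. p \<noteq> q \<longrightarrow> E p q) \<and> (\<forall>p\<in>V - A. \<forall>q\<in>V - A. \<not> E p q)
    \<and> card {v \<in> V - A. 0 < card {p \<in> A. E p v} \<and> card {p \<in> A. E p v} < k} \<le> 1"
proof -
  have z0: "0 < z" "z \<le> 1" unfolding z using k2 by auto
  have d0: "0 < d" "d \<le> 1 / 20480" using z0 d by auto
  have g0: "0 < d ^ 3" using d0 by simp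
  have "d ^ 3 \<le> d ^ 1" using d0 by (intro power_decreasing) auto
  then have g12: "d ^ 3 \<le> 1 / 12" using d0 by simp
  have lam0: "0 < lam" using lam1 by simp
  have "0 \<le> real k" by simp
  then have lam12: "12 < lam" using big(4) by argo
  have heavy: "card {w \<in> N. d ^ 3 * lam \<le> wt N w} < h"
    by (rule card_heavy_less[OF h big(1)])
  have C20: "0 \<le> C2" using c0 by (simp add: C2)
  have C0: "0 \<le> C" using C20 d0 by (simp add: C B)
  have "1 * lam \<le> (real k - 1) * lam" using k2 lam0 by (intro mult_right_mono) auto
  then have klam: "c < (real k - 1) * lam" using big(8) by linarith
  \<comment> \<open>A vertex of \<open>N\<close> with entry above \<open>1 / 2\<close> and little
    weight in \<open>N\<close> must draw its value from \<open>W\<close>, so \<open>W\<close> is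
    heavy.\<close>
  have False if w0: "w0 \<in> N" "1 / 2 < x w0" "wt N w0 < d ^ 3 * lam" for w0
  proof (rule dense_case[OF z d])
    show mlt: "m < lam\<^sup>2" using large klam by simp
    have "Q \<le> real h * lam + 3 * d * lam\<^sup>2"
      by (rule excess_le) (use heavy d0 mlt in auto)
    also have "real h * lam \<le> d * lam * lam"
      using big(2) d0 lam0 by (intro mult_right_mono) (simp_all add: field_simps)
    finally have "2 * D + eW \<le> 4 * (d * lam\<^sup>2)"
      using excess_ge klam by (simp add: power2_eq_square algebra_simps)
    then have "D \<le> 2 * (d * lam\<^sup>2)" "eW \<le> 4 * (d * lam\<^sup>2)"
      using D_nonneg eW_nonneg by linarith+
    then show "D \<le> 2 * d * lam\<^sup>2" "eW \<le> 4 * d * lam\<^sup>2" by auto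
    have "lam * (1 / 2) \<le> lam * x w0" using w0 lam0 by (intro mult_left_mono) auto
    moreover have "d ^ 3 * lam \<le> 1 / 12 * lam" using g12 lam0 by (intro mult_right_mono) auto
    \<comment> \<open>The share \<open>lam / 2\<close> loses \<open>lam / 12\<close> to
      \<open>N\<close> and the contribution \<open>1 < lam / 12\<close> of \<open>u\<close>.\<close>
    ultimately have "lam / 3 \<le> wt W w0" using wt_N[OF w0(1)] w0(3) lam12 by linarith
    then show "lam / 3 \<le> (\<Sum>v\<in>W. x v)" using wt_le_sum[of W w0] by simp
    show "real t \<le> z * lam" using big(3) z0 by (simp add: field_simps)
    show "12 * (real k + 1) \<le> lam" using big(4) by simp
  qed
  then have gN: "\<And>w. w \<in> N \<Longrightarrow> 1 / 2 < x w \<Longrightarrow> d ^ 3 * lam \<le> wt N w"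
    using not_less by blast
  obtain A where A: "A \<subseteq> V" "card A = k" "\<And>v. v \<in> A \<Longrightarrow> lam * (1 - x v) \<le> C"
    "\<And>v. v \<in> V - A \<Longrightarrow> lam * x v \<le> C"
  proof (rule sparse_case[OF g0 gN less_imp_le[OF heavy] C2 B])
    show "real t + (real k - 1) * (6 * C2) < d ^ 3 * lam"
      using big(6) g0 by (simp add: field_simps)
    show "8 * C2 \<le> lam" "real t + real k * B < lam" "c < lam" using big(5,7,8) by simp_all
  qed (simp_all only: C)
  have C2lam: "2 * C \<le> lam" using big(9) by simp
  show ?thesis
    using split_structure[OF A mM sharp C2lam big(10,11) C0] A(1,2) by blast
qed

end

section \<open>Edge sets and the split graph\<close>

lemma graph_verts:
  assumes "simple_graph G"
  shows "finite (verts G)" "{v, w} \<in> G \<Longrightarrow> v \<in> verts G" "{v, v} \<notin> G"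
proof -
  show "finite (verts G)"
    using assms unfolding simple_graph_def verts_def by (auto simp: card_ge_0_finite)
  show "{v, w} \<in> G \<Longrightarrow> v \<in> verts G" by (auto simp: verts_def)
  show "{v, v} \<notin> G" using assms by (auto simp: simple_graph_def)
qed

lemma handshake:
  assumes G: "simple_graph G"
  shows "(\<Sum>v\<in>verts G. \<Sum>w\<in>verts G. of_bool ({v, w} \<in> G)) = 2 * real (card G)"
proof -
  let ?V = "verts G"
  have fin: "finite ?V" "finite G" using graph_verts[OF G] G by (auto simp: simple_graph_def)
  have "(\<Sum>v\<in>?V. \<Sum>w\<in>?V. of_bool ({v, w} \<in> G)) = (\<Sum>v\<in>?V. \<Sum>w\<in>?V. \<Sum>e\<in>G. of_bool ({v, w} = e) :: real)"
    using fin by (intro sum.cong refl) (simp add: of_bool_def)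
  also have "\<dots> = (\<Sum>v\<in>?V. \<Sum>e\<in>G. \<Sum>w\<in>?V. of_bool ({v, w} = e))"
    by (intro sum.cong refl sum.swap)
  also have "\<dots> = (\<Sum>e\<in>G. \<Sum>v\<in>?V. \<Sum>w\<in>?V. of_bool ({v, w} = e))"
    by (rule sum.swap)
  also have "\<dots> = (\<Sum>e\<in>G. 2)"
  proof (intro sum.cong refl)
    fix e assume e: "e \<in> G"
    then have "card e = 2" using G by (simp add: simple_graph_def)
    then obtain p q where pq: "e = {p, q}" "p \<noteq> q" by (auto simp: card_2_iff)
    then have V: "p \<in> ?V" "q \<in> ?V" using e by (auto simp: verts_def)
    have "(\<Sum>v\<in>?V. \<Sum>w\<in>?V. of_bool ({v, w} = e)) =
      (\<Sum>v\<in>?V. \<Sum>w\<in>?V. of_bool (v = p) * of_bool (w = q) + of_bool (v = q) * of_bool (w = p) :: real)"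
      using pq by (intro sum.cong refl) (auto simp: doubleton_eq_iff)
    also have "\<dots> = 2"
      using V fin by (simp add: sum.distrib of_bool_def flip: sum_distrib_left sum_distrib_right)
    finally show "(\<Sum>v\<in>?V. \<Sum>w\<in>?V. of_bool ({v, w} = e)) = (2::real)" .
  qed
  finally show ?thesis by simp
qed

text \<open>The maximum of the Rayleigh quotient is an eigenvalue, and it dominates the modulus of
  every other one: replacing an eigenvector by its absolute values does not decrease the form. So it
  is \<open>spec_rad\<close>, and the Perron vector may be rescaled to maximum one.\<close>

lemma spec_rad_vector:
  fixes G :: "'a set set"
  assumes G: "simple_graph G" and ne: "G \<noteq> {}"
  obtains x u where "\<And>v. 0 \<le> x v" "\<And>v. x v \<le> 1" "u \<in> verts G" "x u = (1::real)"
    "\<And>v. v \<in> verts G \<Longrightarrow> (\<Sum>w\<in>verts G. of_bool ({v, w} \<in> G) * x w) = spec_rad G * x v"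
    "\<And>z. (\<Sum>v\<in>verts G. \<Sum>w\<in>verts G. of_bool ({v, w} \<in> G) * z v * z w) \<le> spec_rad G * (\<Sum>v\<in>verts G. (z v)\<^sup>2)"
    "0 < spec_rad G"
proof -
  let ?V = "verts G"
  have fin: "finite ?V" "finite G" using graph_verts[OF G] G by (auto simp: simple_graph_def)
  obtain e where e: "e \<in> G" using ne by auto
  then have "e \<noteq> {}" using G by (auto simp: simple_graph_def)
  then have Vne: "?V \<noteq> {}" using e by (auto simp: verts_def)
  obtain lam x where x0: "\<And>v. 0 \<le> x v" and x1: "\<And>v. x v \<le> 1" and xn: "(\<Sum>v\<in>?V. (x v)\<^sup>2) = (1::real)"
    and eig: "\<And>v. v \<in> ?V \<Longrightarrow> (\<Sum>w\<in>?V. of_bool ({v, w} \<in> G) * x w) = lam * x v"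
    and ray: "\<And>z. (\<Sum>v\<in>?V. \<Sum>w\<in>?V. of_bool ({v, w} \<in> G) * z v * z w) \<le> lam * (\<Sum>v\<in>?V. (z v)\<^sup>2)"
  proof (rule perron_vector[of ?V "\<lambda>v w. {v, w} \<in> G"])
    show "{v, v} \<notin> G" for v using graph_verts[OF G] by blast
    show "{w, v} \<in> G" if "{v, w} \<in> G" for v w using that by (simp add: insert_commute)
  qed (use fin Vne in blast)+
  have "2 * real (card G) \<le> lam * real (card ?V)"
    using ray[of "\<lambda>_. 1"] handshake[OF G] by simp
  moreover have "0 < card G" using ne fin by (simp add: card_gt_0_iff)
  ultimately have "0 < lam * real (card ?V)" by linarith
  then have lam0: "0 < lam" by (simp add: zero_less_mult_iff)
  have "\<exists>v\<in>?V. x v \<noteq> 0" using xn by (metis (mono_tags, lifting) sum.neutral power_zero_numeral zero_neq_one)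
  then obtain v0 where v0: "v0 \<in> ?V" "x v0 \<noteq> 0" by blast
  have evl: "adj_eigenvalue G (of_real lam)"
    unfolding adj_eigenvalue_def
  proof (intro exI[of _ "\<lambda>v. of_real (x v)"] conjI ballI)
    show "\<exists>v\<in>?V. complex_of_real (x v) \<noteq> 0" using v0 by auto
    fix v assume v: "v \<in> ?V"
    have "(\<Sum>u\<in>{u \<in> ?V. {u, v} \<in> G}. complex_of_real (x u)) = of_real (\<Sum>w\<in>?V. of_bool ({v, w} \<in> G) * x w)"
      unfolding of_real_sum using fin by (intro sum.mono_neutral_cong_left) (auto simp: insert_commute)
    then show "(\<Sum>u\<in>{u \<in> ?V. {u, v} \<in> G}. complex_of_real (x u)) = of_real lam * of_real (x v)"
      using eig[OF v] by simp
  qed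
  have le: "cmod \<mu> \<le> lam" if ev: "adj_eigenvalue G \<mu>" for \<mu>
  proof -
    obtain f where f: "(\<Sum>v\<in>?V. (f v)\<^sup>2) = 1"
      "\<forall>v\<in>?V. (\<Sum>w\<in>?V. of_bool ({v, w} \<in> G) * f w) = Re \<mu> * f v" "\<mu> = of_real (Re \<mu>)"
      using adj_eigenvalue_real[OF G ev] by blast
    have "Re \<mu> = (\<Sum>v\<in>?V. f v * (Re \<mu> * f v))"
      using f(1) by (simp add: power2_eq_square mult_ac flip: sum_distrib_left)
    also have "\<dots> = (\<Sum>v\<in>?V. f v * (\<Sum>w\<in>?V. of_bool ({v, w} \<in> G) * f w))"
      using f(2) by (intro sum.cong refl) simp
    also have "\<dots> = (\<Sum>v\<in>?V. \<Sum>w\<in>?V. of_bool ({v, w} \<in> G) * f v * f w)"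
      by (simp add: sum_distrib_left mult_ac)
    finally have "\<bar>Re \<mu>\<bar> \<le> (\<Sum>v\<in>?V. \<bar>\<Sum>w\<in>?V. of_bool ({v, w} \<in> G) * f v * f w\<bar>)"
      using sum_abs[of "\<lambda>v. \<Sum>w\<in>?V. of_bool ({v, w} \<in> G) * f v * f w" ?V] by simp
    also have "\<dots> \<le> (\<Sum>v\<in>?V. \<Sum>w\<in>?V. \<bar>of_bool ({v, w} \<in> G) * f v * f w\<bar>)"
      by (intro sum_mono sum_abs)
    also have "\<dots> = (\<Sum>v\<in>?V. \<Sum>w\<in>?V. of_bool ({v, w} \<in> G) * \<bar>f v\<bar> * \<bar>f w\<bar>)"
      by (simp add: abs_mult)
    also have "\<dots> \<le> lam" using ray[of "\<lambda>v. \<bar>f v\<bar>"] f(1) by simp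
    finally show ?thesis using f(3) by (metis norm_of_real)
  qed
  have spec: "spec_rad G = lam"
    unfolding spec_rad_def
  proof (rule Max_eqI)
    have "{cmod \<mu> |\<mu>. adj_eigenvalue G \<mu>} = cmod ` {\<mu>. adj_eigenvalue G \<mu>}" by auto
    then show "finite {cmod \<mu> |\<mu>. adj_eigenvalue G \<mu>}" using finite_adj_eigenvalues[OF G] by simp
    show "lam \<in> {cmod \<mu> |\<mu>. adj_eigenvalue G \<mu>}" using evl lam0 by (auto intro!: exI[of _ "complex_of_real lam"])
  qed (use le in auto)
  define b where "b = Max (x ` ?V)"
  have "b \<in> x ` ?V" unfolding b_def using fin Vne by (intro Max_in) auto
  then obtain u where u: "u \<in> ?V" "x u = b" by auto
  have bm: "x v \<le> b" if "v \<in> ?V" for v unfolding b_def using fin that by (intro Max_ge) auto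
  have b0: "0 < b" using bm[OF v0(1)] v0(2) x0[of v0] by linarith
  show ?thesis
  proof (rule that[of "\<lambda>v. if v \<in> ?V then x v / b else 0" u])
    fix v assume "v \<in> ?V"
    have "(\<Sum>w\<in>?V. of_bool ({v, w} \<in> G) * (if w \<in> ?V then x w / b else 0)) = (\<Sum>w\<in>?V. of_bool ({v, w} \<in> G) * x w) / b"
      unfolding sum_divide_distrib by (intro sum.cong) auto
    then show "(\<Sum>w\<in>?V. of_bool ({v, w} \<in> G) * (if w \<in> ?V then x w / b else 0)) = spec_rad G * (if v \<in> ?V then x v / b else 0)"
      using eig[OF \<open>v \<in> ?V\<close>] \<open>v \<in> ?V\<close> spec by simp
  qed (use ray spec lam0 b0 x0 bm u in auto)
qed

lemma
  assumes G: "simple_graph G" and ne: "G \<noteq> {}"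
  shows spec_rad_rayleigh: "(\<Sum>v\<in>verts G. \<Sum>w\<in>verts G. of_bool ({v, w} \<in> G) * z v * z w) \<le> spec_rad G * (\<Sum>v\<in>verts G. (z v)\<^sup>2)"
    and spec_rad_pos: "0 < spec_rad G"
proof -
  show "(\<Sum>v\<in>verts G. \<Sum>w\<in>verts G. of_bool ({v, w} \<in> G) * z v * z w) \<le> spec_rad G * (\<Sum>v\<in>verts G. (z v)\<^sup>2)"
    by (rule spec_rad_vector[OF G ne])
  show "0 < spec_rad G"
    by (rule spec_rad_vector[OF G ne])
qed

text \<open>In the labelling of \<open>Kplus\<close>, 0 and 1 go to the ends of the edge,
  \<open>2..k\<close> to the rest of \<open>S\<close>, and the other labels to \<open>t + 1\<close>
  common neighbours, which lie outside \<open>S\<close> because there are no loops.\<close>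

lemma common_neighbours_le:
  assumes G: "simple_graph G" and free: "\<not> contains_subgraph G (Kplus k t)" and k: "1 \<le> k"
    and S: "card S = k + 1" "p \<in> S" "q \<in> S" "{p, q} \<in> G"
  shows "card {w \<in> verts G. \<forall>s\<in>S. {s, w} \<in> G} \<le> t"
proof (rule ccontr)
  define C where "C = {w \<in> verts G. \<forall>s\<in>S. {s, w} \<in> G}"
  assume "\<not> card {w \<in> verts G. \<forall>s\<in>S. {s, w} \<in> G} \<le> t"
  then have "t + 1 \<le> card C" by (simp add: C_def)
  then obtain C' where C': "C' \<subseteq> C" "card C' = t + 1" "finite C'" by (meson obtain_subset_with_card_n)
  have pq: "p \<noteq> q" using S graph_verts(3)[OF G] by auto
  have finS: "finite S" using S by (metis card.infinite add_is_0 one_neq_zero)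
  have disj: "S \<inter> C = {}" using graph_verts(3)[OF G] by (auto simp: C_def)
  obtain h where h: "bij_betw h {2..k} (S - {p, q})"
    using finite_same_card_bij[of "{2..k}" "S - {p, q}"] finS S pq k by (auto simp: card_Diff_subset)
  obtain g where g: "bij_betw g {k + 1..k + t + 1} C'"
    using finite_same_card_bij[of "{k + 1..k + t + 1}" C'] C' by auto
  define f where "f = (\<lambda>i. if i = 0 then p else if i = 1 then q else if i \<le> k then h i else g i)"
  have hS: "h i \<in> S - {p, q}" if "2 \<le> i" "i \<le> k" for i
    using bij_betwE[OF h] that by auto
  have gC: "g i \<in> C'" if "k < i" "i \<le> k + t + 1" for i
    using bij_betwE[OF g] that by auto
  have fS: "f i \<in> S" if "i \<le> k" for i using that S hS[of i] by (auto simp: f_def)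
  have fC: "f i \<in> C'" if "k < i" "i \<le> k + t + 1" for i using that k gC[of i] by (auto simp: f_def)
  have sub: "verts (Kplus k t) \<subseteq> {..k + t + 1}" using k by (auto simp: verts_def Kplus_def)
  have "inj_on f {..k + t + 1}"
  proof (rule inj_onI)
    fix i j assume ij: "i \<in> {..k + t + 1}" "j \<in> {..k + t + 1}" "f i = f j"
    have hi: "h a = h b \<Longrightarrow> a = b" if "2 \<le> a" "a \<le> k" "2 \<le> b" "b \<le> k" for a b
      using bij_betw_imp_inj_on[OF h] that by (auto dest: inj_onD)
    have gi: "g a = g b \<Longrightarrow> a = b" if "k < a" "a \<le> k + t + 1" "k < b" "b \<le> k + t + 1" for a b
      using bij_betw_imp_inj_on[OF g] that by (auto dest: inj_onD)
    consider "i \<le> k" "j \<le> k" | "i \<le> k" "k < j" | "k < i" "j \<le> k" | "k < i" "k < j" by linarith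
    then show "i = j"
    proof cases
      case 1
      then show ?thesis using ij(3) pq hS[of i] hS[of j] hi[of i j]
        by (auto simp: f_def split: if_splits)
    next
      case 2 then show ?thesis using ij fS[of i] fC[of j] C' disj by auto
    next
      case 3 then show ?thesis using ij fS[of j] fC[of i] C' disj by auto
    next
      case 4 then show ?thesis using ij k gi[of i j] by (auto simp: f_def)
    qed
  qed
  then have "inj_on f (verts (Kplus k t))" using sub inj_on_subset by blast
  moreover have "\<forall>e\<in>Kplus k t. f ` e \<in> G"
  proof
    fix e assume "e \<in> Kplus k t"
    then consider i j where "e = {i, j}" "i \<le> k" "k < j" "j \<le> k + t + 1" | "e = {0, 1}"
      by (auto simp: Kplus_def)
    then show "f ` e \<in> G"
    proof cases
      case 1 then show ?thesis using fS[of i] fC[of j] C' by (auto simp: C_def)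
    next
      case 2 then show ?thesis using S by (simp add: f_def insert_commute)
    qed
  qed
  ultimately show False using free by (auto simp: contains_subgraph_def)
qed

lemma adj_eigenvalue_image:
  fixes f :: "'a \<Rightarrow> 'b"
  assumes G: "simple_graph G" and inj: "inj_on f (verts G)"
  shows "adj_eigenvalue ((\<lambda>e. f ` e) ` G) \<mu> \<longleftrightarrow> adj_eigenvalue G \<mu>"
proof -
  let ?V = "verts G" and ?H = "(\<lambda>e. f ` e) ` G"
  have VH: "verts ?H = f ` ?V" by (auto simp: verts_def)
  have sub: "e \<subseteq> ?V" if "e \<in> G" for e using that by (auto simp: verts_def)
  have edge: "{f p, f q} \<in> ?H \<longleftrightarrow> {p, q} \<in> G" if "p \<in> ?V" "q \<in> ?V" for p q
  proof
    assume "{f p, f q} \<in> ?H"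
    then obtain e where e: "e \<in> G" "f ` {p, q} = f ` e" by auto
    then have "{p, q} = e" using inj that sub inj_on_image_eq_iff[OF inj, of "{p, q}" e] by auto
    then show "{p, q} \<in> G" using e by simp
  next
    assume "{p, q} \<in> G"
    then have "f ` {p, q} \<in> ?H" by (rule imageI)
    then show "{f p, f q} \<in> ?H" by simp
  qed
  have nb: "{w \<in> f ` ?V. {w, f v} \<in> ?H} = f ` {w \<in> ?V. {w, v} \<in> G}" if "v \<in> ?V" for v
    using edge that by auto
  have eq: "(\<Sum>w\<in>{w \<in> f ` ?V. {w, f v} \<in> ?H}. y w) = (\<Sum>w\<in>{w \<in> ?V. {w, v} \<in> G}. y (f w))"
    if "v \<in> ?V" for v and y :: "'b \<Rightarrow> complex"
    unfolding nb[OF that] by (subst sum.reindex) (auto intro: inj_on_subset[OF inj])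
  show ?thesis
  proof
    assume "adj_eigenvalue ?H \<mu>"
    then obtain y where y: "\<exists>v\<in>f ` ?V. y v \<noteq> 0" "\<And>v. v \<in> f ` ?V \<Longrightarrow> (\<Sum>w\<in>{w \<in> f ` ?V. {w, v} \<in> ?H}. y w) = \<mu> * y v"
      unfolding adj_eigenvalue_def VH by blast
    have "(\<Sum>w\<in>{w \<in> ?V. {w, v} \<in> G}. y (f w)) = \<mu> * y (f v)" if "v \<in> ?V" for v
      using eq[OF that, of y] y(2)[of "f v"] that by simp
    then show "adj_eigenvalue G \<mu>"
      unfolding adj_eigenvalue_def using y(1) by (intro exI[of _ "\<lambda>v. y (f v)"]) auto
  next
    assume "adj_eigenvalue G \<mu>"
    then obtain x where x: "\<exists>v\<in>?V. x v \<noteq> 0" "\<And>v. v \<in> ?V \<Longrightarrow> (\<Sum>w\<in>{w \<in> ?V. {w, v} \<in> G}. x w) = \<mu> * x v"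
      unfolding adj_eigenvalue_def by blast
    define y where "y = (\<lambda>w. x (inv_into ?V f w))"
    have yf: "y (f v) = x v" if "v \<in> ?V" for v using that inj by (simp add: y_def)
    have "(\<Sum>w\<in>{w \<in> f ` ?V. {w, f v} \<in> ?H}. y w) = \<mu> * y (f v)" if "v \<in> ?V" for v
      unfolding eq[OF that] using x(2)[OF that] that by (simp add: yf)
    then show "adj_eigenvalue ?H \<mu>"
      unfolding adj_eigenvalue_def VH using x(1) yf by (intro exI[of _ y]) auto
  qed
qed

lemma spec_rad_iso:
  assumes "simple_graph G" "graph_iso G H"
  shows "spec_rad G = spec_rad H"
proof -
  obtain f where f: "inj_on f (verts G)" "H = (\<lambda>e. f ` e) ` G"
    using assms(2) by (auto simp: graph_iso_def)
  have "adj_eigenvalue H = adj_eigenvalue G"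
    unfolding f(2) by (intro ext adj_eigenvalue_image assms f(1))
  then show ?thesis by (simp add: spec_rad_def)
qed

text \<open>Rayleigh quotient of the vector that is \<open>1\<close> on the clique and \<open>d / \<lambda>\<close> at an outside vertex with \<open>d\<close>
  neighbours in it.\<close>

lemma split_spec_lower:
  fixes V :: "'a set"
  assumes V: "A \<union> R = V" "A \<inter> R = {}" "finite V"
    and sym: "\<And>v w. E v w \<Longrightarrow> E w v"
    and AA: "\<And>p q. p \<in> A \<Longrightarrow> q \<in> A \<Longrightarrow> E p q \<longleftrightarrow> p \<noteq> q"
    and RR: "\<And>p q. p \<in> R \<Longrightarrow> q \<in> R \<Longrightarrow> \<not> E p q"
    and ray: "\<And>z. (\<Sum>v\<in>V. \<Sum>w\<in>V. of_bool (E v w) * z v * z w) \<le> lam * (\<Sum>v\<in>V. (z v)\<^sup>2)"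
    and lam: "0 < lam"
  shows "lam * (real (card A) * (real (card A) - 1)) + (\<Sum>v\<in>R. (real (card {p \<in> A. E p v}))\<^sup>2) \<le> lam\<^sup>2 * real (card A)"
proof -
  define n where "n = (\<lambda>v. real (card {p \<in> A. E p v}))"
  define P where "P = (\<Sum>v\<in>R. (n v)\<^sup>2)"
  define z where "z = (\<lambda>v. if v \<in> A then 1 else n v / lam)"
  have fin: "finite A" "finite R" using V by auto
  have sV: "(\<Sum>v\<in>V. f v) = (\<Sum>v\<in>A. f v) + (\<Sum>v\<in>R. f v)" for f :: "'a \<Rightarrow> real"
    using sum.union_disjoint[OF fin V(2), of f] V(1) by simp
  have zA: "z v = 1" if "v \<in> A" for v using that by (simp add: z_def)
  have zR: "z v = n v / lam" if "v \<in> R" for v using that V by (auto simp: z_def)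
  have row: "(\<Sum>p\<in>A. of_bool (E p v)) = n v" for v
    using fin by (simp add: n_def sum_of_bool_eq Int_def)
  have nA: "n v = real (card A) - 1" if "v \<in> A" for v
  proof -
    have "{p \<in> A. E p v} = A - {v}" using AA that by auto
    moreover have "0 < card A" using that fin by (auto simp: card_gt_0_iff)
    ultimately show ?thesis using that by (simp add: n_def of_nat_diff Suc_le_eq)
  qed
  have "(\<Sum>v\<in>V. \<Sum>w\<in>V. of_bool (E v w) * z v * z w) =
    (\<Sum>v\<in>A. \<Sum>w\<in>A. of_bool (E v w)) + 2 * (\<Sum>v\<in>R. \<Sum>w\<in>A. of_bool (E w v) * (n v / lam))"
  proof -
    have "(\<Sum>v\<in>A. \<Sum>w\<in>R. of_bool (E v w) * z v * z w) = (\<Sum>w\<in>R. \<Sum>v\<in>A. of_bool (E v w) * (n w / lam))"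
      by (subst sum.swap) (simp add: zA zR)
    moreover have "(\<Sum>v\<in>R. \<Sum>w\<in>A. of_bool (E v w) * z v * z w) = (\<Sum>w\<in>R. \<Sum>v\<in>A. of_bool (E v w) * (n w / lam))"
      by (intro sum.cong refl) (auto simp: zA zR of_bool_def dest: sym)
    moreover have "(\<Sum>v\<in>R. \<Sum>w\<in>R. of_bool (E v w) * z v * z w) = 0"
      by (intro sum.neutral ballI) (simp add: RR)
    moreover have "(\<Sum>v\<in>A. \<Sum>w\<in>A. of_bool (E v w) * z v * z w) = (\<Sum>v\<in>A. \<Sum>w\<in>A. of_bool (E v w))"
      by (simp add: zA)
    ultimately show ?thesis by (simp add: sV sum.distrib)
  qed
  also have "(\<Sum>v\<in>A. \<Sum>w\<in>A. of_bool (E v w)) = (\<Sum>w\<in>A. n w)"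
    by (subst sum.swap) (simp add: row)
  also have "\<dots> = real (card A) * (real (card A) - 1)" by (simp add: nA)
  also have "(\<Sum>v\<in>R. \<Sum>w\<in>A. of_bool (E w v) * (n v / lam)) = P / lam"
    unfolding sum_distrib_right[symmetric] row by (simp add: P_def power2_eq_square sum_divide_distrib)
  finally have 1: "real (card A) * (real (card A) - 1) + 2 * (P / lam) \<le> lam * (\<Sum>v\<in>V. (z v)\<^sup>2)"
    using ray[of z] by simp
  have "(\<Sum>v\<in>V. (z v)\<^sup>2) = real (card A) + P / lam\<^sup>2"
    by (simp add: sV zA zR power_divide P_def sum_divide_distrib)
  then have "real (card A) * (real (card A) - 1) + 2 * (P / lam) \<le> lam * real (card A) + P / lam"
    using 1 lam by (simp add: power2_eq_square distrib_left)
  then have "lam * (real (card A) * (real (card A) - 1) + P / lam) \<le> lam * (lam * real (card A))"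
    using lam by (intro mult_left_mono) auto
  then show ?thesis using lam by (simp add: P_def n_def power2_eq_square distrib_left mult_ac)
qed

section \<open>The split graph: edges, spectral radius and recognition\<close>

lemma Ssplit_edge:
  assumes k: "0 < k" and s: "s = (m - (k choose 2)) div k" and r: "r = (m - (k choose 2)) mod k"
  shows "{i, j} \<in> Ssplit k m \<longleftrightarrow>
    i \<noteq> j \<and> (i < k \<and> j < k \<or> i < k \<and> k \<le> j \<and> j < k + s \<or> j < k \<and> k \<le> i \<and> i < k + s
      \<or> i < r \<and> j = k + s \<or> j < r \<and> i = k + s)" (is "_ \<longleftrightarrow> ?R i j")
proof -
  have S: "Ssplit k m = {{i, j} | i j. i < j \<and> j < k} \<union> {{i, k + s'} | i s'. i < k \<and> s' < s} \<union> {{i, k + s} | i. i < r}"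
    by (simp add: Ssplit_def Let_def s r)
  have rk: "r < k" using k by (simp add: r)
  have sym: "?R j i \<longleftrightarrow> ?R i j" for i j by auto
  have fwd: "?R i j" if "{i, j} \<in> Ssplit k m"
  proof -
    consider (AA) p q where "{i, j} = {p, q}" "p < q" "q < k"
      | (AB) p s' where "{i, j} = {p, k + s'}" "p < k" "s' < s"
      | (last) p where "{i, j} = {p, k + s}" "p < r"
      using \<open>{i, j} \<in> Ssplit k m\<close> unfolding S by blast
    then show ?thesis by cases (use rk in \<open>auto simp: doubleton_eq_iff\<close>)
  qed
  have bwd: "{i, j} \<in> Ssplit k m" if R: "?R i j" "i \<le> j" for i j
  proof -
    consider "i < j" "j < k" | "i < k" "k \<le> j" "j < k + s" | "i < r" "j = k + s"
      using R rk by linarith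
    then show ?thesis
    proof cases
      case 2
      then obtain s' where s': "j = k + s'" using le_iff_add by blast
      then have "s' < s" using 2 by simp
      then show ?thesis using 2(1) unfolding S s' by blast
    qed (auto simp: S)
  qed
  show ?thesis
  proof
    assume R: "?R i j"
    show "{i, j} \<in> Ssplit k m"
    proof (cases "i \<le> j")
      case False
      have "{j, i} \<in> Ssplit k m" using R sym False by (intro bwd) auto
      then show ?thesis by (simp only: insert_commute)
    qed (rule bwd[OF R])
  qed (rule fwd)
qed

lemma simple_Ssplit: "0 < k \<Longrightarrow> simple_graph (Ssplit k m)"
proof -
  assume k: "0 < k"
  define s where "s = (m - (k choose 2)) div k"
  define r where "r = (m - (k choose 2)) mod k"
  have r: "r < k" using k by (simp add: r_def)
  have S: "Ssplit k m = {{i, j} | i j. i < j \<and> j < k} \<union> {{i, k + s'} | i s'. i < k \<and> s' < s} \<union> {{i, k + s} | i. i < r}"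
    by (simp add: Ssplit_def Let_def s_def r_def)
  have "Ssplit k m \<subseteq> Pow {..k + s}"
    unfolding S using r by auto
  then have "finite (Ssplit k m)" by (rule finite_subset) simp
  moreover have "card e = 2" if "e \<in> Ssplit k m" for e
  proof -
    consider p q where "e = {p, q}" "p < q" "q < k"
      | p s' where "e = {p, k + s'}" "p < k" "s' < s"
      | p where "e = {p, k + s}" "p < r"
      using \<open>e \<in> Ssplit k m\<close> unfolding S by blast
    then show ?thesis by cases (use r in simp_all)
  qed
  ultimately show ?thesis by (simp add: simple_graph_def)
qed

text \<open>With \<open>M = k * s + r\<close>, \<open>split_spec_lower\<close> has the degree
  squares \<open>s * k\<^sup>2 + r\<^sup>2\<close>. Division by \<open>k\<close> turns them into
  \<open>M - r * (k - r) / k\<close>, the exact quantity with which the free graph is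
  compared.\<close>

lemma spec_rad_Ssplit_ge:
  assumes k: "2 \<le> k" and m: "k + (k choose 2) \<le> m"
  defines "M \<equiv> m - (k choose 2)"
  shows "real M - real (M mod k * (k - M mod k)) / real k
    \<le> (spec_rad (Ssplit k m))\<^sup>2 - (real k - 1) * spec_rad (Ssplit k m)" "0 < spec_rad (Ssplit k m)"
proof -
  define s where "s = M div k"
  define r where "r = M mod k"
  have k0: "0 < k" and r: "r < k" using k by (auto simp: r_def)
  have "k \<le> M" using m by (simp add: M_def)
  then have s1: "1 \<le> s" using k0 div_le_mono[of k M k] by (simp add: s_def)
  have Mks: "M = k * s + r" by (simp add: s_def r_def)
  let ?S = "Ssplit k m"
  have edge: "{i, j} \<in> ?S \<longleftrightarrow> i \<noteq> j \<and> (i < k \<and> j < k \<or> i < k \<and> k \<le> j \<and> j < k + s \<or> j < k \<and> k \<le> i \<and> i < k + s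
      \<or> i < r \<and> j = k + s \<or> j < r \<and> i = k + s)" for i j
    by (rule Ssplit_edge[OF k0]) (simp_all add: s_def r_def M_def)
  define A where "A = {..<k}"
  \<comment> \<open>For \<open>r = 0\<close> the last vertex is isolated and does not belong to
    \<open>verts\<close>.\<close>
  define R where "R = {k..<k + s} \<union> (if r = 0 then {} else {k + s})"
  have "verts ?S = A \<union> R"
  proof
    show "verts ?S \<subseteq> A \<union> R"
    proof
      fix i assume "i \<in> verts ?S"
      then obtain e where e: "e \<in> ?S" "i \<in> e" by (auto simp: verts_def)
      then have "card e = 2" using simple_Ssplit[OF k0] by (auto simp: simple_graph_def)
      then obtain j where "e = {i, j}" using e(2) by (auto simp: card_2_iff insert_commute)
      with e(1) have "{i, j} \<in> ?S" by simp
      then show "i \<in> A \<union> R" unfolding edge A_def R_def using r by auto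
    qed
    show "A \<union> R \<subseteq> verts ?S"
    proof
      fix i assume "i \<in> A \<union> R"
      then consider "i < k" | "i \<in> R" by (auto simp: A_def)
      then obtain j where "{i, j} \<in> ?S"
      proof cases
        case 1
        then have "{i, k} \<in> ?S" using s1 by (simp add: edge)
        then show ?thesis by (rule that)
      next
        case 2
        then have "{i, 0} \<in> ?S" using s1 k0 by (auto simp: edge R_def split: if_splits)
        then show ?thesis by (rule that)
      qed
      then show "i \<in> verts ?S" by (auto simp: verts_def)
    qed
  qed
  then have V: "A \<union> R = verts ?S" by simp
  have dis: "A \<inter> R = {}" using s1 by (auto simp: A_def R_def split: if_splits)
  have ne: "?S \<noteq> {}" using edge[of 0 1] k by auto
  have sg: "simple_graph ?S" by (rule simple_Ssplit[OF k0])
  note ray = spec_rad_rayleigh[OF sg ne] and pos = spec_rad_pos[OF sg ne]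
  show "0 < spec_rad ?S" by (rule pos)
  have "spec_rad ?S * (real (card A) * (real (card A) - 1)) + (\<Sum>v\<in>R. (real (card {p \<in> A. {p, v} \<in> ?S}))\<^sup>2)
      \<le> (spec_rad ?S)\<^sup>2 * real (card A)"
  proof (rule split_spec_lower[OF V dis graph_verts(1)[OF sg], of "\<lambda>v w. {v, w} \<in> ?S"])
    show "{w, v} \<in> ?S" if "{v, w} \<in> ?S" for v w using that by (simp add: insert_commute)
    show "{p, q} \<in> ?S \<longleftrightarrow> p \<noteq> q" if "p \<in> A" "q \<in> A" for p q
      using that by (auto simp: edge A_def)
    show "{p, q} \<notin> ?S" if "p \<in> R" "q \<in> R" for p q
      using that r by (auto simp: edge R_def split: if_splits)
  qed (rule ray pos)+
  also have "(\<Sum>v\<in>R. (real (card {p \<in> A. {p, v} \<in> ?S}))\<^sup>2) = real s * (real k)\<^sup>2 + (real r)\<^sup>2"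
  proof -
    have c1: "card {p \<in> A. {p, v} \<in> ?S} = k" if "v \<in> {k..<k + s}" for v
    proof -
      have "{p \<in> A. {p, v} \<in> ?S} = {..<k}" using that r by (auto simp: edge A_def)
      then show ?thesis by simp
    qed
    have c2: "card {p \<in> A. {p, k + s} \<in> ?S} = r"
    proof -
      have "{p \<in> A. {p, k + s} \<in> ?S} = {..<r}" using r by (auto simp: edge A_def)
      then show ?thesis by simp
    qed
    show ?thesis
      by (cases "r = 0") (use c1 c2 in \<open>auto simp: R_def\<close>)
  qed
  finally have "spec_rad ?S * (real k * (real k - 1)) + (real s * (real k)\<^sup>2 + (real r)\<^sup>2) \<le> (spec_rad ?S)\<^sup>2 * real k"
    by (simp add: A_def)
  then have "(spec_rad ?S * (real k * (real k - 1)) + (real s * (real k)\<^sup>2 + (real r)\<^sup>2)) / real k \<le> (spec_rad ?S)\<^sup>2"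
    using k0 by (simp add: field_simps)
  moreover have "(spec_rad ?S * (real k * (real k - 1)) + (real s * (real k)\<^sup>2 + (real r)\<^sup>2)) / real k
      = (real k - 1) * spec_rad ?S + (real M - real (r * (k - r)) / real k)"
    using k0 r by (simp add: Mks of_nat_diff field_simps power2_eq_square)
  ultimately show "real M - real (M mod k * (k - M mod k)) / real k \<le> (spec_rad ?S)\<^sup>2 - (real k - 1) * spec_rad ?S"
    unfolding r_def by linarith
qed

lemma real_choose_two: "real (k choose 2) = real k * (real k - 1) / 2"
proof (induction k)
  case (Suc k)
  have "Suc k choose 2 = k + (k choose 2)" by (simp add: numeral_2_eq_2)
  then have "real (Suc k choose 2) = real k + real (k choose 2)" by simp
  then show ?case unfolding Suc by (simp add: field_simps)
qed simp

text \<open>Counting edges gives \<open>card G - (k choose 2) = k * s + j\<close> with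
  \<open>j < k\<close>, so \<open>s\<close> and \<open>j\<close> are the quotient and the remainder
  in \<open>Ssplit\<close>. The isomorphism sends the neighbours of the deficient vertex to the
  first \<open>j\<close> labels of the clique.\<close>

lemma graph_iso_Ssplit:
  fixes G :: "'a set set"
  assumes G: "simple_graph G" and A: "A \<subseteq> verts G" "card A = k" and k: "0 < k"
    and AA: "\<And>p q. p \<in> A \<Longrightarrow> q \<in> A \<Longrightarrow> p \<noteq> q \<Longrightarrow> {p, q} \<in> G"
    and RR: "\<And>p q. p \<in> verts G - A \<Longrightarrow> q \<in> verts G - A \<Longrightarrow> {p, q} \<notin> G"
    and le1: "card {v \<in> verts G - A. 0 < card {p \<in> A. {p, v} \<in> G} \<and> card {p \<in> A. {p, v} \<in> G} < k} \<le> 1"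
  shows "graph_iso G (Ssplit k (card G))"
proof -
  let ?V = "verts G"
  define R where "R = ?V - A"
  define n where "n = (\<lambda>v. card {p \<in> A. {p, v} \<in> G})"
  define Fu where "Fu = {v \<in> R. n v = k}"
  define De where "De = {v \<in> R. 0 < n v \<and> n v < k}"
  define A1 where "A1 = {p \<in> A. \<exists>w\<in>De. {p, w} \<in> G}"
  define s where "s = card Fu"
  define j where "j = card A1"
  let ?S = "Ssplit k (card G)"
  have fV: "finite ?V" by (rule graph_verts(1)[OF G])
  have fA: "finite A" and fR: "finite R" using A fV finite_subset by (auto simp: R_def)
  have VAR: "?V = A \<union> R" "A \<inter> R = {}" using A by (auto simp: R_def)
  have sub: "A1 \<subseteq> A" "Fu \<subseteq> R" "De \<subseteq> R" by (auto simp: A1_def Fu_def De_def)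
  have fin: "finite A1" "finite Fu" "finite De"
    using finite_subset[OF sub(1) fA] finite_subset[OF sub(2) fR] finite_subset[OF sub(3) fR] by auto
  have nle: "n v \<le> k" for v using card_mono[OF fA, of "{p \<in> A. {p, v} \<in> G}"] A by (auto simp: n_def)
  \<comment> \<open>Vertices are not isolated and \<open>R\<close> is independent, so each vertex of
    \<open>R\<close> has a neighbour in \<open>A\<close>, and \<open>Fu\<close> and
    \<open>De\<close> exhaust \<open>R\<close>.\<close>
  have npos: "0 < n v" if v: "v \<in> R" for v
  proof -
    obtain e where e: "e \<in> G" "v \<in> e" using v by (auto simp: R_def verts_def)
    then have "card e = 2" using G by (simp add: simple_graph_def)
    then obtain w where w: "e = {w, v}" using e(2) by (auto simp: card_2_iff insert_commute)
    then have "w \<in> ?V" using e by (auto simp: verts_def)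
    then have "w \<in> A" using RR[of w v] e w v by (auto simp: R_def)
    then have "w \<in> {p \<in> A. {p, v} \<in> G}" using e w by simp
    then show ?thesis using fA by (auto simp: n_def card_gt_0_iff)
  qed
  have RFD: "R = Fu \<union> De" "Fu \<inter> De = {}" using npos nle by (auto simp: Fu_def De_def le_less)
  have cDe: "card De \<le> 1" using le1 by (simp add: De_def R_def n_def)
  have De_eq: "v = w" if "v \<in> De" "w \<in> De" for v w
    using cDe fin(3) that by (metis One_nat_def card_le_Suc0_iff_eq)
  have A1_n: "{p \<in> A. {p, w} \<in> G} = A1" if "w \<in> De" for w
    using that De_eq by (auto simp: A1_def)
  have full: "{p \<in> A. {p, v} \<in> G} = A" if "v \<in> Fu" for v
    using that fA A by (intro card_subset_eq) (auto simp: Fu_def n_def)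
  have jk: "j < k"
  proof (cases "De = {}")
    case True
    then have "A1 = {}" by (auto simp: A1_def)
    then show ?thesis using k by (simp add: j_def)
  next
    case False
    then obtain w where w: "w \<in> De" by auto
    then have "n w = j" using A1_n[OF w] by (simp add: n_def j_def)
    then show ?thesis using w by (simp add: De_def)
  qed
  have "(\<Sum>v\<in>De. n v) = j"
  proof (cases "De = {}")
    case True
    then have "A1 = {}" by (auto simp: A1_def)
    then show ?thesis using True by (simp add: j_def)
  next
    case False
    then obtain w where w: "w \<in> De" by auto
    then have "De = {w}" using De_eq by auto
    then show ?thesis using A1_n[OF w] by (simp add: n_def j_def)
  qed
  moreover have "(\<Sum>v\<in>Fu. n v) = k * s" by (simp add: Fu_def s_def)
  ultimately have sn: "(\<Sum>v\<in>R. n v) = k * s + j"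
    using RFD fin by (simp add: sum.union_disjoint)
  have "2 * real (card G) = real k * (real k - 1) + 2 * real (\<Sum>v\<in>R. n v)"
  proof -
    have sV: "(\<Sum>v\<in>?V. f v) = (\<Sum>v\<in>A. f v) + (\<Sum>v\<in>R. f v)" for f :: "'a \<Rightarrow> real"
      using sum.union_disjoint[OF fA fR VAR(2), of f] VAR(1) by simp
    have row: "(\<Sum>p\<in>A. of_bool ({p, v} \<in> G)) = real (n v)" for v
      using fA by (simp add: n_def sum_of_bool_eq Int_def)
    have nA: "real (n v) = real k - 1" if "v \<in> A" for v
    proof -
      have "{p \<in> A. {p, v} \<in> G} = A - {v}" using AA that graph_verts(3)[OF G] by auto
      then show ?thesis using that fA A k by (simp add: n_def of_nat_diff)
    qed
    have "2 * real (card G) = (\<Sum>v\<in>A. \<Sum>w\<in>A. of_bool ({v, w} \<in> G)) + (\<Sum>v\<in>A. \<Sum>w\<in>R. of_bool ({v, w} \<in> G))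
      + ((\<Sum>v\<in>R. \<Sum>w\<in>A. of_bool ({v, w} \<in> G)) + (\<Sum>v\<in>R. \<Sum>w\<in>R. of_bool ({v, w} \<in> G)))"
      unfolding handshake[OF G, symmetric] sV by (simp add: sV sum.distrib)
    also have "(\<Sum>v\<in>A. \<Sum>w\<in>R. of_bool ({v, w} \<in> G)) = (\<Sum>v\<in>R. real (n v))"
      by (subst sum.swap) (simp add: row)
    also have "(\<Sum>v\<in>R. \<Sum>w\<in>A. of_bool ({v, w} \<in> G)) = (\<Sum>v\<in>R. real (n v))"
      unfolding row[symmetric] by (simp add: insert_commute)
    also have "(\<Sum>v\<in>A. \<Sum>w\<in>A. of_bool ({v, w} \<in> G)) = (\<Sum>v\<in>A. real (n v))"
      by (subst sum.swap) (simp add: row)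
    also have "\<dots> = real k * (real k - 1)" using nA A by simp
    also have "(\<Sum>v\<in>R. \<Sum>w\<in>R. of_bool ({v, w} \<in> G)) = (0::real)"
      using RR by (intro sum.neutral ballI) (simp add: R_def)
    finally show ?thesis by simp
  qed
  then have "real (card G) = real ((k choose 2) + (k * s + j))"
    unfolding sn by (simp add: real_choose_two)
  then have "card G = (k choose 2) + (k * s + j)" by (simp only: of_nat_eq_iff)
  then have M: "card G - (k choose 2) = k * s + j" by simp
  have edge: "{p, q} \<in> ?S \<longleftrightarrow> p \<noteq> q \<and> (p < k \<and> q < k \<or> p < k \<and> k \<le> q \<and> q < k + s \<or> q < k \<and> k \<le> p \<and> p < k + s
      \<or> p < j \<and> q = k + s \<or> q < j \<and> p = k + s)" for p q
    by (rule Ssplit_edge[OF k]) (use jk M in simp_all)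
  have "card A1 = card {0..<j}" "card (A - A1) = card {j..<k}" "card Fu = card {k..<k + s}"
    using fin(1) sub(1) A(2) by (simp_all add: j_def s_def card_Diff_subset)
  then obtain f1 f2 f3 where f1: "bij_betw f1 A1 {0..<j}" and f2: "bij_betw f2 (A - A1) {j..<k}"
    and f3: "bij_betw f3 Fu {k..<k + s}"
    using finite_same_card_bij[OF fin(1) finite_atLeastLessThan]
      finite_same_card_bij[OF finite_Diff[OF fA] finite_atLeastLessThan]
      finite_same_card_bij[OF fin(2) finite_atLeastLessThan] by meson
  define f where "f = (\<lambda>v. if v \<in> A1 then f1 v else if v \<in> A then f2 v else if v \<in> Fu then f3 v else k + s)"
  have b1: "bij_betw f A1 {0..<j}"
    using f1 by (rule bij_betw_cong[THEN iffD1, rotated]) (simp add: f_def)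
  have b2: "bij_betw f (A - A1) {j..<k}"
    using f2 by (rule bij_betw_cong[THEN iffD1, rotated]) (simp add: f_def)
  have b3: "bij_betw f Fu {k..<k + s}"
    using f3 by (rule bij_betw_cong[THEN iffD1, rotated]) (use sub VAR in \<open>auto simp: f_def\<close>)
  have bD: "f v = k + s" if "v \<in> De" for v
    using that sub VAR RFD by (auto simp: f_def)
  have bA: "bij_betw f A {0..<k}"
  proof -
    have "bij_betw f (A1 \<union> (A - A1)) ({0..<j} \<union> {j..<k})" by (rule bij_betw_combine[OF b1 b2]) auto
    moreover have "A1 \<union> (A - A1) = A" using sub by auto
    moreover have "{0..<j} \<union> {j..<k} = {0..<k}" using jk by auto
    ultimately show ?thesis by simp
  qed
  have bAF: "bij_betw f (A \<union> Fu) {0..<k + s}"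
  proof -
    have "bij_betw f (A \<union> Fu) ({0..<k} \<union> {k..<k + s})" by (rule bij_betw_combine[OF bA b3]) auto
    moreover have "{0..<k} \<union> {k..<k + s} = {0..<k + s}" by auto
    ultimately show ?thesis by simp
  qed
  have fA1: "f v < j \<longleftrightarrow> v \<in> A1" if "v \<in> A" for v
  proof (cases "v \<in> A1")
    case True
    then show ?thesis using bspec[OF bij_betwE[OF b1] True] by simp
  next
    case False
    then have "v \<in> A - A1" using that by simp
    then show ?thesis using bspec[OF bij_betwE[OF b2]] False by fastforce
  qed
  have fAk: "f v < k" if "v \<in> A" for v using bij_betwE[OF bA] that by auto
  have fF: "k \<le> f v \<and> f v < k + s" if "v \<in> Fu" for v using bij_betwE[OF b3] that by auto
  have inj: "inj_on f ?V"
  proof (rule inj_onI)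
    fix v w assume vw: "v \<in> ?V" "w \<in> ?V" "f v = f w"
    have lt: "f v < k + s" if "v \<in> A \<union> Fu" for v using bij_betwE[OF bAF] that by auto
    have "v \<in> De \<longleftrightarrow> w \<in> De" using vw lt[of v] lt[of w] bD[of v] bD[of w] VAR RFD by auto
    then show "v = w"
      using vw De_eq[of v w] inj_onD[OF bij_betw_imp_inj_on[OF bAF], of v w] VAR RFD by auto
  qed
  have edge_iff: "{f p, f q} \<in> ?S \<longleftrightarrow> {p, q} \<in> G" if pq: "p \<in> ?V" "q \<in> ?V" for p q
  proof -
    have AR: "{f a, f b} \<in> ?S \<longleftrightarrow> {a, b} \<in> G" if "a \<in> A" "b \<in> R" for a b
    proof (cases "b \<in> Fu")
      case True
      then have "{a, b} \<in> G" using full[OF True] that by auto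
      moreover have "{f a, f b} \<in> ?S" unfolding edge using fAk[OF that(1)] fF[OF True] by auto
      ultimately show ?thesis by simp
    next
      case False
      then have b: "b \<in> De" using that RFD by auto
      have "{a, b} \<in> G \<longleftrightarrow> a \<in> A1" using A1_n[OF b] that by auto
      moreover have "{f a, f b} \<in> ?S \<longleftrightarrow> f a < j" unfolding edge bD[OF b] using fAk[OF that(1)] jk by auto
      ultimately show ?thesis using fA1[OF that(1)] by simp
    qed
    have fR: "k \<le> f b" if "b \<in> R" for b using that RFD fF bD by fastforce
    consider "p \<in> A" "q \<in> A" | "p \<in> A" "q \<in> R" | "p \<in> R" "q \<in> A" | "p \<in> R" "q \<in> R" using pq VAR by auto
    then show ?thesis
    proof cases
      case 1
      have "f p = f q \<longleftrightarrow> p = q" using inj pq by (auto dest: inj_onD)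
      then show ?thesis unfolding edge using 1 fAk AA graph_verts(3)[OF G] by auto
    next
      case 3 then show ?thesis using AR[of q p] by (simp add: insert_commute)
    next
      case 4
      then have "{p, q} \<notin> G" using RR by (auto simp: R_def)
      moreover have "{f p, f q} \<notin> ?S" unfolding edge using fR[OF 4(1)] fR[OF 4(2)] jk by auto
      ultimately show ?thesis by simp
    qed (rule AR)
  qed
  have "?S = (\<lambda>e. f ` e) ` G"
  proof
    show "(\<lambda>e. f ` e) ` G \<subseteq> ?S"
    proof
      fix e' assume "e' \<in> (\<lambda>e. f ` e) ` G"
      then obtain e where e: "e \<in> G" "e' = f ` e" by auto
      then have "card e = 2" using G by (simp add: simple_graph_def)
      then obtain p q where pq: "e = {p, q}" by (auto simp: card_2_iff)
      then have "p \<in> ?V" "q \<in> ?V" using e by (auto simp: verts_def)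
      then show "e' \<in> ?S" using edge_iff[of p q] e pq by simp
    qed
    show "?S \<subseteq> (\<lambda>e. f ` e) ` G"
    proof
      fix e' assume e': "e' \<in> ?S"
      then have "card e' = 2" using simple_Ssplit[OF k] by (auto simp: simple_graph_def)
      then obtain p q where pq: "e' = {p, q}" by (auto simp: card_2_iff)
      have range: "p \<in> f ` ?V" if "{p, q} \<in> ?S" for p q
      proof -
        have "p < k + s \<or> p = k + s \<and> 0 < j" using that unfolding edge using jk by auto
        then show ?thesis
        proof
          assume "p < k + s"
          then have "p \<in> f ` (A \<union> Fu)" using bAF by (auto simp: bij_betw_def)
          then show ?thesis using VAR RFD by auto
        next
          assume p: "p = k + s \<and> 0 < j"
          then have "A1 \<noteq> {}" by (auto simp: j_def)
          then obtain w where w: "w \<in> De" by (auto simp: A1_def)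
          then have "w \<in> ?V" using VAR RFD by auto
          moreover have "p = f w" using bD[OF w] p by simp
          ultimately show ?thesis by blast
        qed
      qed
      obtain a b where ab: "a \<in> ?V" "b \<in> ?V" "p = f a" "q = f b"
        using range[of p q] range[of q p] e' pq by (auto simp: insert_commute)
      then have "{a, b} \<in> G" using edge_iff[of a b] e' pq by simp
      moreover have "e' = f ` {a, b}" using ab pq by simp
      ultimately show "e' \<in> (\<lambda>e. f ` e) ` G" by blast
    qed
  qed
  with inj show ?thesis by (auto simp: graph_iso_def)
qed

theorem theorem1p11:
  fixes k t :: nat
  assumes "2 \<le> k" and "k \<le> t"
  shows "\<exists>m0. \<forall>m\<ge>m0. \<forall>G :: 'a set set.
           simple_graph G \<and> card G = m \<and> \<not> contains_subgraph G (Kplus k t) \<longrightarrow>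
             spec_rad G \<le> spec_rad (Ssplit k m) \<and>
             (spec_rad G = spec_rad (Ssplit k m) \<longleftrightarrow> graph_iso G (Ssplit k m))"
proof -
  define z where "z = 1 / (4096 * real k)"
  define d where "d = z / 20480"
  \<comment> \<open>The edges of the clique, plus \<open>k\<close> as a bound for the residue
    term.\<close>
  define c where "c = real k * (real k - 1) / 2 + real k"
  have k2: "2 \<le> k" and k0: "0 < k" by (use assms in auto)
  have d0: "0 < d" using k0 by (simp add: d_def z_def)
  define h where "h = nat \<lceil>real k / d ^ 3\<rceil>"
  have "real k / d ^ 3 \<le> real h" unfolding h_def by linarith
  then have h: "real k \<le> d ^ 3 * real h" using d0 by (simp add: field_simps)
  define C2 where "C2 = 2 ^ h * real t * real h + c"
  define B where "B = C2 / d ^ 3 + 1 + real k + 6 * C2"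
  define C where "C = 1 + real t + real k * B + 2 * C2"
  have "eventually (\<lambda>l. 1 < l \<and> 2 ^ h * real t * real h < l \<and> real h / d < l \<and> real t / z < l \<and> 12 * (real k + 1) < l
      \<and> 8 * C2 < l \<and> (real t + (real k - 1) * (6 * C2)) / d ^ 3 < l \<and> real t + real k * B < l \<and> c < l
      \<and> 2 * C < l \<and> 32 * (2 * C * (real k)\<^sup>2 + C\<^sup>2) < l \<and> 4 * (real k)\<^sup>2 + 2 * real k < l) at_top"
    by (intro eventually_conj eventually_gt_at_top)
  then obtain L :: real where L: "\<And>l. L \<le> l \<Longrightarrow> 1 < l \<and> 2 ^ h * real t * real h < l \<and> real h / d < l \<and> real t / z < l
      \<and> 12 * (real k + 1) < l
      \<and> 8 * C2 < l \<and> (real t + (real k - 1) * (6 * C2)) / d ^ 3 < l \<and> real t + real k * B < l \<and> c < l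
      \<and> 2 * C < l \<and> 32 * (2 * C * (real k)\<^sup>2 + C\<^sup>2) < l \<and> 4 * (real k)\<^sup>2 + 2 * real k < l"
    unfolding eventually_at_top_linorder by blast
  have gle: "real (M mod k * (k - M mod k)) / real k \<le> real k" for M
  proof -
    have "M mod k * (k - M mod k) \<le> k * k" using k0 by (intro mult_le_mono) (auto intro: less_imp_le)
    then have "real (M mod k * (k - M mod k)) \<le> real (k * k)" by (simp only: of_nat_le_iff)
    then show ?thesis using k0 by (simp add: divide_le_eq)
  qed
  \<comment> \<open>Since \<open>lam\<^sup>2\<close> will be at least
    \<open>real M - real k\<close>, this makes \<open>lam\<close> at least \<open>L\<close>.\<close>
  define m0 where "m0 = (k choose 2) + k + nat \<lceil>L\<^sup>2\<rceil>"
  have key: "graph_iso G (Ssplit k (card G))"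
    if G: "simple_graph G" and free: "\<not> contains_subgraph G (Kplus k t)" and m: "m0 \<le> card G"
      and ge: "spec_rad (Ssplit k (card G)) \<le> spec_rad G" for G :: "'a set set"
  proof -
    define M where "M = card G - (k choose 2)"
    define lam where "lam = spec_rad G"
    define lS where "lS = spec_rad (Ssplit k (card G))"
    have mk: "k + (k choose 2) \<le> card G" using m by (simp add: m0_def)
    have cM: "card G = M + (k choose 2)" using mk by (simp add: M_def)
    then have mM: "real (card G) = real M + real k * (real k - 1) / 2" by (simp add: real_choose_two)
    have S1: "real M - real (M mod k * (k - M mod k)) / real k \<le> lS\<^sup>2 - (real k - 1) * lS"
      using spec_rad_Ssplit_ge(1)[OF k2 mk] by (simp add: lS_def M_def)
    have S2: "0 < lS" using spec_rad_Ssplit_ge(2)[OF k2 mk] by (simp add: lS_def)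
    have Mbig: "L\<^sup>2 \<le> real M - real k" "0 \<le> real M - real k"
    proof -
      have "k + nat \<lceil>L\<^sup>2\<rceil> \<le> M" using m by (simp add: m0_def M_def)
      then have "real k + real (nat \<lceil>L\<^sup>2\<rceil>) \<le> real M" by (metis of_nat_add of_nat_le_iff)
      moreover have "L\<^sup>2 \<le> real (nat \<lceil>L\<^sup>2\<rceil>)" by linarith
      ultimately show "L\<^sup>2 \<le> real M - real k" by linarith
      then show "0 \<le> real M - real k" using zero_le_power2[of L] by linarith
    qed
    have pos: "0 \<le> lS * (lS - (real k - 1))"
      using S1 gle[of M] Mbig(2) by (simp add: power2_eq_square algebra_simps)
    then have lk: "0 \<le> lS - (real k - 1)" using S2 by (simp add: zero_le_mult_iff)
    \<comment> \<open>The function \<open>y * (y - (k - 1))\<close> is increasing for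
      \<open>y \<ge> k - 1\<close>, and \<open>lk\<close> places \<open>lS\<close> in that
      range.\<close>
    have "lS * (lS - (real k - 1)) \<le> lam * (lam - (real k - 1))"
      using ge S2 lk by (intro mult_mono) (auto simp: lS_def lam_def)
    then have sharp: "real M - real (M mod k * (k - M mod k)) / real k \<le> lam\<^sup>2 - (real k - 1) * lam"
      using S1 by (simp add: power2_eq_square algebra_simps)
    have lam0: "0 \<le> lam" using ge S2 by (simp add: lS_def lam_def)
    have "0 \<le> (real k - 1) * lam" using k0 lam0 by simp
    then have "L\<^sup>2 \<le> lam\<^sup>2" using sharp gle[of M] Mbig by linarith
    then have "L \<le> lam" using lam0 by (rule power2_le_imp_le)
    note big = L[OF this]
    have "0 < card G" using mk k0 by linarith
    then have ne: "G \<noteq> {}" by auto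
    obtain x u where x: "\<And>v. 0 \<le> x v" "\<And>v. x v \<le> 1" "u \<in> verts G" "x u = (1::real)"
      "\<And>v. v \<in> verts G \<Longrightarrow> (\<Sum>w\<in>verts G. of_bool ({v, w} \<in> G) * x w) = lam * x v"
    proof (rule spec_rad_vector[OF G ne], goal_cases)
      case (1 x u)
      show ?case by (rule 1(1)[OF 1(2-6)[folded lam_def]])
    qed
    have "0 \<le> real k * (real k - 1) / 2" using k0 by simp
    then have c0: "0 \<le> c" by (simp add: c_def)
    interpret kfree_eigen "verts G" "\<lambda>v w. {v, w} \<in> G" k t x lam u "real (card G)" c
    proof
      show "{w, v} \<in> G" if "{v, w} \<in> G" for v w using that by (simp add: insert_commute)
      show "{v, v} \<notin> G" for v by (rule graph_verts(3)[OF G])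
      show "v \<in> verts G" if "{v, w} \<in> G" for v w using graph_verts(2)[OF G that] .
      show "card {w \<in> verts G. \<forall>s\<in>S. {s, w} \<in> G} \<le> t"
        if "card S = k + 1" "p \<in> S" "q \<in> S" "{p, q} \<in> G" for S p q
        using common_neighbours_le[OF G free _ that] k0 by simp
      show "1 \<le> lam" using big by simp
      show "real (card G) - c \<le> lam\<^sup>2 - (real k - 1) * lam"
        using sharp gle[of M] mM by (simp add: c_def)
      show "(\<Sum>v\<in>verts G. \<Sum>w\<in>verts G. of_bool ({v, w} \<in> G)) = 2 * real (card G)"
        by (rule handshake[OF G])
    qed (use graph_verts(1)[OF G] k2 x c0 in auto)
    have "\<exists>A\<subseteq>verts G. card A = k \<and> (\<forall>p\<in>A. \<forall>q\<in>A. p \<noteq> q \<longrightarrow> {p, q} \<in> G)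
        \<and> (\<forall>p\<in>verts G - A. \<forall>q\<in>verts G - A. {p, q} \<notin> G)
        \<and> card {v \<in> verts G - A. 0 < card {p \<in> A. {p, v} \<in> G} \<and> card {p \<in> A. {p, v} \<in> G} < k} \<le> 1"
      by (rule split_structure_exists[OF z_def d_def h C2_def B_def C_def mM sharp]) (use big in blast)+
    then obtain A where A: "A \<subseteq> verts G" "card A = k" "\<forall>p\<in>A. \<forall>q\<in>A. p \<noteq> q \<longrightarrow> {p, q} \<in> G"
      "\<forall>p\<in>verts G - A. \<forall>q\<in>verts G - A. {p, q} \<notin> G"
      "card {v \<in> verts G - A. 0 < card {p \<in> A. {p, v} \<in> G} \<and> card {p \<in> A. {p, v} \<in> G} < k} \<le> 1"
      by - (elim exE conjE, rule that)
    show ?thesis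
      by (rule graph_iso_Ssplit[OF G A(1,2) k0 A(3)[rule_format] A(4)[rule_format] A(5)])
  qed
  show ?thesis
  proof (intro exI[of _ m0] allI impI)
    fix m and G :: "'a set set"
    assume "m0 \<le> m" and "simple_graph G \<and> card G = m \<and> \<not> contains_subgraph G (Kplus k t)"
    then have G: "simple_graph G" "card G = m" "\<not> contains_subgraph G (Kplus k t)" "m0 \<le> card G" by auto
    have iso: "graph_iso G (Ssplit k m)" if "spec_rad (Ssplit k m) \<le> spec_rad G"
      using key[OF G(1,3,4)] that G(2) by simp
    have eq: "spec_rad G = spec_rad (Ssplit k m)" if "graph_iso G (Ssplit k m)"
      by (rule spec_rad_iso[OF G(1) that])
    show "spec_rad G \<le> spec_rad (Ssplit k m) \<and>
        (spec_rad G = spec_rad (Ssplit k m) \<longleftrightarrow> graph_iso G (Ssplit k m))"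
      using iso eq by fastforce
  qed
qed

end
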